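(* Let $\Phi$ be an arbitrary symmetric norming function and let $\mathscr{A}\colon\Omega\to\mathcal{B}(\mathcal{H})$ be a weakly$^*$ integrable function. Assume that $\mathscr{A}_t\in\mathcal{C}_\Phi^{(\circ)}(\mathcal{H})$ for all $t\in\Omega$, that $\int_E\mathscr{A}\,d\mu\in\mathcal{C}_\Phi(\mathcal{H})$ for every $E\in\mathfrak{M}$, and that the vector measure $\nu_{\mathscr{A}}\colon\mathfrak{M}\to\mathcal{C}_\Phi(\mathcal{H})$, $\nu_{\mathscr{A}}(E)=\int_E\mathscr{A}\,d\mu$, is countably additive (with respect to the norm $\|\cdot\|_\Phi$). Then $\mathscr{A}\in\mathbb{P}(\Omega,\mu,\mathcal{C}_\Phi^{(\circ)}(\mathcal{H}))$, i.e. $\mathscr{A}$ is Pettis integrable as a $\mathcal{C}_\Phi^{(\circ)}(\mathcal{H})$-valued function.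
   Context: $\mathcal{H}$ is an infinite-dimensional separable complex Hilbert space, $\mathcal{B}(\mathcal{H})$ the bounded linear operators on it. $(\Omega,\mathfrak{M},\mu)$ is a measure space with complete measure $\mu$. Symmetric norming (s.n.) function: a norm $\Phi$ on finitely supported sequences with $\Phi(1,0,0,\dots)=1$, depending only on the absolute values of the entries and invariant under permutations of the entries. It is extended by $\Phi(a)=\lim_n\Phi(a_1,\dots,a_n,0,0,\dots)$, and $\mathfrak{c}_\Phi$ is the set of complex sequences $a$ converging to $0$ with $\Phi(a)<+\infty$. $\mathcal{C}_\Phi(\mathcal{H})$ is the ideal of compact operators $A$ whose singular value sequence $(s_n(A))_{n\ge1}$ (decreasing) lies in $\mathfrak{c}_\Phi$, with norm $\|A\|_\Phi=\Phi((s_n(A))_n)$. $\mathcal{C}_\Phi^{(\circ)}(\mathcal{H})$ is the $\|\cdot\|_\Phi$-closure of the finite-rank operators in $\mathcal{C}_\Phi(\mathcal{H})$. Measurability: a scalar function on $\Omega$ is $\mu$-measurable if it is a $\mu$-a.e. limit of $\mu$-simple functions $\sum_{k=1}^m x_k\chi_{A_k}$ with $A_k\in\mathfrak{M}$ disjoint of finite measure. $\mathscr{A}\colon\Omega\to\mathcal{B}(\mathcal{H})$, $t\mapsto\mathscr{A}_t$, is weakly$^*$ integrable if for every $f\in\mathcal{H}$ the function $t\mapsto\langle\mathscr{A}_tf,f\rangle$ is $\mu$-measurable and integrable. Then for each $E\in\mathfrak{M}$ the weak$^*$ integral $\int_E\mathscr{A}\,d\mu\in\mathcal{B}(\mathcal{H})$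 is the unique operator with $\langle(\int_E\mathscr{A}\,d\mu)f,g\rangle=\int_E\langle\mathscr{A}_tf,g\rangle\,d\mu(t)$ for all $f,g\in\mathcal{H}$. Pettis integrability: for a Banach space $X$, $\varphi\colon\Omega\to X$ is Pettis integrable ($\varphi\in\mathbb{P}(\Omega,\mu,X)$) if $t\mapsto\langle\varphi(t),x^*\rangle$ is $\mu$-measurable and integrable for every $x^*\in X^*$ and for every $E\in\mathfrak{M}$ there is $\varphi_E\in X$ with $\langle\varphi_E,x^*\rangle=\int_E\langle\varphi(t),x^*\rangle\,d\mu(t)$ for every $x^*\in X^*$. A vector measure $\nu\colon\mathfrak{M}\to X$ is countably additive if $\nu(\bigsqcup_nE_n)=\sum_n\nu(E_n)$ in the norm of $X$ for every sequence of pairwise disjoint $E_n\in\mathfrak{M}$. *)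

theory Defs
  imports "HOL-Analysis.Analysis"
begin

section \<open>Complex Hilbert spaces\<close>

class complex_vector = real_vector +
  fixes scaleC :: "complex \<Rightarrow> 'a \<Rightarrow> 'a" (infixr "*\<^sub>C" 75)
  assumes scaleC_add_right: "a *\<^sub>C (x + y) = a *\<^sub>C x + a *\<^sub>C y"
    and scaleC_add_left: "(a + b) *\<^sub>C x = a *\<^sub>C x + b *\<^sub>C x"
    and scaleC_scaleC: "a *\<^sub>C (b *\<^sub>C x) = (a * b) *\<^sub>C x"
    and scaleC_one: "1 *\<^sub>C x = x"
    and scaleC_of_real: "complex_of_real r *\<^sub>C x = r *\<^sub>R x"

global_interpretation complex_vector: vector_space "scaleC :: complex \<Rightarrow> 'a \<Rightarrow> 'a :: complex_vector"
  defines cspan = complex_vector.span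
    and cdim = complex_vector.dim
  by unfold_locales (auto simp: scaleC_add_right scaleC_add_left scaleC_scaleC scaleC_one)

class complex_normed_vector = complex_vector + real_normed_vector +
  assumes norm_scaleC: "norm (a *\<^sub>C x) = cmod a * norm x"

text \<open>The inner product is linear in the first and conjugate-linear in the second argument.\<close>

class complex_hilbert_space = complex_normed_vector + banach +
  fixes cinner :: "'a \<Rightarrow> 'a \<Rightarrow> complex"
  assumes cinner_commute: "cinner x y = cnj (cinner y x)"
    and cinner_add_left: "cinner (x + y) z = cinner x z + cinner y z"
    and cinner_scaleC_left: "cinner (a *\<^sub>C x) y = a * cinner x y"
    and cinner_ge_zero: "0 \<le> Re (cinner x x)"
    and norm_eq_sqrt_cinner: "norm x = sqrt (Re (cinner x x))"

definition infinite_dimensional :: "'h::complex_vector itself \<Rightarrow> bool" where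
  "infinite_dimensional _ \<longleftrightarrow> \<not> (\<exists>B::'h set. finite B \<and> cspan B = UNIV)"


section \<open>Operators on a complex Hilbert space\<close>

text \<open>
  The type of bounded operators in the library consists of the bounded \<^emph>\<open>real\<close>-linear maps;
  \<open>bounded_ops\<close> carves out the complex-linear ones.
\<close>

instantiation blinfun :: (real_normed_vector, complex_normed_vector) complex_vector
begin

lift_definition scaleC_blinfun :: "complex \<Rightarrow> 'a \<Rightarrow>\<^sub>L 'b \<Rightarrow> 'a \<Rightarrow>\<^sub>L 'b"
  is "\<lambda>c f x. c *\<^sub>C f x"
proof -
  fix c :: complex and f :: "'a \<Rightarrow> 'b"
  assume f: "bounded_linear f"
  have "bounded_linear (\<lambda>y::'b. c *\<^sub>C y)"
    by (rule bounded_linear_intro[where K = "cmod c"])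
      (simp_all add: scaleC_add_right norm_scaleC mult.commute scaleC_scaleC
        flip: scaleC_of_real)
  from bounded_linear_compose[OF this f] show "bounded_linear (\<lambda>x. c *\<^sub>C f x)" .
qed

instance
  by standard (transfer, simp add: scaleC_add_right scaleC_add_left scaleC_scaleC scaleC_one
      scaleC_of_real)+

end

definition bounded_ops :: "('h::complex_hilbert_space \<Rightarrow>\<^sub>L 'h) set" where
  "bounded_ops = {A. \<forall>c x. blinfun_apply A (c *\<^sub>C x) = c *\<^sub>C blinfun_apply A x}"

definition cadjoint :: "('h::complex_hilbert_space \<Rightarrow>\<^sub>L 'h) \<Rightarrow> 'h \<Rightarrow>\<^sub>L 'h" where
  "cadjoint A = (THE B. B \<in> bounded_ops \<and>
     (\<forall>x y. cinner (blinfun_apply A x) y = cinner x (blinfun_apply B y)))"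

definition compact_ops :: "('h::complex_hilbert_space \<Rightarrow>\<^sub>L 'h) set" where
  "compact_ops = {A \<in> bounded_ops. compact (closure (blinfun_apply A ` cball 0 1))}"

definition finite_rank_ops :: "('h::complex_hilbert_space \<Rightarrow>\<^sub>L 'h) set" where
  "finite_rank_ops = {A \<in> bounded_ops. \<exists>B. finite B \<and> range (blinfun_apply A) \<subseteq> cspan B}"

text \<open>
  The singular values of a compact operator \<open>A\<close> are the square roots of the eigenvalues of
  \<open>A\<^sup>* A\<close>, in decreasing order and repeated according to multiplicity, followed by zeros if
  \<open>A\<close> has finite rank.  (If \<open>A\<close> has infinite rank, an eigenvalue \<open>0\<close> does not occur in the
  sequence.)  Sequences are indexed from \<open>0\<close>.
\<close>

definition singular_values :: "('h::complex_hilbert_space \<Rightarrow>\<^sub>L 'h) \<Rightarrow> nat \<Rightarrow> real" where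
  "singular_values A = (THE s. decseq s \<and> (\<forall>n. 0 \<le> s n) \<and>
     (\<forall>l>0. finite {n. s n = l} \<and>
       card {n. s n = l} =
         cdim {x. blinfun_apply (cadjoint A o\<^sub>L A) x = complex_of_real (l\<^sup>2) *\<^sub>C x}))"


section \<open>Symmetric norming functions and the associated ideals\<close>

definition finsupp :: "(nat \<Rightarrow> complex) set" where
  "finsupp = {a. finite {n. a n \<noteq> 0}}"

text \<open>Only the values of \<open>\<Phi>\<close> on \<open>finsupp\<close> matter.\<close>

definition sn_function :: "((nat \<Rightarrow> complex) \<Rightarrow> real) \<Rightarrow> bool" where
  "sn_function \<Phi> \<longleftrightarrow>
     (\<forall>a\<in>finsupp. 0 \<le> \<Phi> a \<and> (\<Phi> a = 0 \<longleftrightarrow> a = (\<lambda>_. 0))) \<and>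
     (\<forall>a\<in>finsupp. \<forall>c. \<Phi> (\<lambda>n. c * a n) = cmod c * \<Phi> a) \<and>
     (\<forall>a\<in>finsupp. \<forall>b\<in>finsupp. \<Phi> (\<lambda>n. a n + b n) \<le> \<Phi> a + \<Phi> b) \<and>
     \<Phi> (\<lambda>n. if n = 0 then 1 else 0) = 1 \<and>
     (\<forall>a\<in>finsupp. \<forall>b\<in>finsupp. (\<forall>n. cmod (a n) = cmod (b n)) \<longrightarrow> \<Phi> a = \<Phi> b) \<and>
     (\<forall>a\<in>finsupp. \<forall>\<pi>. bij \<pi> \<longrightarrow> \<Phi> (\<lambda>n. a (\<pi> n)) = \<Phi> a)"

text \<open>The truncations have increasing \<open>\<Phi>\<close>-norms, so the limit exists in \<open>[0, \<infinity>]\<close>.\<close>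

definition sn_ext :: "((nat \<Rightarrow> complex) \<Rightarrow> real) \<Rightarrow> (nat \<Rightarrow> complex) \<Rightarrow> ereal" where
  "sn_ext \<Phi> a = lim (\<lambda>n. ereal (\<Phi> (\<lambda>k. if k < n then a k else 0)))"

definition sn_space :: "((nat \<Rightarrow> complex) \<Rightarrow> real) \<Rightarrow> (nat \<Rightarrow> complex) set" where
  "sn_space \<Phi> = {a. a \<longlonglongrightarrow> 0 \<and> sn_ext \<Phi> a < \<infinity>}"

definition C_ideal ::
    "((nat \<Rightarrow> complex) \<Rightarrow> real) \<Rightarrow> ('h::complex_hilbert_space \<Rightarrow>\<^sub>L 'h) set" where
  "C_ideal \<Phi> = {A \<in> compact_ops. (\<lambda>n. complex_of_real (singular_values A n)) \<in> sn_space \<Phi>}"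

text \<open>To be used on \<open>C_ideal\<close> only: the value \<open>\<infinity>\<close> is mapped to the junk value \<open>0\<close>.\<close>

definition C_norm ::
    "((nat \<Rightarrow> complex) \<Rightarrow> real) \<Rightarrow> ('h::complex_hilbert_space \<Rightarrow>\<^sub>L 'h) \<Rightarrow> real" where
  "C_norm \<Phi> A = real_of_ereal (sn_ext \<Phi> (\<lambda>n. complex_of_real (singular_values A n)))"

definition C0_ideal ::
    "((nat \<Rightarrow> complex) \<Rightarrow> real) \<Rightarrow> ('h::complex_hilbert_space \<Rightarrow>\<^sub>L 'h) set" where
  "C0_ideal \<Phi> = {A \<in> C_ideal \<Phi>. \<forall>e>0. \<exists>F \<in> C_ideal \<Phi> \<inter> finite_rank_ops. C_norm \<Phi> (A - F) < e}"


section \<open>Measurability and integrability\<close>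

definition mu_simple :: "'t measure \<Rightarrow> ('t \<Rightarrow> complex) \<Rightarrow> bool" where
  "mu_simple M f \<longleftrightarrow> (\<exists>(m::nat) (x :: nat \<Rightarrow> complex) (A :: nat \<Rightarrow> 't set).
     (\<forall>k<m. A k \<in> sets M \<and> emeasure M (A k) < \<infinity>) \<and>
     disjoint_family_on A {..<m} \<and>
     (\<forall>t\<in>space M. f t = (\<Sum>k<m. x k * indicator (A k) t)))"

definition mu_measurable :: "'t measure \<Rightarrow> ('t \<Rightarrow> complex) \<Rightarrow> bool" where
  "mu_measurable M f \<longleftrightarrow>
     (\<exists>s. (\<forall>n. mu_simple M (s n)) \<and> (AE t in M. (\<lambda>n. s n t) \<longlonglongrightarrow> f t))"

definition weak_star_integrable ::
    "'t measure \<Rightarrow> ('t \<Rightarrow> 'h::complex_hilbert_space \<Rightarrow>\<^sub>L 'h) \<Rightarrow> bool" where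
  "weak_star_integrable M A \<longleftrightarrow>
     (\<forall>t\<in>space M. A t \<in> bounded_ops) \<and>
     (\<forall>f. mu_measurable M (\<lambda>t. cinner (blinfun_apply (A t) f) f) \<and>
          integrable M (\<lambda>t. cinner (blinfun_apply (A t) f) f))"

definition weak_star_integral ::
    "'t measure \<Rightarrow> ('t \<Rightarrow> 'h::complex_hilbert_space \<Rightarrow>\<^sub>L 'h) \<Rightarrow> 't set \<Rightarrow> 'h \<Rightarrow>\<^sub>L 'h" where
  "weak_star_integral M A E = (THE T. T \<in> bounded_ops \<and>
     (\<forall>f g. cinner (blinfun_apply T f) g = (LINT t:E|M. cinner (blinfun_apply (A t) f) g)))"

text \<open>
  In the following, a normed space is given by a complex subspace \<open>X\<close> of a complex vector space
  together with a function \<open>N\<close> that is a norm on \<open>X\<close>.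
\<close>

definition countably_additive_in ::
    "('v::complex_vector \<Rightarrow> real) \<Rightarrow> 't measure \<Rightarrow> ('t set \<Rightarrow> 'v) \<Rightarrow> bool" where
  "countably_additive_in N M \<nu> \<longleftrightarrow>
     (\<forall>E :: nat \<Rightarrow> 't set. range E \<subseteq> sets M \<and> disjoint_family E \<longrightarrow>
        (\<lambda>n. N (\<nu> (\<Union>i. E i) - (\<Sum>i<n. \<nu> (E i)))) \<longlonglongrightarrow> 0)"

definition dual_space ::
    "'v::complex_vector set \<Rightarrow> ('v \<Rightarrow> real) \<Rightarrow> ('v \<Rightarrow> complex) set" where
  "dual_space X N = {l.
     (\<forall>x\<in>X. \<forall>y\<in>X. l (x + y) = l x + l y) \<and>
     (\<forall>c. \<forall>x\<in>X. l (c *\<^sub>C x) = c * l x) \<and>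
     (\<exists>K. \<forall>x\<in>X. cmod (l x) \<le> K * N x)}"

definition pettis_integrable ::
    "'t measure \<Rightarrow> 'v::complex_vector set \<Rightarrow> ('v \<Rightarrow> real) \<Rightarrow> ('t \<Rightarrow> 'v) \<Rightarrow> bool" where
  "pettis_integrable M X N \<phi> \<longleftrightarrow>
     (\<forall>t\<in>space M. \<phi> t \<in> X) \<and>
     (\<forall>l\<in>dual_space X N. mu_measurable M (\<lambda>t. l (\<phi> t)) \<and> integrable M (\<lambda>t. l (\<phi> t))) \<and>
     (\<forall>E\<in>sets M. \<exists>v\<in>X. \<forall>l\<in>dual_space X N. l v = (LINT t:E|M. l (\<phi> t)))"

end

(*
  Let P_n be the projections onto the initial segments of an orthonormal basis.  Everything rests on
  the variational formula |A|_Phi = sup Phi(<A x_1, y_1>, ..., <A x_n, y_n>) over finite Bessel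
  families (x_i), (y_i), which follows from the singular value decomposition and the monotonicity of
  Phi under weak majorization.  It makes |.|_Phi a lower semicontinuous norm that decreases under
  A |-> P_n A P_n, and C_Phi^0 becomes the set of A in C_Phi with |A - P_n A P_n|_Phi -> 0.

  (1) nu(E) lies in C_Phi^0: for a near-optimal pair of Bessel families for nu(E) - P_n nu(E) P_n,
  Jensen's inequality bounds the norm by an integral of functions tending to 0 pointwise.  On suitable
  sets S_k exhausting Omega these functions are dominated, and the remainder |nu(E - S_k)|_Phi is small
  by countable additivity.
  (2) For a functional l, the functions l(P_n A_t P_n) are integrable combinations of matrix entries
  and converge to l(A_t).  Dominated convergence on exhausting sets S_k gives
  int_{E cap S_k} l(A_t) = l(nu(E cap S_k)), and countable additivity makes the right-hand side converge
  for every E.  Taking E = {Re l(A_t) > 0} and the like yields integrability of l(A_t) and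
  int_E l(A_t) = l(nu(E)).
*)

theory Submission
  imports Defs
begin

section \<open>Inner products\<close>

text \<open>Nothing bounds the integral of |A_t|_Phi, so neither limit passage has a majorant on all
  of Omega. Its substitute is a pointwise bound: for each t the sequence in question converges,
  hence is bounded, and a weighted sum of countably many integrable functions yields both the sets
  S_k and the majorants on them. Countable additivity controls only the part outside S_k. Step (1)
  cannot be bypassed: nu(E) is given in C_Phi only, where compressions may fail to converge and a
  functional on C_Phi^0 has no prescribed value. Bessel families instead of orthonormal ones are
  forced by P_n, since projecting an orthonormal family destroys orthonormality but not Bessel's
  inequality. Functionals are never represented by operators; they are known only through continuity
  and their values on rank-one matrix units. Singular values, adjoints and weak* integrals are
  definite descriptions, so each needs a proof of existence and uniqueness; for the weak* integral,
  existence takes uniform boundedness twice.\<close>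

lemma mult_cnj_eq_cmod: "z * cnj z = (of_real (cmod z))\<^sup>2" "cnj z * z = (of_real (cmod z))\<^sup>2"
  using complex_norm_square[of z] by (simp_all add: mult.commute)

lemma cinner_add_right: "cinner x (y + z) = cinner x y + cinner x (z::'h::complex_hilbert_space)"
  by (metis cinner_add_left cinner_commute complex_cnj_add)

lemma cinner_scaleC_right: "cinner x (a *\<^sub>C y) = cnj a * cinner x (y::'h::complex_hilbert_space)"
  by (metis cinner_scaleC_left cinner_commute complex_cnj_mult)

lemma cinner_scaleR_left: "cinner (r *\<^sub>R x) y = of_real r * cinner x (y::'h::complex_hilbert_space)"
  by (metis cinner_scaleC_left scaleC_of_real)

lemma cinner_scaleR_right: "cinner x (r *\<^sub>R y) = of_real r * cinner x (y::'h::complex_hilbert_space)"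
  by (metis cinner_scaleC_right scaleC_of_real complex_cnj_complex_of_real)

lemma cinner_zero_left [simp]: "cinner 0 (y::'h::complex_hilbert_space) = 0"
  by (metis cinner_scaleR_left mult_zero_left of_real_0 scaleR_zero_left)

lemma cinner_zero_right [simp]: "cinner (y::'h::complex_hilbert_space) 0 = 0"
  by (metis cinner_commute cinner_zero_left complex_cnj_zero)

lemma cinner_minus_left: "cinner (- x) y = - cinner x (y::'h::complex_hilbert_space)"
  using cinner_scaleR_left[of "-1" x y] by simp

lemma cinner_minus_right: "cinner x (- y) = - cinner x (y::'h::complex_hilbert_space)"
  using cinner_scaleR_right[of x "-1" y] by simp

lemma cinner_diff_left: "cinner (x - y) z = cinner x z - cinner y (z::'h::complex_hilbert_space)"
  using cinner_add_left[of x "- y" z] by (simp add: cinner_minus_left)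

lemma cinner_diff_right: "cinner x (y - z) = cinner x y - cinner x (z::'h::complex_hilbert_space)"
  using cinner_add_right[of x y "- z"] by (simp add: cinner_minus_right)

lemma cinner_sum_left: "cinner (\<Sum>i\<in>I. f i) y = (\<Sum>i\<in>I. cinner (f i) (y::'h::complex_hilbert_space))"
  by (induction I rule: infinite_finite_induct) (simp_all add: cinner_add_left)

lemma cinner_sum_right: "cinner y (\<Sum>i\<in>I. f i) = (\<Sum>i\<in>I. cinner (y::'h::complex_hilbert_space) (f i))"
  by (induction I rule: infinite_finite_induct) (simp_all add: cinner_add_right)

lemma cinner_self: "cinner x x = of_real ((norm (x::'h::complex_hilbert_space))\<^sup>2)"
proof -
  have "Im (cinner x x) = 0"
    using arg_cong[OF cinner_commute[of x x], of Im] by simp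
  moreover have "Re (cinner x x) = (norm x)\<^sup>2"
    using cinner_ge_zero[of x] by (simp add: norm_eq_sqrt_cinner)
  ultimately show ?thesis by (simp add: complex_eq_iff)
qed

lemma cinner_self_eq_0: "cinner x x = 0 \<longleftrightarrow> x = (0::'h::complex_hilbert_space)"
  by (simp add: cinner_self)

lemma cmod_cinner_commute: "cmod (cinner x y) = cmod (cinner y (x::'h::complex_hilbert_space))"
  by (metis cinner_commute complex_mod_cnj)

lemma norm_diff_squared:
  "(norm (x - y))\<^sup>2 = (norm x)\<^sup>2 - 2 * Re (cinner x y) + (norm (y::'h::complex_hilbert_space))\<^sup>2"
proof -
  have "complex_of_real ((norm (x - y))\<^sup>2) = cinner x x - (cinner x y + cinner y x) + cinner y y"
    by (simp only: cinner_self[symmetric] cinner_diff_left cinner_diff_right) simp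
  also have "cinner x y + cinner y x = of_real (2 * Re (cinner x y))"
    by (subst cinner_commute[of y x]) (simp add: complex_add_cnj)
  finally have "complex_of_real ((norm (x - y))\<^sup>2) =
    of_real ((norm x)\<^sup>2 - 2 * Re (cinner x y) + (norm y)\<^sup>2)"
    by (simp only: cinner_self of_real_add of_real_diff)
  then show ?thesis by (simp only: of_real_eq_iff)
qed

lemma norm_add_squared:
  "(norm (x + y))\<^sup>2 = (norm x)\<^sup>2 + 2 * Re (cinner x y) + (norm (y::'h::complex_hilbert_space))\<^sup>2"
  using norm_diff_squared[of x "- y"] by (simp add: cinner_minus_right)

lemma cinner_Cauchy_Schwarz: "cmod (cinner x y) \<le> norm x * norm (y::'h::complex_hilbert_space)"
proof (cases "y = 0")
  case False
  \<comment> \<open>\<open>c *\<^sub>C y\<close> is the orthogonal projection of \<open>x\<close>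
    onto the line of \<open>y\<close>; the inequality is the nonnegativity of the squared distance
    between the two.\<close>
  define c where "c = cinner x y / of_real ((norm y)\<^sup>2)"
  have ny: "norm y > 0" using False by simp
  have "cinner x (c *\<^sub>C y) = of_real ((cmod (cinner x y))\<^sup>2 / (norm y)\<^sup>2)"
    by (simp add: cinner_scaleC_right c_def complex_mult_cnj cmod_power2 mult.commute)
  then have r: "Re (cinner x (c *\<^sub>C y)) = (cmod (cinner x y))\<^sup>2 / (norm y)\<^sup>2"
    by simp
  have n: "(norm (c *\<^sub>C y))\<^sup>2 = (cmod (cinner x y))\<^sup>2 / (norm y)\<^sup>2"
    using ny by (simp add: norm_scaleC c_def norm_divide norm_power power_mult_distrib power_divide)
        (simp add: power2_eq_square power4_eq_xxxx field_simps)
  have "0 \<le> (norm (x - c *\<^sub>C y))\<^sup>2" by simp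
  also have "\<dots> = (norm x)\<^sup>2 - (cmod (cinner x y))\<^sup>2 / (norm y)\<^sup>2"
    unfolding norm_diff_squared r n by simp
  finally have "(cmod (cinner x y))\<^sup>2 \<le> (norm x * norm y)\<^sup>2"
    using ny by (simp add: field_simps power_mult_distrib)
  then show ?thesis by (rule power2_le_imp_le) simp
qed simp

lemma bounded_bilinear_cinner: "bounded_bilinear (cinner :: 'h::complex_hilbert_space \<Rightarrow> 'h \<Rightarrow> complex)"
  by unfold_locales
    (auto simp: cinner_add_left cinner_add_right cinner_scaleR_left cinner_scaleR_right
      scaleR_conv_of_real intro!: exI[of _ 1] cinner_Cauchy_Schwarz)

lemmas tendsto_cinner = bounded_bilinear.tendsto[OF bounded_bilinear_cinner]
lemmas continuous_on_cinner = bounded_bilinear.continuous_on[OF bounded_bilinear_cinner]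

lemma cinner_eqI: "(\<And>y. cinner x y = cinner z y) \<Longrightarrow> x = (z::'h::complex_hilbert_space)"
  using cinner_self_eq_0[of "x - z"] by (simp add: cinner_diff_left)

text \<open>Weak* integrability speaks only of the diagonal values \<open>cinner (A t f) f\<close>;
  polarization carries it over to all matrix coefficients.\<close>

lemma cinner_polarization:
  fixes f g :: "'h::complex_hilbert_space"
  assumes "A \<in> bounded_ops"
  shows "cinner (A f) g = (cinner (A (f + g)) (f + g) - cinner (A (f - g)) (f - g)
    + \<i> * cinner (A (f + \<i> *\<^sub>C g)) (f + \<i> *\<^sub>C g) - \<i> * cinner (A (f - \<i> *\<^sub>C g)) (f - \<i> *\<^sub>C g)) / 4"
  using assms
  by (simp add: bounded_ops_def blinfun.add_right blinfun.diff_right cinner_add_left cinner_add_right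
    cinner_diff_left cinner_diff_right cinner_scaleC_left cinner_scaleC_right algebra_simps)

lemma blinfun_apply_scaleC: "blinfun_apply (c *\<^sub>C A) x = c *\<^sub>C blinfun_apply A x"
  by (simp add: scaleC_blinfun.rep_eq)

lemma bounded_linear_scaleC_right: "bounded_linear (\<lambda>y::'h::complex_normed_vector. c *\<^sub>C y)"
  by (rule bounded_linear_intro[where K = "cmod c"])
    (simp_all add: scaleC_add_right norm_scaleC mult.commute scaleC_scaleC flip: scaleC_of_real)

lemma bounded_ops_scaleC: "A \<in> bounded_ops \<Longrightarrow> A (c *\<^sub>C x) = c *\<^sub>C A x"
  by (simp add: bounded_ops_def)

lemma bounded_ops_add: "A \<in> bounded_ops \<Longrightarrow> B \<in> bounded_ops \<Longrightarrow> A + B \<in> bounded_ops"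
  by (simp add: bounded_ops_def blinfun.add_left scaleC_add_right)

lemma bounded_ops_scale: "A \<in> bounded_ops \<Longrightarrow> c *\<^sub>C A \<in> bounded_ops"
  by (simp add: bounded_ops_def blinfun_apply_scaleC scaleC_scaleC mult.commute)

lemma bounded_ops_zero: "0 \<in> bounded_ops"
  by (simp add: bounded_ops_def)

lemma bounded_ops_sum: "(\<And>i. i \<in> I \<Longrightarrow> f i \<in> bounded_ops) \<Longrightarrow> (\<Sum>i\<in>I. f i) \<in> bounded_ops"
  by (induction I rule: infinite_finite_induct) (auto intro: bounded_ops_add bounded_ops_zero)

lemma bounded_ops_eqI:
  fixes A B :: "'h::complex_hilbert_space \<Rightarrow>\<^sub>L 'h"
  assumes "\<And>x y. cinner (A x) y = cinner (B x) y"
  shows "A = B"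
  by (intro blinfun_eqI cinner_eqI assms)

section \<open>Bessel families\<close>

text \<open>Only the first \<open>n\<close> vectors count. The condition says that the map from
  \<open>z\<close> to its coefficients is a contraction, a property that survives applying an
  orthogonal projection to every vector.\<close>

definition bessel :: "nat \<Rightarrow> (nat \<Rightarrow> 'h::complex_hilbert_space) \<Rightarrow> bool" where
  "bessel n x \<longleftrightarrow> (\<forall>z. (\<Sum>i<n. (cmod (cinner z (x i)))\<^sup>2) \<le> (norm z)\<^sup>2)"

text \<open>Allowing zero vectors lets one family type cover finite-rank operators and Gram--Schmidt
  on linearly dependent sequences.\<close>

definition orthonormal0 :: "(nat \<Rightarrow> 'h::complex_hilbert_space) \<Rightarrow> bool" where
  "orthonormal0 e \<longleftrightarrow> (\<forall>i j. i \<noteq> j \<longrightarrow> cinner (e i) (e j) = 0) \<and> (\<forall>i. e i = 0 \<or> norm (e i) = 1)"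

definition proj :: "(nat \<Rightarrow> 'h::complex_hilbert_space) \<Rightarrow> nat \<Rightarrow> 'h \<Rightarrow> 'h" where
  "proj e n x = (\<Sum>i<n. cinner x (e i) *\<^sub>C e i)"

lemma orthonormal0_norm_le: "orthonormal0 e \<Longrightarrow> norm (e i) \<le> 1"
  unfolding orthonormal0_def by (metis norm_zero order_refl zero_le_one)

lemma orthonormal0_cinner_sum:
  assumes "orthonormal0 e" "finite I" "i \<in> I"
  shows "cinner (\<Sum>k\<in>I. c k *\<^sub>C e k) (e i) = (if e i = 0 then 0 else c i)"
proof -
  have "cinner (\<Sum>k\<in>I. c k *\<^sub>C e k) (e i) = (\<Sum>k\<in>I. if k = i then c i * cinner (e i) (e i) else 0)"
    unfolding cinner_sum_left
    by (rule sum.cong) (use assms in \<open>auto simp: cinner_scaleC_left orthonormal0_def\<close>)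
  also have "\<dots> = (if e i = 0 then 0 else c i)"
    using assms by (auto simp: cinner_self orthonormal0_def)
  finally show ?thesis .
qed

lemma orthonormal0_norm_sum:
  assumes "orthonormal0 e" "finite I"
  shows "(norm (\<Sum>k\<in>I. c k *\<^sub>C e k))\<^sup>2 = (\<Sum>k\<in>I. if e k = 0 then 0 else (cmod (c k))\<^sup>2)"
proof -
  have "cinner (\<Sum>k\<in>I. c k *\<^sub>C e k) (\<Sum>k\<in>I. c k *\<^sub>C e k) =
      (\<Sum>i\<in>I. cnj (c i) * (if e i = 0 then 0 else c i))"
    by (subst cinner_sum_right)
      (rule sum.cong, use assms in \<open>auto simp: cinner_scaleC_right orthonormal0_cinner_sum\<close>)
  also have "\<dots> = of_real (\<Sum>k\<in>I. if e k = 0 then 0 else (cmod (c k))\<^sup>2)"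
    unfolding of_real_sum
    by (rule sum.cong) (auto simp: mult_cnj_eq_cmod)
  finally show ?thesis unfolding cinner_self of_real_eq_iff .
qed

lemma orthonormal0_norm_sum_le:
  assumes "orthonormal0 e" "finite I"
  shows "(norm (\<Sum>k\<in>I. c k *\<^sub>C e k))\<^sup>2 \<le> (\<Sum>k\<in>I. (cmod (c k))\<^sup>2)"
  unfolding orthonormal0_norm_sum[OF assms] by (rule sum_mono) simp

lemma orthonormal0_Pythagoras:
  assumes "orthonormal0 e"
  shows "(norm x)\<^sup>2 = (norm (x - proj e n x))\<^sup>2 + (\<Sum>i<n. (cmod (cinner x (e i)))\<^sup>2)"
proof -
  have s: "(norm (proj e n x))\<^sup>2 = (\<Sum>i<n. (cmod (cinner x (e i)))\<^sup>2)"
    unfolding proj_def orthonormal0_norm_sum[OF assms finite_lessThan]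
    by (rule sum.cong) auto
  have "cinner x (proj e n x) = of_real (\<Sum>i<n. (cmod (cinner x (e i)))\<^sup>2)"
    unfolding proj_def cinner_sum_right of_real_sum cinner_scaleC_right
    by (rule sum.cong) (auto simp: mult_cnj_eq_cmod)
  then have "Re (cinner x (proj e n x)) = (\<Sum>i<n. (cmod (cinner x (e i)))\<^sup>2)"
    by simp
  then show ?thesis unfolding norm_diff_squared s by simp
qed

lemma orthonormal0_bessel: "orthonormal0 e \<Longrightarrow> bessel n e"
  unfolding bessel_def using orthonormal0_Pythagoras[of e] by (metis le_add_same_cancel2 zero_le_power2)

lemma bessel_L2_set:
  assumes "bessel n x" shows "L2_set (\<lambda>i. cmod (cinner z (x i))) {..<n} \<le> norm z"
  unfolding L2_set_def using assms by (intro real_le_lsqrt) (auto simp: bessel_def intro: sum_nonneg)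

text \<open>Cauchy--Schwarz for the coefficient sequences, then both Bessel bounds. It serves in two
  directions: summing over a Bessel family for fixed singular vectors, and summing over singular
  vectors for fixed members of the family.\<close>

lemma bessel_sum_mult:
  assumes "bessel n x" "bessel n y"
  shows "(\<Sum>i<n. cmod (cinner (x i) v) * cmod (cinner u (y i))) \<le> norm v * norm u"
proof -
  have "(\<Sum>i<n. \<bar>cmod (cinner v (x i))\<bar> * \<bar>cmod (cinner u (y i))\<bar>) \<le>
      L2_set (\<lambda>i. cmod (cinner v (x i))) {..<n} * L2_set (\<lambda>i. cmod (cinner u (y i))) {..<n}"
    by (rule L2_set_mult_ineq)
  also have "\<dots> \<le> norm v * norm u"
    by (intro mult_mono bessel_L2_set assms L2_set_nonneg norm_ge_zero)
  finally show ?thesis by (simp add: cmod_cinner_commute[of v])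
qed

text \<open>Testing the Bessel inequality with the member itself shows that the fourth power of its
  norm is at most the square.\<close>

lemma bessel_norm_le:
  assumes "bessel n x" "i < n" shows "norm (x i) \<le> 1"
proof -
  have "((norm (x i))\<^sup>2)\<^sup>2 = (cmod (cinner (x i) (x i)))\<^sup>2"
    by (simp only: cinner_self norm_of_real power2_abs)
  also have "\<dots> \<le> (\<Sum>j<n. (cmod (cinner (x i) (x j)))\<^sup>2)"
    using assms by (intro member_le_sum) auto
  also have "\<dots> \<le> (norm (x i))\<^sup>2"
    using assms by (simp add: bessel_def)
  finally have *: "((norm (x i))\<^sup>2)\<^sup>2 \<le> (norm (x i))\<^sup>2" .
  have "a \<le> 1" if "a\<^sup>2 \<le> a" for a :: real
    using that mult_strict_right_mono[of 1 a a] by (cases "a \<le> 1") (auto simp: power2_eq_square)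
  from this[OF *] show ?thesis by (simp add: power_le_one_iff)
qed

lemma cinner_proj_left: "cinner (proj e n x) y = cinner x (proj e n y)"
  unfolding proj_def cinner_sum_left cinner_sum_right cinner_scaleC_left cinner_scaleC_right
  by (subst (2) cinner_commute) (simp add: mult.commute)

lemma norm_proj_le:
  assumes "orthonormal0 e" shows "norm (proj e n x) \<le> norm x"
proof -
  have "(norm (proj e n x))\<^sup>2 \<le> (\<Sum>i<n. (cmod (cinner x (e i)))\<^sup>2)"
    unfolding proj_def by (rule orthonormal0_norm_sum_le[OF assms finite_lessThan])
  also have "\<dots> \<le> (norm x)\<^sup>2"
    using orthonormal0_bessel[OF assms, of n] by (simp add: bessel_def)
  finally show ?thesis by (rule power2_le_imp_le) simp
qed

text \<open>Self-adjointness moves the projection onto the test vector \<open>z\<close>, where it is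
  a contraction.\<close>

lemma bessel_proj:
  assumes "orthonormal0 e" "bessel m x" shows "bessel m (\<lambda>i. proj e n (x i))"
  unfolding bessel_def
proof
  fix z
  have "(\<Sum>i<m. (cmod (cinner z (proj e n (x i))))\<^sup>2) = (\<Sum>i<m. (cmod (cinner (proj e n z) (x i)))\<^sup>2)"
    by (simp add: cinner_proj_left)
  also have "\<dots> \<le> (norm (proj e n z))\<^sup>2" using assms(2) by (simp add: bessel_def)
  also have "\<dots> \<le> (norm z)\<^sup>2" by (intro power_mono norm_proj_le assms norm_ge_zero)
  finally show "(\<Sum>i<m. (cmod (cinner z (proj e n (x i))))\<^sup>2) \<le> (norm z)\<^sup>2" .
qed

lemma proj_diff: "proj e n (x - y) = proj e n x - proj e n y"
  by (simp add: proj_def cinner_diff_left sum_subtractf complex_vector.scale_left_diff_distrib)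

lemma proj_eq_self:
  assumes "orthonormal0 e" "x = (\<Sum>i<m. c i *\<^sub>C e i)" "m \<le> n"
  shows "proj e n x = x"
proof -
  have "x = (\<Sum>i<n. (if i < m then c i else 0) *\<^sub>C e i)"
    unfolding assms(2) by (rule sum.mono_neutral_cong_left) (use assms(3) in auto)
  then obtain d where d: "x = (\<Sum>i<n. d i *\<^sub>C e i)" by (rule that)
  show ?thesis unfolding proj_def
    by (subst (2) d, rule sum.cong[OF refl])
      (use orthonormal0_cinner_sum[OF assms(1) finite_lessThan] in \<open>auto simp: d\<close>)
qed

text \<open>Blocks of the vector series have squared norm at most the corresponding block of the
  convergent series of squared coefficients, so the partial sums are Cauchy.\<close>

lemma orthonormal0_summable:
  assumes "orthonormal0 e" "\<And>n. (\<Sum>i<n. (cmod (c i))\<^sup>2) \<le> C"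
  shows "summable (\<lambda>i. c i *\<^sub>C e i)"
proof -
  have "summable (\<lambda>i. (cmod (c i))\<^sup>2)"
    by (rule summableI_nonneg_bounded[OF _ assms(2)]) simp
  then have *: "\<And>\<epsilon>. \<epsilon> > 0 \<Longrightarrow> \<exists>N. \<forall>m\<ge>N. \<forall>n. norm (\<Sum>i=m..<n. (cmod (c i))\<^sup>2) < \<epsilon>"
    by (simp add: summable_Cauchy)
  show ?thesis unfolding summable_Cauchy
  proof (intro allI impI)
    fix \<epsilon> :: real assume "\<epsilon> > 0"
    then obtain N where N: "\<And>m n. m \<ge> N \<Longrightarrow> norm (\<Sum>i=m..<n. (cmod (c i))\<^sup>2) < \<epsilon>\<^sup>2"
      using *[of "\<epsilon>\<^sup>2"] by auto
    have "norm (\<Sum>i=m..<n. c i *\<^sub>C e i) < \<epsilon>" if "m \<ge> N" for m n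
    proof -
      have "(norm (\<Sum>i=m..<n. c i *\<^sub>C e i))\<^sup>2 \<le> (\<Sum>i=m..<n. (cmod (c i))\<^sup>2)"
        by (rule orthonormal0_norm_sum_le[OF assms(1)]) simp
      also have "\<dots> < \<epsilon>\<^sup>2" using N[OF that, of n] by simp
      finally show ?thesis by (rule power2_less_imp_less) (use \<open>\<epsilon> > 0\<close> in simp)
    qed
    then show "\<exists>N. \<forall>m\<ge>N. \<forall>n. norm (\<Sum>i=m..<n. c i *\<^sub>C e i) < \<epsilon>" by blast
  qed
qed

section \<open>Symmetric norming functions\<close>

text \<open>\<open>\<Phi>\<close> carries information only on \<open>finsupp\<close>; passing every
  sequence through a truncation makes membership there automatic. The truncations are also those of
  \<open>sn_ext\<close>.\<close>

definition cut :: "nat \<Rightarrow> (nat \<Rightarrow> complex) \<Rightarrow> nat \<Rightarrow> complex" where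
  "cut n a = (\<lambda>i. if i < n then a i else 0)"

lemma cut_finsupp [simp]: "cut n a \<in> finsupp"
  by (auto simp: cut_def finsupp_def intro!: finite_subset[of _ "{..<n}"])

lemma cut_cut [simp]: "cut n (cut n a) = cut n a"
  by (auto simp: cut_def)

locale symmetric_norming =
  fixes \<Phi> :: "(nat \<Rightarrow> complex) \<Rightarrow> real"
  assumes sn: "sn_function \<Phi>"
begin

lemma nonneg: "a \<in> finsupp \<Longrightarrow> 0 \<le> \<Phi> a"
  using sn unfolding sn_function_def by blast

lemma scale: "a \<in> finsupp \<Longrightarrow> \<Phi> (\<lambda>n. c * a n) = cmod c * \<Phi> a"
  using sn unfolding sn_function_def by blast

lemma triangle: "a \<in> finsupp \<Longrightarrow> b \<in> finsupp \<Longrightarrow> \<Phi> (\<lambda>n. a n + b n) \<le> \<Phi> a + \<Phi> b"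
  using sn unfolding sn_function_def by blast

lemma unit: "\<Phi> (\<lambda>n. if n = 0 then 1 else 0) = 1"
  using sn unfolding sn_function_def by blast

lemma cong_cmod: "a \<in> finsupp \<Longrightarrow> b \<in> finsupp \<Longrightarrow> (\<And>n. cmod (a n) = cmod (b n)) \<Longrightarrow> \<Phi> a = \<Phi> b"
  using sn unfolding sn_function_def by blast

lemma permute: "a \<in> finsupp \<Longrightarrow> bij \<pi> \<Longrightarrow> \<Phi> (\<lambda>n. a (\<pi> n)) = \<Phi> a"
  using sn unfolding sn_function_def by blast

lemma convex_combination:
  assumes "a \<in> finsupp" "b \<in> finsupp" "0 \<le> t" "t \<le> 1"
  shows "\<Phi> (\<lambda>n. of_real (1 - t) * a n + of_real t * b n) \<le> (1 - t) * \<Phi> a + t * \<Phi> b"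
proof -
  have f: "(\<lambda>n. c * a n) \<in> finsupp" if "a \<in> finsupp" for c :: complex and a
    using that by (auto simp: finsupp_def intro: rev_finite_subset)
  have "\<Phi> (\<lambda>n. of_real (1 - t) * a n + of_real t * b n) \<le>
      \<Phi> (\<lambda>n. of_real (1 - t) * a n) + \<Phi> (\<lambda>n. of_real t * b n)"
    by (intro triangle f assms)
  also have "\<dots> = (1 - t) * \<Phi> a + t * \<Phi> b"
    using assms by (simp only: scale norm_of_real abs_of_nonneg diff_ge_0_iff_ge)
  finally show ?thesis .
qed

text \<open>The number \<open>t * a j\<close> is a convex combination of \<open>a j\<close> and
  \<open>- a j\<close> with weight \<open>(1 - t) / 2\<close> on the latter, and changing the sign
  of one coordinate does not affect \<open>\<Phi>\<close>.\<close>

lemma shrink_coordinate: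
  assumes "a \<in> finsupp" "0 \<le> t" "t \<le> 1"
  shows "\<Phi> (a(j := of_real t * a j)) \<le> \<Phi> a"
proof -
  have u: "a(j := z) \<in> finsupp" for z
    using assms(1) by (auto simp: finsupp_def intro!: finite_subset[of _ "insert j {n. a n \<noteq> 0}"])
  have e: "a(j := of_real t * a j) =
      (\<lambda>n. of_real (1 - (1 - t) / 2) * a n + of_real ((1 - t) / 2) * (a(j := - a j)) n)"
    by (rule ext) (auto simp: field_simps)
  have "\<Phi> (a(j := of_real t * a j)) \<le> (1 - (1 - t) / 2) * \<Phi> a + (1 - t) / 2 * \<Phi> (a(j := - a j))"
    unfolding e by (intro convex_combination assms u) (use assms in auto)
  also have "\<Phi> (a(j := - a j)) = \<Phi> a"
    by (intro cong_cmod assms u) auto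
  also have "(1 - (1 - t) / 2) * \<Phi> a + (1 - t) / 2 * \<Phi> a = \<Phi> a"
    by (simp add: field_simps)
  finally show ?thesis .
qed

text \<open>The coordinates of \<open>b\<close> are shrunk one at a time by the ratios
  \<open>t n\<close>; \<open>c J\<close> is the stage at which those in \<open>J\<close> are done.
  The finite support of \<open>b\<close> exhausts all that matters, because \<open>a\<close>
  vanishes wherever \<open>b\<close> does, and phases are irrelevant.\<close>

lemma mono:
  assumes "a \<in> finsupp" "b \<in> finsupp" "\<And>n. cmod (a n) \<le> cmod (b n)"
  shows "\<Phi> a \<le> \<Phi> b"
proof -
  define t where "t n = (if b n = 0 then 0 else cmod (a n) / cmod (b n))" for n
  have t: "0 \<le> t n" "t n \<le> 1" for n
    using assms(3)[of n] by (auto simp: t_def divide_le_eq)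
  define c where "c J n = (if n \<in> J then of_real (t n) * b n else b n)" for J n
  have c_fin: "c J \<in> finsupp" for J
    using assms(2) by (auto simp: finsupp_def c_def intro: rev_finite_subset)
  have *: "\<Phi> (c J) \<le> \<Phi> b" if "finite J" for J
    using that
  proof (induction J)
    case empty
    have "c {} = b" by (auto simp: c_def)
    then show ?case by simp
  next
    case (insert j J)
    have "c (insert j J) = (c J)(j := of_real (t j) * c J j)"
      using insert by (auto simp: c_def)
    then show ?case
      using order_trans[OF shrink_coordinate[OF c_fin t] insert.IH] by metis
  qed
  have "\<Phi> a = \<Phi> (c {n. b n \<noteq> 0})"
  proof (rule cong_cmod[OF assms(1) c_fin])
    show "cmod (a n) = cmod (c {n. b n \<noteq> 0} n)" for n
      using assms(3)[of n] by (auto simp: c_def t_def norm_mult norm_divide)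
  qed
  also have "\<dots> \<le> \<Phi> b"
    by (rule *) (use assms(2) in \<open>simp add: finsupp_def\<close>)
  finally show ?thesis .
qed

lemma mono_cut: "(\<And>i. i < n \<Longrightarrow> cmod (a i) \<le> cmod (b i)) \<Longrightarrow> n \<le> m \<Longrightarrow> \<Phi> (cut n a) \<le> \<Phi> (cut m b)"
  by (rule mono[OF cut_finsupp cut_finsupp]) (auto simp: cut_def)

lemma cong_cmod_cut: "(\<And>i. i < n \<Longrightarrow> cmod (a i) = cmod (b i)) \<Longrightarrow> \<Phi> (cut n a) = \<Phi> (cut n b)"
  by (rule cong_cmod[OF cut_finsupp cut_finsupp]) (auto simp: cut_def)

lemma triangle_cut: "\<Phi> (cut n (\<lambda>i. a i + b i)) \<le> \<Phi> (cut n a) + \<Phi> (cut n b)"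
proof -
  have "cut n (\<lambda>i. a i + b i) = (\<lambda>i. cut n a i + cut n b i)" by (auto simp: cut_def)
  then show ?thesis by (simp add: triangle)
qed

lemma scale_cut: "\<Phi> (cut n (\<lambda>i. c * a i)) = cmod c * \<Phi> (cut n a)"
proof -
  have "cut n (\<lambda>i. c * a i) = (\<lambda>i. c * cut n a i)" by (auto simp: cut_def)
  then show ?thesis by (simp add: scale)
qed

lemma zero_cut [simp]: "\<Phi> (cut n (\<lambda>i. 0)) = 0"
  using scale_cut[of n 0 "\<lambda>i. 0"] by simp

text \<open>Each unit vector has value 1, since a transposition moves it to index 0, where
  \<open>\<Phi>\<close> is normalized. This crude bound is the source of the continuity and
  measurability of \<open>\<Phi>\<close> on truncations.\<close>

lemma le_sum_cut: "\<Phi> (cut n a) \<le> (\<Sum>i<n. cmod (a i))"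
proof (induction n)
  case 0
  have "cut 0 a = cut 0 (\<lambda>i. 0)" by (auto simp: cut_def)
  then show ?case by simp
next
  case (Suc n)
  have u: "(\<lambda>i. if i = n then (1::complex) else 0) \<in> finsupp" for n :: nat
    by (auto simp: finsupp_def)
  have u2: "(\<lambda>i. if i = n then a n else 0) \<in> finsupp"
    by (auto simp: finsupp_def)
  have "cut (Suc n) a = (\<lambda>i. cut n a i + (if i = n then a n else 0))"
    by (auto simp: cut_def)
  then have "\<Phi> (cut (Suc n) a) \<le> \<Phi> (cut n a) + \<Phi> (\<lambda>i. if i = n then a n else 0)"
    using triangle[OF cut_finsupp u2] by simp
  also have "(\<lambda>i. if i = n then a n else 0) = (\<lambda>i. a n * (if i = n then 1 else 0))" by auto
  also have "\<Phi> \<dots> = cmod (a n) * \<Phi> (\<lambda>i. if i = n then 1 else 0)"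
    by (rule scale[OF u])
  also have "(\<lambda>i. if i = n then 1 else (0::complex)) =
      (\<lambda>i. (\<lambda>i. if i = 0 then 1 else 0) (Transposition.transpose 0 n i))"
    by (auto simp: Transposition.transpose_def)
  also have "\<Phi> \<dots> = \<Phi> (\<lambda>i. if i = 0 then 1 else 0)"
    by (rule permute[OF u]) simp
  finally show ?case using Suc by (simp add: unit)
qed

lemma abs_diff_cut_le: "\<bar>\<Phi> (cut n a) - \<Phi> (cut n b)\<bar> \<le> (\<Sum>i<n. cmod (a i - b i))"
  using triangle_cut[of n b "\<lambda>i. a i - b i"] triangle_cut[of n a "\<lambda>i. b i - a i"]
    le_sum_cut[of n "\<lambda>i. a i - b i"] le_sum_cut[of n "\<lambda>i. b i - a i"]
  by (simp add: norm_minus_commute)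

lemma tendsto_cut:
  assumes "\<And>i. i < n \<Longrightarrow> ((\<lambda>k. f k i) \<longlongrightarrow> a i) F"
  shows "((\<lambda>k. \<Phi> (cut n (f k))) \<longlongrightarrow> \<Phi> (cut n a)) F"
proof -
  have "((\<lambda>k. cmod (f k i - a i)) \<longlongrightarrow> 0) F" if "i < n" for i
    by (rule tendsto_norm_zero[OF LIM_zero[OF assms[OF that]]])
  then have "((\<lambda>k. \<Sum>i<n. cmod (f k i - a i)) \<longlongrightarrow> 0) F"
    by (rule tendsto_null_sum) auto
  then have "((\<lambda>k. \<Phi> (cut n (f k)) - \<Phi> (cut n a)) \<longlongrightarrow> 0) F"
    by (rule Lim_null_comparison[rotated])
      (auto intro!: always_eventually simp only: abs_diff_cut_le real_norm_def)
  then show ?thesis by (rule LIM_zero_cancel)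
qed

section \<open>Weak majorization\<close>

text \<open>The vector \<open>a\<close> is moved towards \<open>b\<close> by averaging it with a transposed copy
  of itself; each such step makes one further coordinate agree.\<close>

lemma majorization_decreasing:
  fixes a b :: "nat \<Rightarrow> real"
  assumes "\<And>i. i < n \<Longrightarrow> 0 \<le> b i" "\<And>i j. i \<le> j \<Longrightarrow> j < n \<Longrightarrow> b j \<le> b i"
    "\<And>k. k \<le> n \<Longrightarrow> (\<Sum>i<k. b i) \<le> (\<Sum>i<k. a i)"
  shows "\<Phi> (cut n b) \<le> \<Phi> (cut n a)"
  using assms(3)
proof (induction "card {i. i < n \<and> a i \<noteq> b i}" arbitrary: a rule: less_induct)
  case less
  show ?case
  proof (cases "\<exists>k<n. a k < b k")
    case False
    then have "\<bar>b i\<bar> \<le> \<bar>a i\<bar>" if "i < n" for i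
    proof -
      have "b i \<le> a i" using False that not_less by blast
      with assms(1)[OF that] show ?thesis by simp
    qed
    then show ?thesis by (intro mono_cut) auto
  next
    case True
    \<comment> \<open>At the first deficit \<open>k\<close>, the partial sums of length
      \<open>k + 1\<close> can only be ordered as assumed if \<open>a\<close> has a strict surplus
      at some earlier \<open>j\<close>.\<close>
    define k where "k = (LEAST k. k < n \<and> a k < b k)"
    have k: "k < n" "a k < b k" and kmin: "\<And>i. i < k \<Longrightarrow> b i \<le> a i"
      using LeastI_ex[OF True] not_less_Least[of _ "\<lambda>k. k < n \<and> a k < b k"] unfolding k_def[symmetric]
      by (auto simp: not_less)
    have "\<exists>j<k. b j < a j"
    proof (rule ccontr)
      assume "\<not> ?thesis"
      then have "(\<Sum>i<k. a i) \<le> (\<Sum>i<k. b i)" by (intro sum_mono) (metis not_less lessThan_iff)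
      then have "(\<Sum>i<Suc k. a i) < (\<Sum>i<Suc k. b i)" using k by simp
      then show False using less.prems[of "Suc k"] k by simp
    qed
    then obtain j where j: "j < k" "b j < a j" by blast
    \<comment> \<open>The largest amount that can move from \<open>j\<close> to \<open>k\<close>
      without overshooting \<open>b\<close> at either place; it makes at least one of the two
      coordinates agree with \<open>b\<close>.\<close>
    define \<delta> where "\<delta> = min (a j - b j) (b k - a k)"
    define a' where "a' = a(j := a j - \<delta>, k := a k + \<delta>)"
    have \<delta>: "\<delta> > 0" "\<delta> \<le> a j - b j" "\<delta> \<le> b k - a k" using j k by (auto simp: \<delta>_def)
    \<comment> \<open>Because \<open>b\<close> decreases, \<open>a k < b k \<le> b j < a j\<close>.
      So the transfer stays below the full gap \<open>a j - a k\<close> and is an average of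
      \<open>a\<close> with its transposed copy.\<close>
    have bkj: "b k \<le> b j" using assms(2) j k by auto
    have gap: "a j - a k > 0" "\<delta> \<le> a j - a k" using j k bkj \<delta> by auto
    have "card {i. i < n \<and> a' i \<noteq> b i} < card {i. i < n \<and> a i \<noteq> b i}"
    proof (rule psubset_card_mono)
      show "{i. i < n \<and> a' i \<noteq> b i} \<subset> {i. i < n \<and> a i \<noteq> b i}"
      proof (cases "\<delta> = a j - b j")
        case True
        then have "a' j = b j" using j by (auto simp: a'_def)
        moreover have "a' i \<noteq> b i \<Longrightarrow> a i \<noteq> b i" for i
          using j k by (auto simp: a'_def split: if_splits)
        ultimately show ?thesis using j k by fastforce
      next
        case False
        then have "a' k = b k" using j by (auto simp: a'_def \<delta>_def min_def split: if_splits)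
        moreover have "a' i \<noteq> b i \<Longrightarrow> a i \<noteq> b i" for i
          using j k by (auto simp: a'_def split: if_splits)
        ultimately show ?thesis using j k by fastforce
      qed
    qed simp
    moreover have "(\<Sum>i<m. b i) \<le> (\<Sum>i<m. a' i)" if "m \<le> n" for m
    proof -
      \<comment> \<open>Sums ending before \<open>j\<close> are unchanged and those reaching beyond
        \<open>k\<close> contain both ends of the transfer. In between a sum does drop, but there
        \<open>b\<close> is dominated by \<open>a'\<close> term by term.\<close>
      consider "m \<le> j" | "j < m" "m \<le> k" | "k < m" by linarith
      then show ?thesis
      proof cases
        case 1
        then have "(\<Sum>i<m. a' i) = (\<Sum>i<m. a i)"
          by (intro sum.cong) (use j in \<open>auto simp: a'_def\<close>)
        then show ?thesis using less.prems that by simp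
      next
        case 2
        have "b i \<le> a' i" if "i < m" for i
          using that 2 kmin[of i] \<delta> by (auto simp: a'_def)
        then show ?thesis by (intro sum_mono) auto
      next
        case 3
        have "a' i = a i + (if i = j then - \<delta> else 0) + (if i = k then \<delta> else 0)" for i
          using j by (auto simp: a'_def)
        then have "(\<Sum>i<m. a' i) = (\<Sum>i<m. a i) - \<delta> + \<delta>"
          using 3 j by (simp add: sum.distrib)
        then show ?thesis using less.prems that by simp
      qed
    qed
    ultimately have "\<Phi> (cut n b) \<le> \<Phi> (cut n a')"
      by (rule less.hyps)
    also have "\<dots> \<le> \<Phi> (cut n a)"
    proof -
      \<comment> \<open>The fraction of a complete exchange of the entries at \<open>j\<close> and
        \<open>k\<close> that moves exactly \<open>\<delta>\<close>.\<close>
      define t where "t = \<delta> / (a j - a k)"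
      have t: "0 \<le> t" "t \<le> 1" using gap \<delta> by (auto simp: t_def)
      have td: "t * (a j - a k) = \<delta>" using gap by (simp add: t_def)
      define \<pi> where "\<pi> = Transposition.transpose j k"
      have a'r: "a' i = (1 - t) * a i + t * a (\<pi> i)" for i
        using j td by (auto simp: a'_def \<pi>_def Transposition.transpose_def algebra_simps)
      have "cut n (\<lambda>i. of_real (a' i)) =
          (\<lambda>i. of_real (1 - t) * cut n a i + of_real t * cut n a (\<pi> i))"
      proof
        fix i
        have "\<pi> i < n \<longleftrightarrow> i < n"
          using j k by (auto simp: \<pi>_def Transposition.transpose_def)
        then show "cut n (\<lambda>i. of_real (a' i)) i =
            of_real (1 - t) * cut n a i + of_real t * cut n a (\<pi> i)"
          by (simp add: cut_def a'r)
      qed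
      moreover have "(\<lambda>i. cut n a (\<pi> i)) \<in> finsupp"
      proof -
        have "{i. cut n a (\<pi> i) \<noteq> 0} \<subseteq> {..<n}"
          using j k by (auto simp: \<pi>_def Transposition.transpose_def cut_def split: if_splits)
        then show ?thesis by (auto simp: finsupp_def intro: finite_subset)
      qed
      ultimately have "\<Phi> (cut n a') \<le> (1 - t) * \<Phi> (cut n a) + t * \<Phi> (\<lambda>i. cut n a (\<pi> i))"
        using convex_combination[OF _ _ t] by simp
      also have "\<Phi> (\<lambda>i. cut n a (\<pi> i)) = \<Phi> (cut n a)"
        by (rule permute) (simp_all add: \<pi>_def)
      finally show ?thesis by (simp add: algebra_simps)
    qed
    finally show ?thesis .
  qed
qed

text \<open>Sorting \<open>b\<close> by a permutation leaves \<open>\<Phi>\<close> unchanged, and a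
  hypothesis on all index sets covers the initial segments of any rearrangement. Only
  \<open>b\<close> is sorted, so nothing is required of the order of \<open>a\<close>.\<close>

lemma majorization:
  fixes a b :: "nat \<Rightarrow> real"
  assumes nn: "\<And>i. i < n \<Longrightarrow> 0 \<le> b i"
    and maj: "\<And>I. I \<subseteq> {..<n} \<Longrightarrow> (\<Sum>i\<in>I. b i) \<le> (\<Sum>i<card I. a i)"
  shows "\<Phi> (cut n b) \<le> \<Phi> (cut n a)"
proof -
  define xs where "xs = sort_key (\<lambda>i. - b i) [0..<n]"
  have len: "length xs = n" and set: "set xs = {..<n}" and dist: "distinct xs"
    by (auto simp: xs_def)
  have dec: "b (xs ! j) \<le> b (xs ! i)" if "i \<le> j" "j < n" for i j
  proof -
    have srt: "sorted (map (\<lambda>i. - b i) xs)" unfolding xs_def by (rule sorted_sort_key)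
    have "map (\<lambda>i. - b i) xs ! i \<le> map (\<lambda>i. - b i) xs ! j"
      by (rule sorted_nth_mono[OF srt]) (use that len in auto)
    then show ?thesis using that len by (simp only: nth_map neg_le_iff_le le_less_trans)
  qed
  \<comment> \<open>The invariance of \<open>\<Phi>\<close> concerns bijections of all natural
    numbers, hence the extension by the identity beyond \<open>n\<close>.\<close>
  define \<pi> where "\<pi> i = (if i < n then xs ! i else i)" for i
  have bij: "bij_betw \<pi> {..<n} {..<n}"
  proof -
    have "bij_betw (\<lambda>i. xs ! i) {..<n} {..<n}"
      by (rule bij_betw_nth[OF dist]) (simp_all add: len set)
    then show ?thesis by (subst bij_betw_cong[where g = "\<lambda>i. xs ! i"]) (simp_all add: \<pi>_def)
  qed
  have "bij_betw \<pi> (- {..<n}) (- {..<n})"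
    by (subst bij_betw_cong[where g = id]) (simp_all add: \<pi>_def)
  from bij_betw_combine[OF bij this Compl_disjoint] have bijU: "bij \<pi>"
    unfolding Compl_partition .
  have \<pi>n: "\<pi> i < n \<longleftrightarrow> i < n" for i
    using bij by (auto simp: \<pi>_def bij_betw_def)
  have "\<Phi> (cut n b) = \<Phi> (\<lambda>i. cut n b (\<pi> i))"
    by (rule permute[symmetric]) (auto simp: bijU)
  also have "(\<lambda>i. cut n b (\<pi> i)) = cut n (\<lambda>i. b (\<pi> i))"
    by (auto simp: cut_def \<pi>n)
  also have "\<Phi> \<dots> \<le> \<Phi> (cut n a)"
  proof (rule majorization_decreasing)
    show "0 \<le> b (\<pi> i)" if "i < n" for i using nn \<pi>n that by simp
    show "b (\<pi> j) \<le> b (\<pi> i)" if "i \<le> j" "j < n" for i j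
      using dec[OF that] that by (simp add: \<pi>_def)
    show "(\<Sum>i<k. b (\<pi> i)) \<le> (\<Sum>i<k. a i)" if "k \<le> n" for k
    proof -
      have inj: "inj_on \<pi> {..<k}" using bijU by (rule bij_betw_imp_inj_on[THEN inj_on_subset]) simp
      have "(\<Sum>i<k. b (\<pi> i)) = (\<Sum>i\<in>\<pi> ` {..<k}. b i)"
        by (rule sum.reindex[OF inj, unfolded o_def, symmetric])
      also have "\<dots> \<le> (\<Sum>i<card (\<pi> ` {..<k}). a i)"
        by (rule maj) (use \<pi>n that in force)
      finally show ?thesis by (simp add: card_image[OF inj])
    qed
  qed
  finally show ?thesis .
qed

text \<open>Truncations increase by monotonicity, so the limit is a supremum and finiteness becomes
  a uniform bound.\<close>

lemma sn_ext_SUP: "sn_ext \<Phi> a = (SUP n. ereal (\<Phi> (cut n a)))"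
proof -
  have "incseq (\<lambda>n. ereal (\<Phi> (cut n a)))"
    by (rule incseq_SucI) (auto intro!: mono_cut)
  from LIMSEQ_SUP[OF this] show ?thesis
    unfolding sn_ext_def cut_def[symmetric] by (rule limI)
qed

lemma sn_ext_nonneg: "0 \<le> sn_ext \<Phi> a"
  unfolding sn_ext_SUP by (rule SUP_upper2[of 0]) (auto simp: nonneg)

end

section \<open>Orthonormal bases of separable spaces\<close>

definition orthonormal0_basis :: "(nat \<Rightarrow> 'h::complex_hilbert_space) \<Rightarrow> bool" where
  "orthonormal0_basis e \<longleftrightarrow> orthonormal0 e \<and> (\<forall>x. (\<lambda>n. proj e n x) \<longlonglongrightarrow> x)"

lemma Gram_Schmidt:
  fixes d :: "nat \<Rightarrow> 'h::complex_hilbert_space"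
  obtains e where "orthonormal0 e" "\<And>n. \<exists>c. d n = (\<Sum>i<Suc n. c i *\<^sub>C e i)"
proof -
  \<comment> \<open>Since \<open>inverse 0 = 0\<close>, a vector \<open>d n\<close> that depends on
    its predecessors produces the zero vector and no case distinction.\<close>
  define P where "P f n r \<longleftrightarrow> (let w = d n - proj f n (d n) in r = inverse (norm w) *\<^sub>R w)"
    for f :: "nat \<Rightarrow> 'h" and n r
  have "\<exists>e. \<forall>n. P e n (e n)"
  proof (rule dependent_wellorder_choice)
    fix r :: 'h and f g :: "nat \<Rightarrow> 'h" and x :: nat
    assume "\<And>y. y < x \<Longrightarrow> f y = g y"
    then have "proj f x (d x) = proj g x (d x)" by (simp add: proj_def)
    then show "P f x r = P g x r" by (simp add: P_def)
  qed (auto simp: P_def Let_def)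
  then obtain e where e: "\<And>n. e n = inverse (norm (d n - proj e n (d n))) *\<^sub>R (d n - proj e n (d n))"
    by (auto simp: P_def Let_def)
  have nrm: "e n = 0 \<or> norm (e n) = 1" for n
  proof -
    have "inverse (norm w) *\<^sub>R w = 0 \<or> norm (inverse (norm w) *\<^sub>R w) = 1" for w :: 'h
      by (cases "w = 0") simp_all
    then show ?thesis unfolding e[of n] .
  qed
  have orth: "\<forall>i<n. cinner (e n) (e i) = 0" for n
  proof (induction n rule: less_induct)
    case (less n)
    \<comment> \<open>Statements about \<open>orthonormal0\<close> concern whole sequences;
      replacing the entries from \<open>n\<close> on by zero makes them applicable inside the
      induction.\<close>
    define f where "f i = (if i < n then e i else 0)" for i
    have f: "orthonormal0 f"
      unfolding orthonormal0_def
    proof (intro conjI allI impI)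
      fix i j :: nat assume "i \<noteq> j"
      then consider "i < j" | "j < i" by linarith
      then show "cinner (f i) (f j) = 0"
      proof cases
        case 1
        then have "j < n \<Longrightarrow> cinner (e j) (e i) = 0" using less by blast
        then show ?thesis by (subst cinner_commute) (auto simp: f_def)
      next
        case 2
        then have "i < n \<Longrightarrow> cinner (e i) (e j) = 0" using less by blast
        then show ?thesis by (auto simp: f_def)
      qed
    qed (use nrm in \<open>auto simp: f_def\<close>)
    have "cinner (proj e n (d n)) (e i) = cinner (d n) (e i)" if "i < n" for i
    proof -
      have "proj e n (d n) = (\<Sum>k<n. cinner (d n) (f k) *\<^sub>C f k)"
        by (simp add: proj_def f_def)
      moreover have "e i = f i" using that by (simp add: f_def)
      ultimately show ?thesis
        using orthonormal0_cinner_sum[OF f finite_lessThan, of i n "\<lambda>k. cinner (d n) (f k)"] that by simp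
    qed
    then show ?case
      by (subst e) (auto simp: cinner_scaleR_left cinner_diff_left)
  qed
  have "orthonormal0 e"
    unfolding orthonormal0_def
  proof (intro conjI allI impI nrm)
    fix i j :: nat assume "i \<noteq> j"
    then consider "i < j" | "j < i" by linarith
    then show "cinner (e i) (e j) = 0"
      by cases (use orth in \<open>auto intro: trans[OF cinner_commute]\<close>)
  qed
  moreover have "\<exists>c. d n = (\<Sum>i<Suc n. c i *\<^sub>C e i)" for n
  proof
    let ?w = "d n - proj e n (d n)"
    have "d n = proj e n (d n) + ?w" by simp
    also have "?w = complex_of_real (norm ?w) *\<^sub>C e n"
    proof -
      have "w = complex_of_real (norm w) *\<^sub>C inverse (norm w) *\<^sub>R w" for w :: 'h
        by (cases "w = 0") (simp_all add: scaleC_of_real)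
      then show ?thesis unfolding e[of n] .
    qed
    also have "proj e n (d n) + complex_of_real (norm ?w) *\<^sub>C e n =
      (\<Sum>i<Suc n. (if i = n then complex_of_real (norm ?w) else cinner (d n) (e i)) *\<^sub>C e i)"
      by (simp add: proj_def)
    finally show "d n = \<dots>" .
  qed
  ultimately show thesis by (rule that)
qed

lemma separable_dense_sequence:
  assumes "separable_space (euclidean :: 'h::metric_space topology)"
  obtains d :: "nat \<Rightarrow> 'h::metric_space" where "\<And>x \<epsilon>. \<epsilon> > 0 \<Longrightarrow> \<exists>n. dist (d n) x < \<epsilon>"
proof -
  obtain C :: "'h set" where C: "countable C" "closure C = UNIV"
    using assms by (auto simp: separable_space_def)
  then have "C \<noteq> {}" by auto
  show thesis
  proof (rule that)
    fix x :: 'h and \<epsilon> :: real assume "\<epsilon> > 0"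
    then obtain y where "y \<in> C" "dist y x < \<epsilon>"
      using C(2) closure_approachable[of x C] by auto
    then show "\<exists>n. dist (from_nat_into C n) x < \<epsilon>"
      using range_from_nat_into[OF \<open>C \<noteq> {}\<close> C(1)] by (metis imageE)
  qed
qed

text \<open>Gram--Schmidt on a dense sequence: \<open>proj e m\<close> fixes \<open>d n\<close> as
  soon as \<open>m > n\<close>, and it is a contraction, so its error at \<open>x\<close> is at most
  twice the distance from \<open>x\<close> to \<open>d n\<close>.\<close>

lemma orthonormal0_basis_exists:
  assumes "separable_space (euclidean :: 'h::complex_hilbert_space topology)"
  obtains e :: "nat \<Rightarrow> 'h::complex_hilbert_space" where "orthonormal0_basis e"
proof -
  obtain d :: "nat \<Rightarrow> 'h" where d: "\<And>x \<epsilon>. \<epsilon> > 0 \<Longrightarrow> \<exists>n. dist (d n) x < \<epsilon>"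
    using separable_dense_sequence[OF assms] by blast
  obtain e where e: "orthonormal0 e" "\<And>n. \<exists>c. d n = (\<Sum>i<Suc n. c i *\<^sub>C e i)"
    using Gram_Schmidt[of d] by blast
  have "(\<lambda>n. proj e n x) \<longlonglongrightarrow> x" for x
  proof (rule LIMSEQ_I)
    fix \<epsilon> :: real assume "\<epsilon> > 0"
    then obtain n where n: "dist (d n) x < \<epsilon> / 2" using d[of "\<epsilon> / 2"] by auto
    have "norm (proj e m x - x) < \<epsilon>" if "m \<ge> Suc n" for m
    proof -
      have "proj e m (d n) = d n" using e proj_eq_self that by metis
      then have "proj e m x - x = proj e m (x - d n) + (d n - x)" by (simp add: proj_diff)
      then have "norm (proj e m x - x) \<le> norm (proj e m (x - d n)) + norm (d n - x)"
        by (metis norm_triangle_ineq)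
      also have "\<dots> \<le> norm (x - d n) + norm (d n - x)"
        using norm_proj_le[OF e(1)] by simp
      also have "\<dots> < \<epsilon>" using n by (simp add: dist_norm norm_minus_commute)
      finally show ?thesis .
    qed
    then show "\<exists>N. \<forall>m\<ge>N. norm (proj e m x - x) < \<epsilon>" by blast
  qed
  then show thesis using e that by (auto simp: orthonormal0_basis_def)
qed

text \<open>The operator is the expansion of \<open>T x\<close> with coefficients
  \<open>\<beta> x (e i)\<close>. For convergence, insert the partial sum \<open>?w\<close> into the
  form: the sum \<open>?S\<close> of squared coefficients equals \<open>\<beta> x ?w\<close>, while
  the squared norm of \<open>?w\<close> is at most \<open>?S\<close>, and the bound on
  \<open>\<beta>\<close> turns this into a bound on \<open>?S\<close> independent of
  \<open>n\<close>.\<close>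

lemma sesquilinear_representation:
  fixes \<beta> :: "'h::complex_hilbert_space \<Rightarrow> 'h \<Rightarrow> complex" and e :: "nat \<Rightarrow> 'h"
  assumes e: "orthonormal0_basis e"
    and add1: "\<And>x y z. \<beta> (x + y) z = \<beta> x z + \<beta> y z" and scale1: "\<And>c x y. \<beta> (c *\<^sub>C x) y = c * \<beta> x y"
    and add2: "\<And>x y z. \<beta> x (y + z) = \<beta> x y + \<beta> x z" and scale2: "\<And>c x y. \<beta> x (c *\<^sub>C y) = cnj c * \<beta> x y"
    and bound: "\<And>x y. cmod (\<beta> x y) \<le> C * norm x * norm y"
  obtains T where "T \<in> bounded_ops" "\<And>x y. cinner (T x) y = \<beta> x y"
proof -
  have o: "orthonormal0 e" and lim: "(\<lambda>n. proj e n x) \<longlonglongrightarrow> x" for x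
    using e by (auto simp: orthonormal0_basis_def)
  have zero2: "\<beta> x 0 = 0" for x using scale2[of x 0 0] by simp
  have sum2: "\<beta> x (\<Sum>i<n. c i *\<^sub>C e i) = (\<Sum>i<n. cnj (c i) * \<beta> x (e i))" for x c and n :: nat
    by (induction n) (simp_all add: zero2 add2 scale2)
  have diff2: "\<beta> x (y - z) = \<beta> x y - \<beta> x z" for x y z
    using add2[of x "y - z" z] by (simp add: algebra_simps)
  have summ: "summable (\<lambda>i. \<beta> x (e i) *\<^sub>C e i)" for x
  proof (rule orthonormal0_summable[OF o])
    fix n :: nat
    let ?w = "\<Sum>i<n. \<beta> x (e i) *\<^sub>C e i" and ?S = "\<Sum>i<n. (cmod (\<beta> x (e i)))\<^sup>2"
    have S0: "0 \<le> ?S" by (intro sum_nonneg) simp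
    have "\<beta> x ?w = of_real ?S"
      unfolding sum2 of_real_sum by (rule sum.cong) (simp_all add: mult_cnj_eq_cmod)
    then have "?S = cmod (\<beta> x ?w)" using S0 by (simp only: norm_of_real abs_of_nonneg)
    also have "\<dots> \<le> C * norm x * norm ?w" by (rule bound)
    finally have "?S * ?S \<le> (C * norm x * norm ?w)\<^sup>2"
      using S0 by (auto simp: power2_eq_square intro: mult_mono)
    also have "\<dots> = (C * norm x)\<^sup>2 * (norm ?w)\<^sup>2" by (simp add: power_mult_distrib)
    also have "\<dots> \<le> (C * norm x)\<^sup>2 * ?S"
      by (intro mult_left_mono orthonormal0_norm_sum_le o) auto
    finally have *: "?S * ?S \<le> (C * norm x)\<^sup>2 * ?S" .
    show "?S \<le> (C * norm x)\<^sup>2"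
    proof (cases "?S = 0")
      case False
      then have "?S > 0" using S0 by linarith
      with * show ?thesis by (rule mult_right_le_imp_le)
    qed simp
  qed
  define T where "T x = (\<Sum>i. \<beta> x (e i) *\<^sub>C e i)" for x
  have T: "cinner (T x) y = \<beta> x y" for x y
  proof -
    have "(\<lambda>n. cinner (\<Sum>i<n. \<beta> x (e i) *\<^sub>C e i) y) \<longlonglongrightarrow> cinner (T x) y"
      unfolding T_def by (intro tendsto_cinner summable_LIMSEQ summ tendsto_const)
    moreover have "cinner (\<Sum>i<n. \<beta> x (e i) *\<^sub>C e i) y = \<beta> x (proj e n y)" for n
      unfolding proj_def sum2 cinner_sum_left cinner_scaleC_left
      by (rule sum.cong) (auto simp: cinner_commute[of _ y])
    moreover have "(\<lambda>n. \<beta> x (proj e n y)) \<longlonglongrightarrow> \<beta> x y"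
    proof (rule LIM_zero_cancel, rule Lim_null_comparison)
      show "\<forall>\<^sub>F n in sequentially. norm (\<beta> x (proj e n y) - \<beta> x y) \<le> C * norm x * norm (proj e n y - y)"
        using bound by (simp flip: diff2)
      show "(\<lambda>n. C * norm x * norm (proj e n y - y)) \<longlonglongrightarrow> 0"
        by (intro tendsto_mult_right_zero tendsto_norm_zero LIM_zero lim)
    qed
    ultimately show ?thesis using LIMSEQ_unique by fastforce
  qed
  have "bounded_linear T"
  proof (rule bounded_linear_intro)
    show "T (x + y) = T x + T y" for x y
      by (rule cinner_eqI) (simp add: T cinner_add_left add1)
    show "T (r *\<^sub>R x) = r *\<^sub>R T x" for r x
      using scale1[of "of_real r" x, unfolded scaleC_of_real]
      by (intro cinner_eqI) (simp add: T cinner_scaleR_left)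
    show "norm (T x) \<le> norm x * C" for x
    \<comment> \<open>\<open>C\<close> has no assumed sign; when \<open>T x = 0\<close> the
      nonnegativity of \<open>norm x * C\<close> has to be extracted from
      \<open>bound\<close>.\<close>
    proof (cases "T x = 0")
      case True
      show ?thesis
      proof (cases "x = 0")
        case False
        have "0 \<le> C * norm x * norm x" using bound[of x x] norm_ge_zero order_trans by blast
        then show ?thesis using True False by (simp add: zero_le_mult_iff mult.commute)
      qed (use True in simp)
    next
      case False
      have "norm (T x) * norm (T x) = cmod (cinner (T x) (T x))"
        by (simp add: cinner_self norm_mult power2_eq_square)
      also have "\<dots> \<le> C * norm x * norm (T x)" unfolding T by (rule bound)
      finally show ?thesis using False by (simp add: mult.commute)
    qed
  qed
  then have ap: "blinfun_apply (Blinfun T) = T" by (rule bounded_linear_Blinfun_apply)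
  show thesis
  proof (rule that)
    show "Blinfun T \<in> bounded_ops"
      unfolding bounded_ops_def
      by (intro CollectI allI cinner_eqI) (simp only: ap T cinner_scaleC_left scale1)
    show "cinner (Blinfun T x) y = \<beta> x y" for x y by (simp add: ap T)
  qed
qed

text \<open>Resolves the definite description: the form that sends \<open>x\<close>,
  \<open>y\<close> to \<open>cinner x (A y)\<close> has a representing operator, and matrix
  coefficients determine it.\<close>

lemma cadjoint:
  fixes A :: "'h::complex_hilbert_space \<Rightarrow>\<^sub>L 'h" and e :: "nat \<Rightarrow> 'h"
  assumes "orthonormal0_basis e" "A \<in> bounded_ops"
  shows "cinner (A x) y = cinner x (cadjoint A y)"
proof -
  obtain B where B: "B \<in> bounded_ops" "\<And>x y. cinner (B x) y = cinner x (A y)"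
  proof (rule sesquilinear_representation[OF assms(1), of "\<lambda>x y. cinner x (A y)" "norm A"])
    show "cmod (cinner x (A y)) \<le> norm A * norm x * norm y" for x y
    proof -
      have "norm x * norm (A y) \<le> norm x * (norm A * norm y)"
        by (intro mult_left_mono norm_blinfun) simp
      then show ?thesis using cinner_Cauchy_Schwarz[of x "A y"] by (simp add: mult_ac)
    qed
  qed (auto simp: cinner_add_left cinner_add_right cinner_scaleC_left cinner_scaleC_right
      blinfun.add_right bounded_ops_scaleC[OF assms(2)])
  have "cadjoint A = B"
    unfolding cadjoint_def
  proof (rule the_equality)
    show "B \<in> bounded_ops \<and> (\<forall>x y. cinner (A x) y = cinner x (B y))"
      using B by (metis cinner_commute)
    fix B' assume "B' \<in> bounded_ops \<and> (\<forall>x y. cinner (A x) y = cinner x (blinfun_apply B' y))"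
    then show "B' = B" by (intro bounded_ops_eqI) (metis B(2) cinner_commute)
  qed
  then show ?thesis using B by (metis cinner_commute)
qed

section \<open>Singular value decomposition of compact operators\<close>

lemma compact_ops_subseq:
  fixes A :: "'h::complex_hilbert_space \<Rightarrow>\<^sub>L 'h" and x :: "nat \<Rightarrow> 'h"
  assumes "A \<in> compact_ops" "\<And>k. norm (x k) \<le> 1"
  obtains y and r :: "nat \<Rightarrow> nat" where "strict_mono r" "(\<lambda>k. blinfun_apply A (x (r k))) \<longlonglongrightarrow> y"
proof -
  have "compact (closure (blinfun_apply A ` cball 0 1))" using assms by (simp add: compact_ops_def)
  moreover have "\<forall>k. A (x k) \<in> closure (blinfun_apply A ` cball 0 1)"
    using assms(2) by (auto intro!: closure_subset[THEN subsetD])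
  ultimately obtain y r where "strict_mono (r :: nat \<Rightarrow> nat)" "((\<lambda>k. A (x k)) \<circ> r) \<longlonglongrightarrow> y"
    unfolding compact_def by metis
  then show thesis using that by (simp add: o_def)
qed

text \<open>By the parallelogram law a maximizing sequence whose images converge is itself Cauchy, so no
  weak compactness is needed.\<close>

lemma compact_ops_attains_norm:
  fixes A :: "'h::complex_hilbert_space \<Rightarrow>\<^sub>L 'h"
  assumes A: "A \<in> compact_ops" and W: "subspace W" "closed W"
  obtains v where "v \<in> W" "v = 0 \<or> norm v = 1" "\<And>x. x \<in> W \<Longrightarrow> norm (A x) \<le> norm (A v) * norm x"
proof -
  \<comment> \<open>The supremum \<open>s\<close> of \<open>S\<close> is the operator norm of the
    restriction of \<open>A\<close> to \<open>W\<close>.\<close>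
  define S where "S = (\<lambda>x. norm (A x)) ` (W \<inter> cball 0 1)"
  define s where "s = Sup S"
  have bdd: "bdd_above S"
  proof (rule bdd_aboveI)
    fix y assume "y \<in> S"
    then obtain x where x: "y = norm (A x)" "norm x \<le> 1" by (auto simp: S_def)
    then show "y \<le> norm A"
      using norm_blinfun[of A x] mult_left_mono[OF x(2), of "norm A"] by simp
  qed
  have upper: "norm (A x) \<le> s * norm x" if "x \<in> W" for x
  proof (cases "x = 0")
    case False
    let ?z = "inverse (norm x) *\<^sub>R x"
    have "norm (A ?z) \<in> S"
      unfolding S_def using that W(1) False by (intro imageI) (auto simp: subspace_scale)
    then have "norm (A ?z) \<le> s" unfolding s_def by (rule cSup_upper[OF _ bdd])
    then show ?thesis using False by (simp add: blinfun.scaleR_right field_simps)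
  qed simp
  have "0 \<in> W" using W(1) by (rule subspace_0)
  then have "0 \<in> S" unfolding S_def by (auto intro!: image_eqI[of _ _ 0])
  then have "s \<ge> 0" unfolding s_def by (rule cSup_upper[OF _ bdd])
  show thesis
  proof (cases "s = 0")
    case True
    show thesis by (rule that[OF \<open>0 \<in> W\<close>]) (use upper True in auto)
  next
    case False
    then have s: "s > 0" using \<open>s \<ge> 0\<close> by simp
    have "\<exists>x. x \<in> W \<and> norm x \<le> 1 \<and> s - inverse (real (Suc k)) < norm (A x)" for k :: nat
    proof -
      have "s - inverse (real (Suc k)) < Sup S" unfolding s_def[symmetric] by simp
      then obtain w where "w \<in> S" "s - inverse (real (Suc k)) < w"
        using less_cSupD[of S] \<open>0 \<in> S\<close> by blast
      then show ?thesis by (auto simp: S_def)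
    qed
    then obtain x where x: "\<And>k. x k \<in> W" "\<And>k. norm (x k) \<le> 1"
      "\<And>k. s - inverse (real (Suc k)) < norm (A (x k))"
      by metis
    obtain y r where r: "strict_mono r" and y: "(\<lambda>k. A (x (r k))) \<longlonglongrightarrow> y"
      by (rule compact_ops_subseq[OF A x(2)])
    define z where "z k = x (r k)" for k
    have z: "z k \<in> W" "norm (z k) \<le> 1" for k unfolding z_def by (rule x)+
    have y: "(\<lambda>k. A (z k)) \<longlonglongrightarrow> y" using y by (simp add: z_def)
    have "(\<lambda>k. s - inverse (real (Suc (r k)))) \<longlonglongrightarrow> s - 0"
      using LIMSEQ_subseq_LIMSEQ[OF LIMSEQ_inverse_real_of_nat r, unfolded o_def]
      by (rule tendsto_diff[OF tendsto_const])
    moreover have "\<And>k. s - inverse (real (Suc (r k))) \<le> norm (A (z k))"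
      unfolding z_def by (rule less_imp_le[OF x(3)])
    ultimately have "s \<le> norm y"
      using LIMSEQ_le[OF _ tendsto_norm[OF y], of "\<lambda>k. s - inverse (real (Suc (r k)))" s] by auto
    define d where "d k = norm (A (z k) - y)" for k
    have d: "d \<longlonglongrightarrow> 0" unfolding d_def by (rule tendsto_norm_zero[OF LIM_zero[OF y]])
    \<comment> \<open>With \<open>D = d k + d m\<close>, the vector \<open>A (z k) + A (z m)\<close>
      is within \<open>D\<close> of \<open>2 *\<^sub>R y\<close>, so its squared norm is at least
      \<open>4 * s\<^sup>2 - 4 * s * D\<close>. It is also at most \<open>s\<^sup>2\<close> times
      the squared norm of \<open>z k + z m\<close>, which the parallelogram law bounds by 4 minus
      the left-hand side.\<close>
    have key: "(norm (z k - z m))\<^sup>2 \<le> 4 * (d k + d m) / s" for k m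
    proof -
      have "2 * norm y - (d k + d m) \<le> norm (A (z k) + A (z m))"
      proof -
        have "norm (2 *\<^sub>R y) \<le> norm (A (z k) + A (z m)) + norm (2 *\<^sub>R y - (A (z k) + A (z m)))"
          by (metis add_diff_cancel_left' diff_add_cancel norm_triangle_ineq add.commute)
        also have "2 *\<^sub>R y - (A (z k) + A (z m)) = - ((A (z k) - y) + (A (z m) - y))"
          by (simp add: scaleR_2)
        also have "norm \<dots> \<le> d k + d m"
          unfolding d_def norm_minus_cancel by (rule norm_triangle_ineq)
        finally show ?thesis by simp
      qed
      with \<open>s \<le> norm y\<close> have 1: "2 * s - (d k + d m) \<le> norm (A (z k) + A (z m))" by simp
      have dn: "d k \<ge> 0" "d m \<ge> 0" by (auto simp: d_def)
      have "(2 * s)\<^sup>2 \<le> (norm (A (z k) + A (z m)) + (d k + d m))\<^sup>2"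
        using 1 s by (intro power_mono) auto
      have 2: "4 * s\<^sup>2 - 4 * s * (d k + d m) \<le> (norm (A (z k) + A (z m)))\<^sup>2"
      \<comment> \<open>Squaring is monotone only for a nonnegative lower bound; otherwise the
        claimed lower bound is itself at most zero.\<close>
      proof (cases "2 * s - (d k + d m) \<ge> 0")
        case True
        have "4 * s\<^sup>2 - 4 * s * (d k + d m) \<le> (2 * s - (d k + d m))\<^sup>2"
          by (simp add: power2_diff power_mult_distrib)
        also have "\<dots> \<le> (norm (A (z k) + A (z m)))\<^sup>2" by (rule power_mono[OF 1 True])
        finally show ?thesis .
      next
        case False
        then have "4 * s * s \<le> 4 * s * (d k + d m)" using s by (intro mult_left_mono) auto
        then have "4 * s\<^sup>2 - 4 * s * (d k + d m) \<le> 0" by (simp add: power2_eq_square)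
        then show ?thesis by (rule order_trans) simp
      qed
      also have "(norm (A (z k) + A (z m)))\<^sup>2 \<le> (s * norm (z k + z m))\<^sup>2"
        using upper[OF subspace_add[OF W(1) z(1) z(1)], of k m]
        by (intro power_mono) (simp_all add: blinfun.add_right)
      also have "\<dots> = s\<^sup>2 * (2 * (norm (z k))\<^sup>2 + 2 * (norm (z m))\<^sup>2 - (norm (z k - z m))\<^sup>2)"
        by (simp add: power_mult_distrib norm_add_squared norm_diff_squared)
      also have "\<dots> \<le> s\<^sup>2 * (2 * 1 + 2 * 1 - (norm (z k - z m))\<^sup>2)"
        using z(2) by (intro mult_left_mono diff_right_mono add_mono) (auto simp: power_le_one_iff)
      finally have "s * (s * (norm (z k - z m))\<^sup>2) \<le> s * (4 * (d k + d m))"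
        by (simp add: power2_eq_square algebra_simps)
      then have "s * (norm (z k - z m))\<^sup>2 \<le> 4 * (d k + d m)" using s by simp
      then show ?thesis using s by (simp add: field_simps)
    qed
    have "Cauchy z"
      unfolding Cauchy_iff
    proof (intro allI impI)
      fix \<epsilon> :: real assume \<epsilon>: "\<epsilon> > 0"
      then obtain N where N: "\<And>k. k \<ge> N \<Longrightarrow> d k < s * \<epsilon>\<^sup>2 / 8"
        using LIMSEQ_D[OF d, of "s * \<epsilon>\<^sup>2 / 8"] s by (fastforce simp: d_def)
      have "norm (z m - z n) < \<epsilon>" if "m \<ge> N" "n \<ge> N" for m n
      proof -
        have "4 * (d m + d n) < s * \<epsilon>\<^sup>2" using N[OF that(1)] N[OF that(2)] by simp
        then have "4 * (d m + d n) / s < \<epsilon>\<^sup>2" using s by (simp add: field_simps)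
        then have "(norm (z m - z n))\<^sup>2 < \<epsilon>\<^sup>2" using key[of m n] by linarith
        then show ?thesis by (rule power2_less_imp_less) (use \<epsilon> in simp)
      qed
      then show "\<exists>M. \<forall>m\<ge>M. \<forall>n\<ge>M. norm (z m - z n) < \<epsilon>" by blast
    qed
    then obtain v where v: "z \<longlonglongrightarrow> v" by (auto simp: Cauchy_convergent_iff convergent_def)
    have "v \<in> W" using closed_sequentially[OF W(2) _ v] z by blast
    have "norm v \<le> 1" using LIMSEQ_le_const2[OF tendsto_norm[OF v]] z by blast
    have "A v = y" using LIMSEQ_unique[OF blinfun.tendsto[OF tendsto_const v] y] by simp
    then have "s \<le> norm (A v)" using \<open>s \<le> norm y\<close> by simp
    moreover have "norm (A v) \<le> s * norm v" using upper \<open>v \<in> W\<close> by simp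
    ultimately have "s * 1 \<le> s * norm v" by simp
    then have "norm v = 1" using s \<open>norm v \<le> 1\<close> by simp
    show thesis
    proof (rule that[OF \<open>v \<in> W\<close>])
      fix x assume "x \<in> W"
      have "norm (A x) \<le> s * norm x" by (rule upper[OF \<open>x \<in> W\<close>])
      also have "\<dots> \<le> norm (A v) * norm x" using \<open>s \<le> norm (A v)\<close> by (rule mult_right_mono) simp
      finally show "norm (A x) \<le> norm (A v) * norm x" .
    qed (use \<open>norm v = 1\<close> in simp)
  qed
qed

text \<open>A Schmidt decomposition with strong (pointwise) convergence. The vectors are units only
  where \<open>s n\<close> is positive and may vanish elsewhere, so operators of finite and of
  infinite rank share one format.\<close>

definition singular_system ::
    "('h::complex_hilbert_space \<Rightarrow>\<^sub>L 'h) \<Rightarrow> (nat \<Rightarrow> real) \<Rightarrow> (nat \<Rightarrow> 'h) \<Rightarrow> (nat \<Rightarrow> 'h) \<Rightarrow> bool" where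
  "singular_system A s u v \<longleftrightarrow> A \<in> bounded_ops \<and> decseq s \<and> (\<forall>n. 0 \<le> s n) \<and> s \<longlonglongrightarrow> 0 \<and>
     orthonormal0 u \<and> orthonormal0 v \<and> (\<forall>n. 0 < s n \<longrightarrow> norm (u n) = 1 \<and> norm (v n) = 1) \<and>
     (\<forall>x. (\<lambda>n. \<Sum>i<n. (of_real (s i) * cinner x (v i)) *\<^sub>C u i) \<longlonglongrightarrow> A x)"

text \<open>First-order variation: moving \<open>v\<close> in the direction of \<open>w\<close> cannot increase the quotient.\<close>

lemma maximizer_orthogonal:
  fixes A :: "'h::complex_hilbert_space \<Rightarrow>\<^sub>L 'h"
  assumes "A \<in> bounded_ops" "norm v \<le> 1" "cinner v w = 0"
    and max: "\<And>c. norm (A (v + c *\<^sub>C w)) \<le> norm (A v) * norm (v + c *\<^sub>C w)"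
  shows "cinner (A v) (A w) = 0"
proof (rule ccontr)
  define h where "h = cinner (A v) (A w)"
  assume "\<not> ?thesis"
  then have h: "(cmod h)\<^sup>2 > 0" by (simp add: h_def)
  define K where "K = (norm (A v))\<^sup>2 * (norm w)\<^sup>2"
  have K: "K \<ge> 0" by (simp add: K_def)
  have *: "2 * t * (cmod h)\<^sup>2 \<le> t\<^sup>2 * (cmod h)\<^sup>2 * K" for t :: real
  proof -
    \<comment> \<open>The phase of \<open>h\<close> aligns the first-order term, making
      \<open>Re (cnj c * h)\<close> equal to \<open>t * (cmod h)\<^sup>2\<close>.\<close>
    define c where "c = of_real t * h"
    have "(norm (A v + c *\<^sub>C A w))\<^sup>2 \<le> (norm (A v) * norm (v + c *\<^sub>C w))\<^sup>2"
      using max[of c] bounded_ops_scaleC[OF assms(1), of c w] by (intro power_mono) (auto simp: blinfun.add_right)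
    also have "(norm (A v + c *\<^sub>C A w))\<^sup>2 = (norm (A v))\<^sup>2 + 2 * Re (cnj c * h) + (norm (c *\<^sub>C A w))\<^sup>2"
      by (simp add: norm_add_squared cinner_scaleC_right h_def)
    also have "(norm (A v) * norm (v + c *\<^sub>C w))\<^sup>2 = (norm (A v))\<^sup>2 * ((norm v)\<^sup>2 + (norm (c *\<^sub>C w))\<^sup>2)"
      by (simp add: power_mult_distrib norm_add_squared cinner_scaleC_right assms(3))
    also have "\<dots> \<le> (norm (A v))\<^sup>2 * (1 + (norm (c *\<^sub>C w))\<^sup>2)"
      using assms(2) by (intro mult_left_mono add_right_mono) (auto simp: power_le_one_iff)
    finally have "2 * Re (cnj c * h) \<le> (norm (A v))\<^sup>2 * (norm (c *\<^sub>C w))\<^sup>2"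
      using zero_le_power2[of "norm (c *\<^sub>C A w)"]
      by (simp only: distrib_left mult_1_right)
    moreover have "Re (cnj c * h) = t * (cmod h)\<^sup>2"
    proof -
      have "cnj c * h = of_real (t * (cmod h)\<^sup>2)"
        by (simp add: c_def mult.assoc mult_cnj_eq_cmod)
      then show ?thesis by (simp only: Re_complex_of_real)
    qed
    moreover have "(norm (A v))\<^sup>2 * (norm (c *\<^sub>C w))\<^sup>2 = t\<^sup>2 * (cmod h)\<^sup>2 * K"
      by (simp add: norm_scaleC c_def K_def norm_mult power_mult_distrib)
    ultimately show ?thesis by simp
  qed
  \<comment> \<open>Dividing the inequality by \<open>t * (cmod h)\<^sup>2\<close> leaves
    \<open>2 \<le> t * K\<close>, which this choice violates.\<close>
  define t where "t = inverse (K + 1)"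
  have t: "t > 0" "t * K < 1" using K by (auto simp: t_def field_simps)
  have "(t * (cmod h)\<^sup>2) * 2 \<le> (t * (cmod h)\<^sup>2) * (t * K)"
    using *[of t] by (simp add: power2_eq_square algebra_simps)
  then have "2 \<le> t * K" using t h by simp
  then show False using t by simp
qed

text \<open>\<open>v n\<close> maximizes the norm of the image on the orthogonal complement
  \<open>W v n\<close> of its predecessors; \<open>s n\<close> is the maximum and \<open>u n\<close>
  the normalized image. First-order optimality makes the images orthogonal, and compactness makes
  the maxima tend to zero.\<close>

lemma singular_system_exists:
  fixes A :: "'h::complex_hilbert_space \<Rightarrow>\<^sub>L 'h"
  assumes A: "A \<in> compact_ops"
  obtains s u v where "singular_system A s u v"
proof -
  have bo: "A \<in> bounded_ops" using A by (simp add: compact_ops_def)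
  define W where "W f n = {x. \<forall>i<n. cinner x (f i) = 0}" for f :: "nat \<Rightarrow> 'h" and n :: nat
  have Wsub: "subspace (W f n)" for f n
    by (auto simp: W_def subspace_def cinner_add_left cinner_scaleR_left)
  have Wclosed: "closed (W f n)" for f n
  proof -
    have "W f n = (\<Inter>i\<in>{..<n}. {x. cinner x (f i) = 0})" by (auto simp: W_def)
    also have "closed \<dots>"
      by (intro closed_INT ballI closed_Collect_eq continuous_on_cinner continuous_on_id continuous_on_const)
    finally show ?thesis .
  qed
  define P where "P f n v \<longleftrightarrow> v \<in> W f n \<and> (v = 0 \<or> norm v = 1) \<and>
    (\<forall>x\<in>W f n. norm (A x) \<le> norm (A v) * norm x)" for f :: "nat \<Rightarrow> 'h" and n :: nat and v
  have "\<exists>v. \<forall>n. P v n (v n)"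
  proof (rule dependent_wellorder_choice)
    fix r :: 'h and f g :: "nat \<Rightarrow> 'h" and n :: nat
    assume "\<And>y. y < n \<Longrightarrow> f y = g y"
    then have "W f n = W g n" by (auto simp: W_def)
    then show "P f n r = P g n r" by (simp add: P_def)
  next
    fix n :: nat and f :: "nat \<Rightarrow> 'h"
    obtain v where "v \<in> W f n" "v = 0 \<or> norm v = 1"
      "\<And>x. x \<in> W f n \<Longrightarrow> norm (A x) \<le> norm (A v) * norm x"
      using compact_ops_attains_norm[OF A Wsub Wclosed] by metis
    then show "\<exists>v. P f n v" by (auto simp: P_def)
  qed
  then obtain v where v: "\<And>n. v n \<in> W v n" "\<And>n. v n = 0 \<or> norm (v n) = 1"
    and max: "\<And>n x. x \<in> W v n \<Longrightarrow> norm (A x) \<le> norm (A (v n)) * norm x"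
    by (auto simp: P_def)
  have orth: "cinner (v j) (v i) = 0" if "i < j" for i j
    using v(1)[of j] that by (auto simp: W_def)
  have ov: "orthonormal0 v"
    unfolding orthonormal0_def
  proof (intro conjI allI impI v(2))
    fix i j :: nat assume "i \<noteq> j"
    then consider "i < j" | "j < i" by linarith
    then show "cinner (v i) (v j) = 0"
      by cases (metis cinner_commute complex_cnj_zero orth)+
  qed
  have vn: "norm (v n) \<le> 1" for n by (rule orthonormal0_norm_le[OF ov])
  define s where "s n = norm (A (v n))" for n
  \<comment> \<open>Yields the zero vector when \<open>s n = 0\<close>.\<close>
  define u where "u n = inverse (s n) *\<^sub>R A (v n)" for n
  have s0: "0 \<le> s n" for n by (simp add: s_def)
  have Au: "A (v n) = complex_of_real (s n) *\<^sub>C u n" for n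
    by (cases "s n = 0") (auto simp: u_def scaleC_of_real s_def)
  have dec: "decseq s"
  proof (rule decseq_SucI)
    fix n
    have "v (Suc n) \<in> W v n" using v(1)[of "Suc n"] by (auto simp: W_def)
    from max[OF this] have "s (Suc n) \<le> s n * norm (v (Suc n))" by (simp add: s_def)
    also have "\<dots> \<le> s n * 1" by (intro mult_left_mono vn s0)
    finally show "s (Suc n) \<le> s n" by simp
  qed
  have Aorth: "cinner (A (v i)) (A (v j)) = 0" if "i < j" for i j
  proof (rule maximizer_orthogonal[OF bo vn])
    show "cinner (v i) (v j) = 0" using orth[OF that] by (metis cinner_commute complex_cnj_zero)
    fix c
    have "v i + c *\<^sub>C v j \<in> W v i"
      using v(1)[of i] v(1)[of j] that by (auto simp: W_def cinner_add_left cinner_scaleC_left)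
    from max[OF this] show "norm (A (v i + c *\<^sub>C v j)) \<le> norm (A (v i)) * norm (v i + c *\<^sub>C v j)" .
  qed
  have Aorth': "cinner (A (v i)) (A (v j)) = 0" if "i \<noteq> j" for i j
    using that Aorth[of i j] Aorth[of j i] cinner_commute[of "A (v i)" "A (v j)"] by (cases i j rule: linorder_cases) auto
  have un: "norm (u n) = 1" if "0 < s n" for n
    using that by (simp add: u_def s_def)
  have ou: "orthonormal0 u"
    unfolding orthonormal0_def
  proof (intro conjI allI impI)
    show "cinner (u i) (u j) = 0" if "i \<noteq> j" for i j
      using Aorth'[OF that] by (simp add: u_def cinner_scaleR_left cinner_scaleR_right)
    show "u i = 0 \<or> norm (u i) = 1" for i
      using un[of i] s0[of i] by (cases "s i = 0") (auto simp: u_def)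
  qed
  have v1: "norm (v n) = 1" if "0 < s n" for n
    using v(2)[of n] that by (auto simp: s_def)
  obtain L where L: "s \<longlonglongrightarrow> L" "\<And>i. L \<le> s i"
    using decseq_convergent[OF dec, of 0] s0 by blast
  \<comment> \<open>Orthogonal images of norm at least \<open>L\<close> are at distance at least
    \<open>L\<close> from each other, so with \<open>L > 0\<close> no subsequence of them could be
    Cauchy.\<close>
  have "L = 0"
  proof (rule ccontr)
    assume "L \<noteq> 0"
    moreover have "0 \<le> L" using LIMSEQ_le_const[OF L(1)] s0 by blast
    ultimately have "L > 0" by simp
    obtain y and r :: "nat \<Rightarrow> nat" where r: "strict_mono r" "(\<lambda>k. A (v (r k))) \<longlonglongrightarrow> y"
      by (rule compact_ops_subseq[OF A vn])
    from r(2) have "Cauchy (\<lambda>k. A (v (r k)))" by (rule LIMSEQ_imp_Cauchy)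
    then obtain N where N: "\<And>m n. m \<ge> N \<Longrightarrow> n \<ge> N \<Longrightarrow> norm (A (v (r m)) - A (v (r n))) < L"
      using \<open>L > 0\<close> unfolding Cauchy_iff by metis
    have "r N \<noteq> r (Suc N)" using r(1) by (metis n_not_Suc_n strict_mono_eq)
    then have "(norm (A (v (r N)) - A (v (r (Suc N)))))\<^sup>2 = (s (r N))\<^sup>2 + (s (r (Suc N)))\<^sup>2"
      by (simp add: norm_diff_squared Aorth' s_def)
    moreover have "L\<^sup>2 \<le> (s (r N))\<^sup>2" using L(2) \<open>L > 0\<close> by (intro power_mono) auto
    ultimately have "L\<^sup>2 \<le> (norm (A (v (r N)) - A (v (r (Suc N)))))\<^sup>2" by (simp add: add_increasing2)
    then have "L \<le> norm (A (v (r N)) - A (v (r (Suc N))))" by (rule power2_le_imp_le) simp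
    then show False using N[of N "Suc N"] by simp
  qed
  then have lim: "s \<longlonglongrightarrow> 0" using L by simp
  \<comment> \<open>The partial sum is \<open>A (proj v n x)\<close>; the remainder
    \<open>x - proj v n x\<close> lies in \<open>W v n\<close>, where \<open>A\<close> has norm
    \<open>s n\<close>.\<close>
  have expand: "(\<lambda>n. \<Sum>i<n. (complex_of_real (s i) * cinner x (v i)) *\<^sub>C u i) \<longlonglongrightarrow> A x" for x
  proof (rule LIM_zero_cancel, rule Lim_null_comparison)
    have "norm ((\<Sum>i<n. (complex_of_real (s i) * cinner x (v i)) *\<^sub>C u i) - A x) \<le> s n * norm x" for n
    proof -
      have "(\<Sum>i<n. (complex_of_real (s i) * cinner x (v i)) *\<^sub>C u i) = A (proj v n x)"
        by (simp add: proj_def blinfun.sum_right bounded_ops_scaleC[OF bo] Au scaleC_scaleC mult.commute)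
      then have e: "norm ((\<Sum>i<n. (complex_of_real (s i) * cinner x (v i)) *\<^sub>C u i) - A x)
          = norm (A (x - proj v n x))"
        by (simp add: blinfun.diff_right norm_minus_commute)
      have "cinner (proj v n x) (v i) = cinner x (v i)" if "i < n" for i
        unfolding proj_def using orthonormal0_cinner_sum[OF ov finite_lessThan, of i n] that by auto
      then have "x - proj v n x \<in> W v n" by (auto simp: W_def cinner_diff_left)
      then have "norm (A (x - proj v n x)) \<le> s n * norm (x - proj v n x)"
        using max unfolding s_def by blast
      also have "\<dots> \<le> s n * norm x"
      proof (intro mult_left_mono s0)
        have "0 \<le> (\<Sum>i<n. (cmod (cinner x (v i)))\<^sup>2)" by (intro sum_nonneg) simp
        then have "(norm (x - proj v n x))\<^sup>2 \<le> (norm x)\<^sup>2"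
          using orthonormal0_Pythagoras[OF ov, of x n] by linarith
        then show "norm (x - proj v n x) \<le> norm x" by (rule power2_le_imp_le) simp
      qed
      finally show ?thesis unfolding e .
    qed
    then show "\<forall>\<^sub>F n in sequentially.
        norm ((\<Sum>i<n. (complex_of_real (s i) * cinner x (v i)) *\<^sub>C u i) - A x) \<le> s n * norm x"
      by (rule always_eventually[OF allI])
    show "(\<lambda>n. s n * norm x) \<longlonglongrightarrow> 0" by (rule tendsto_mult_left_zero[OF lim])
  qed
  show thesis
    by (rule that[of s u v]) (unfold singular_system_def, intro conjI allI impI bo dec s0 lim ou ov un v1 expand)
qed

section \<open>Uniqueness of the singular values\<close>

lemma orthonormal0_independent:
  assumes "orthonormal0 u" "finite I" "\<And>i. i \<in> I \<Longrightarrow> norm (u i) = 1"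
  shows "inj_on u I" "complex_vector.independent (u ` I)"
proof -
  have nz: "u i \<noteq> 0" if "i \<in> I" for i using assms(3)[OF that] by auto
  show inj: "inj_on u I"
  proof (rule inj_onI, rule ccontr)
    fix i j assume "i \<in> I" "j \<in> I" "u i = u j" "i \<noteq> j"
    then have "cinner (u i) (u i) = 0" using assms(1) unfolding orthonormal0_def by metis
    then show False using nz[OF \<open>i \<in> I\<close>] by (simp add: cinner_self)
  qed
  have "c w = 0" if 0: "(\<Sum>x\<in>u ` I. c x *\<^sub>C x) = 0" and "w \<in> u ` I" for c w
  proof -
    from that obtain k where k: "k \<in> I" "w = u k" by blast
    have "(\<Sum>i\<in>I. c (u i) *\<^sub>C u i) = 0" using 0 by (simp add: sum.reindex[OF inj] o_def)
    then have "cinner (\<Sum>i\<in>I. c (u i) *\<^sub>C u i) (u k) = 0" by simp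
    then show ?thesis using orthonormal0_cinner_sum[OF assms(1,2) k(1), of "\<lambda>i. c (u i)"] nz[OF k(1)] k by simp
  qed
  then show "complex_vector.independent (u ` I)"
    using assms(2) by (auto simp: complex_vector.dependent_finite)
qed

context
  fixes A :: "'h::complex_hilbert_space \<Rightarrow>\<^sub>L 'h" and s u v
  assumes sys: "singular_system A s u v"
begin

lemma singular_system_simps:
  shows "A \<in> bounded_ops" "decseq s" "0 \<le> s n" "s \<longlonglongrightarrow> 0" "orthonormal0 u" "orthonormal0 v"
    "0 < s n \<Longrightarrow> norm (u n) = 1" "0 < s n \<Longrightarrow> norm (v n) = 1"
    "(\<lambda>n. \<Sum>i<n. (complex_of_real (s i) * cinner x (v i)) *\<^sub>C u i) \<longlonglongrightarrow> A x"
  using sys unfolding singular_system_def by blast+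

lemma singular_system_cinner:
  "(\<lambda>n. \<Sum>i<n. of_real (s i) * cinner x (v i) * cinner (u i) y) \<longlonglongrightarrow> cinner (A x) y"
  using tendsto_cinner[OF singular_system_simps(9) tendsto_const, of x y]
  by (simp only: cinner_sum_left cinner_scaleC_left)

lemma singular_system_apply_v: "A (v k) = of_real (s k) *\<^sub>C u k"
proof -
  have "(\<Sum>i<n. (complex_of_real (s i) * cinner (v k) (v i)) *\<^sub>C u i) = of_real (s k) *\<^sub>C u k" if "k < n" for n
  proof -
    have "(complex_of_real (s i) * cinner (v k) (v i)) *\<^sub>C u i = (if i = k then of_real (s k) *\<^sub>C u k else 0)" for i
    proof (cases "i = k")
      case True
      then show ?thesis
        using singular_system_simps(3)[of k] singular_system_simps(8)[of k]
        by (cases "s k = 0") (auto simp: cinner_self)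
    next
      case False
      then have "cinner (v k) (v i) = 0"
        using singular_system_simps(6) unfolding orthonormal0_def by metis
      then show ?thesis using False by simp
    qed
    then show ?thesis using that by simp
  qed
  then have "(\<lambda>n. \<Sum>i<n. (complex_of_real (s i) * cinner (v k) (v i)) *\<^sub>C u i) \<longlonglongrightarrow> of_real (s k) *\<^sub>C u k"
    by (intro tendsto_eventually eventually_sequentiallyI[of "Suc k"]) auto
  then show ?thesis using singular_system_simps(9) LIMSEQ_unique by blast
qed

lemma singular_system_cinner_u: "cinner (A x) (u k) = of_real (s k) * cinner x (v k)"
proof -
  have "cinner (\<Sum>i<n. (complex_of_real (s i) * cinner x (v i)) *\<^sub>C u i) (u k) = of_real (s k) * cinner x (v k)"
    if "k < n" for n
    using orthonormal0_cinner_sum[OF singular_system_simps(5) finite_lessThan, of k n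
        "\<lambda>i. complex_of_real (s i) * cinner x (v i)"] that
      singular_system_simps(3)[of k] singular_system_simps(7)[of k]
    by (cases "s k = 0") (auto split: if_splits)
  then have "(\<lambda>n. cinner (\<Sum>i<n. (complex_of_real (s i) * cinner x (v i)) *\<^sub>C u i) (u k)) \<longlonglongrightarrow>
      of_real (s k) * cinner x (v k)"
    by (intro tendsto_eventually eventually_sequentiallyI[of "Suc k"]) auto
  moreover have "(\<lambda>n. cinner (\<Sum>i<n. (complex_of_real (s i) * cinner x (v i)) *\<^sub>C u i) (u k)) \<longlonglongrightarrow>
      cinner (A x) (u k)"
    by (rule tendsto_cinner[OF singular_system_simps(9) tendsto_const])
  ultimately show ?thesis using LIMSEQ_unique by blast
qed

text \<open>The weak form of saying that \<open>v k\<close> is an eigenvector of the adjoint of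
  \<open>A\<close> composed with \<open>A\<close>; it avoids mentioning the adjoint.\<close>

lemma singular_system_cinner_v: "cinner (A x) (A (v k)) = of_real ((s k)\<^sup>2) * cinner x (v k)"
  by (simp add: singular_system_apply_v cinner_scaleC_right singular_system_cinner_u power2_eq_square)

lemma singular_system_kernel:
  assumes "\<And>k. 0 < s k \<Longrightarrow> cinner x (v k) = 0" shows "A x = 0"
proof -
  have "of_real (s i) * cinner x (v i) = 0" for i
    using assms[of i] singular_system_simps(3)[of i] by (cases "s i = 0") auto
  then have "(\<lambda>n. \<Sum>i<n. (complex_of_real (s i) * cinner x (v i)) *\<^sub>C u i) = (\<lambda>n. 0)"
    by (simp only: complex_vector.scale_zero_left sum.neutral_const)
  with singular_system_simps(9)[of x] show ?thesis by (simp only: LIMSEQ_const_iff)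
qed

lemma singular_system_finite_level:
  assumes "0 < l" shows "finite {n. s n = l}"
proof -
  obtain N where "\<And>n. n \<ge> N \<Longrightarrow> s n < l"
    using order_tendstoD(2)[OF singular_system_simps(4) assms] by (auto simp: eventually_sequentially)
  then have "{n. s n = l} \<subseteq> {..<N}" by (force simp: not_less[symmetric])
  then show ?thesis by (rule finite_subset) simp
qed

text \<open>Subtract from an eigenvector \<open>x\<close> its projection \<open>p\<close> onto the
  span of the \<open>v n\<close> at level \<open>l\<close>. The rest is orthogonal to those
  \<open>v n\<close>, and to every other \<open>v k\<close> with \<open>s k > 0\<close> because the
  eigenvalues differ. So \<open>A\<close> annihilates it, and the eigenvalue relation with
  \<open>l > 0\<close> forces it to be zero.\<close>

lemma singular_system_eigenspace:
  assumes "0 < l"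
  shows "{x. \<forall>y. cinner (A y) (A x) = of_real (l\<^sup>2) * cinner y x} = cspan (v ` {n. s n = l})"
    (is "?E = cspan (v ` ?N)")
proof
  have sub: "complex_vector.subspace ?E"
    using singular_system_simps(1)
    by (auto simp: complex_vector.subspace_def blinfun.add_right cinner_add_right cinner_scaleC_right
      bounded_ops_scaleC algebra_simps)
  show "cspan (v ` ?N) \<subseteq> ?E"
    by (rule complex_vector.span_minimal[OF _ sub]) (use singular_system_cinner_v in auto)
  show "?E \<subseteq> cspan (v ` ?N)"
  proof
    fix x assume x: "x \<in> ?E"
    have fin: "finite ?N" by (rule singular_system_finite_level[OF assms])
    define p where "p = (\<Sum>n\<in>?N. cinner x (v n) *\<^sub>C v n)"
    have p: "p \<in> cspan (v ` ?N)"
      unfolding p_def by (intro complex_vector.span_sum complex_vector.span_scale complex_vector.span_base) auto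
    then have "x - p \<in> ?E"
      using \<open>cspan (v ` ?N) \<subseteq> ?E\<close> complex_vector.subspace_diff[OF sub x] by blast
    then have eig: "cinner (A (x - p)) (A (x - p)) = of_real (l\<^sup>2) * cinner (x - p) (x - p)" by blast
    have "A (x - p) = 0"
    proof (rule singular_system_kernel)
      fix k assume k: "0 < s k"
      show "cinner (x - p) (v k) = 0"
      proof (cases "k \<in> ?N")
        case True
        then show ?thesis
          using orthonormal0_cinner_sum[OF singular_system_simps(6) fin True, of "\<lambda>n. cinner x (v n)"]
          by (auto simp: cinner_diff_left p_def)
      next
        case False
        have "cinner p (v k) = 0"
          unfolding p_def cinner_sum_left
        proof (intro sum.neutral ballI)
          fix n assume "n \<in> ?N"
          then have "n \<noteq> k" using False by auto
          then show "cinner (cinner x (v n) *\<^sub>C v n) (v k) = 0"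
            using singular_system_simps(6) by (simp add: cinner_scaleC_left orthonormal0_def)
        qed
        moreover have "cinner x (v k) = 0"
        proof -
          have "cinner (A (v k)) (A x) = of_real (l\<^sup>2) * cinner (v k) x" using x by blast
          from arg_cong[OF this, of cnj]
          have "cinner (A x) (A (v k)) = of_real (l\<^sup>2) * cinner x (v k)"
            by (simp flip: cinner_commute)
          then have "of_real ((s k)\<^sup>2) * cinner x (v k) = of_real (l\<^sup>2) * cinner x (v k)"
            by (simp only: singular_system_cinner_v)
          moreover have "(s k)\<^sup>2 \<noteq> l\<^sup>2"
            using False k assms by (auto simp: power2_eq_iff)
          ultimately show ?thesis by (metis mult_right_cancel of_real_eq_iff)
        qed
        ultimately show ?thesis by (simp add: cinner_diff_left)
      qed
    qed
    then have "x = p" using eig assms by (simp add: cinner_self)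
    then show "x \<in> cspan (v ` ?N)" using p by simp
  qed
qed

text \<open>Here the adjoint enters: it turns the weak eigenvalue relation into the equation that
  occurs in \<open>singular_values\<close>.\<close>

lemma singular_system_card:
  assumes e: "orthonormal0_basis (e :: nat \<Rightarrow> 'h)" and "0 < l"
  shows "card {n. s n = l} = cdim {x. (cadjoint A o\<^sub>L A) x = complex_of_real (l\<^sup>2) *\<^sub>C x}"
proof -
  have "(cadjoint A o\<^sub>L A) x = complex_of_real (l\<^sup>2) *\<^sub>C x \<longleftrightarrow>
      (\<forall>y. cinner (A y) (A x) = of_real (l\<^sup>2) * cinner y x)" for x
  proof -
    have *: "cinner (A y) (A x) = cinner y ((cadjoint A o\<^sub>L A) x)" for y
      using cadjoint[OF e singular_system_simps(1)] by simp
    have "(cadjoint A o\<^sub>L A) x = complex_of_real (l\<^sup>2) *\<^sub>C x \<longleftrightarrow>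
        (\<forall>y. cinner ((cadjoint A o\<^sub>L A) x) y = cinner (complex_of_real (l\<^sup>2) *\<^sub>C x) y)"
      using cinner_eqI by metis
    also have "\<dots> \<longleftrightarrow> (\<forall>y. cinner y ((cadjoint A o\<^sub>L A) x) = cinner y (complex_of_real (l\<^sup>2) *\<^sub>C x))"
      using cinner_commute by metis
    finally show ?thesis by (simp add: * cinner_scaleC_right)
  qed
  then have "{x. (cadjoint A o\<^sub>L A) x = complex_of_real (l\<^sup>2) *\<^sub>C x} = cspan (v ` {n. s n = l})"
    using singular_system_eigenspace[OF assms(2)] by simp
  moreover have "inj_on v {n. s n = l}" "complex_vector.independent (v ` {n. s n = l})"
    using orthonormal0_independent[OF singular_system_simps(6) singular_system_finite_level[OF assms(2)]]
      singular_system_simps(8) assms(2) by auto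
  ultimately show ?thesis by (metis complex_vector.dim_span_eq_card_independent card_image)
qed

lemma singular_system_finite_rank:
  assumes "A \<in> finite_rank_ops"
  obtains m where "\<And>n. m \<le> n \<Longrightarrow> s n = 0"
proof -
  obtain B where B: "finite B" "range (blinfun_apply A) \<subseteq> cspan B"
    using assms by (auto simp: finite_rank_ops_def)
  \<comment> \<open>Otherwise the \<open>card B + 1\<close> orthonormal vectors \<open>u 0\<close>,
    ..., \<open>u (card B)\<close> all lie in the span of \<open>B\<close>.\<close>
  have "s (card B) = 0"
  proof (rule ccontr)
    assume "s (card B) \<noteq> 0"
    then have pos: "0 < s i" if "i \<le> card B" for i
      using singular_system_simps(3)[of "card B"] decseqD[OF singular_system_simps(2) that] by linarith
    have u: "u i \<in> cspan B" if "i \<le> card B" for i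
    proof -
      have "u i = inverse (complex_of_real (s i)) *\<^sub>C A (v i)"
        using pos[OF that] by (simp add: singular_system_apply_v scaleC_scaleC scaleC_one)
      moreover have "A (v i) \<in> cspan B" using B by blast
      ultimately show ?thesis by (simp only: complex_vector.span_scale)
    qed
    have "inj_on u {..card B}" and ind: "complex_vector.independent (u ` {..card B})"
      using orthonormal0_independent[OF singular_system_simps(5), of "{..card B}"]
        singular_system_simps(7) pos by auto
    then have "card (u ` {..card B}) = Suc (card B)" by (simp add: card_image)
    moreover have "card (u ` {..card B}) \<le> card B"
      using complex_vector.independent_span_bound[OF B(1) ind] u by auto
    ultimately show False by simp
  qed
  then have "s n = 0" if "card B \<le> n" for n
    using singular_system_simps(3)[of n] decseqD[OF singular_system_simps(2) that] by simp
  then show thesis by (rule that)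
qed

end

text \<open>At the first index of disagreement, the larger value is attained there by one sequence;
  the other can attain it only at earlier indices, where both agree. So that positive level has
  different cardinalities.\<close>

lemma decseq_eq_if_card_levels_eq:
  fixes s s' :: "nat \<Rightarrow> real"
  assumes "decseq s" "\<And>n. 0 \<le> s n" "decseq s'" "\<And>n. 0 \<le> s' n"
    and fin: "\<And>l. 0 < l \<Longrightarrow> finite {n. s n = l}" "\<And>l. 0 < l \<Longrightarrow> finite {n. s' n = l}"
    and card: "\<And>l. 0 < l \<Longrightarrow> card {n. s n = l} = card {n. s' n = l}"
  shows "s = s'"
proof (rule ccontr)
  assume "s \<noteq> s'"
  then have ex: "\<exists>n. s n \<noteq> s' n" by auto
  define n where "n = (LEAST n. s n \<noteq> s' n)"
  have n: "s n \<noteq> s' n" unfolding n_def by (rule LeastI_ex[OF ex])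
  have least: "s i = s' i" if "i < n" for i
    using not_less_Least[of i "\<lambda>n. s n \<noteq> s' n"] that unfolding n_def by blast
  have *: False if "decseq t'" "\<And>n. 0 \<le> t' n" "t' n < t n" "\<And>i. i < n \<Longrightarrow> t i = t' i"
    "\<And>l. 0 < l \<Longrightarrow> finite {n. t n = l}" "\<And>l. 0 < l \<Longrightarrow> card {n. t n = l} = card {n. t' n = l}"
  for t t' :: "nat \<Rightarrow> real"
  proof -
    have pos: "0 < t n" using that(2)[of n] that(3) by linarith
    have "{m. t' m = t n} \<subset> {m. t m = t n}"
    proof (intro psubsetI subsetI)
      fix m assume m: "m \<in> {m. t' m = t n}"
      have "m < n"
      proof (rule ccontr)
        assume "\<not> m < n"
        then have "t' m \<le> t' n" using that(1) by (simp add: decseq_def)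
        then show False using m that(3) by simp
      qed
      then show "m \<in> {m. t m = t n}" using m that(4)[of m] by simp
    next
      have "n \<in> {m. t m = t n}" "n \<notin> {m. t' m = t n}" using that(3) by auto
      then show "{m. t' m = t n} \<noteq> {m. t m = t n}" by blast
    qed
    from psubset_card_mono[OF that(5)[OF pos] this] show False using that(6)[OF pos] by simp
  qed
  consider "s n < s' n" | "s' n < s n" using n by linarith
  then show False
  proof cases
    case 1
    show False by (rule *[where t = s' and t' = s, OF assms(1,2) 1]) (use least fin card in auto)
  next
    case 2
    show False by (rule *[where t = s and t' = s', OF assms(3,4) 2]) (use least fin card in auto)
  qed
qed

text \<open>From here on any Schmidt decomposition may be used to compute with
  \<open>singular_values\<close>.\<close>

lemma singular_values_eq:
  fixes A :: "'h::complex_hilbert_space \<Rightarrow>\<^sub>L 'h"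
  assumes e: "orthonormal0_basis (e :: nat \<Rightarrow> 'h)" and sys: "singular_system A s u v"
  shows "singular_values A = s"
  unfolding singular_values_def
proof (rule the_equality)
  show *: "decseq s \<and> (\<forall>n. 0 \<le> s n) \<and> (\<forall>l>0. finite {n. s n = l} \<and> card {n. s n = l} =
      cdim {x. (cadjoint A o\<^sub>L A) x = complex_of_real (l\<^sup>2) *\<^sub>C x})"
    using singular_system_simps(2,3)[OF sys] singular_system_finite_level[OF sys]
      singular_system_card[OF sys e] by blast
  fix s' assume s': "decseq s' \<and> (\<forall>n. 0 \<le> s' n) \<and> (\<forall>l>0. finite {n. s' n = l} \<and> card {n. s' n = l} =
      cdim {x. (cadjoint A o\<^sub>L A) x = complex_of_real (l\<^sup>2) *\<^sub>C x})"
  show "s' = s"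
    by (rule decseq_eq_if_card_levels_eq) (use * s' in auto)
qed

text \<open>Replacing \<open>s j\<close> by \<open>s j - s m\<close> makes the terms from
  \<open>m\<close> on nonpositive and lets the weights below \<open>m\<close> be raised to 1. The
  correction \<open>s m * (\<Sum>j<J. c j)\<close> is at most \<open>real m * s m\<close>, which is
  what the replacement removed from the right.\<close>

lemma weighted_sum_le_initial_sum:
  fixes s c :: "nat \<Rightarrow> real"
  assumes "decseq s" "\<And>n. 0 \<le> s n" "\<And>j. j < J \<Longrightarrow> 0 \<le> c j" "\<And>j. j < J \<Longrightarrow> c j \<le> 1" "(\<Sum>j<J. c j) \<le> real m"
  shows "(\<Sum>j<J. s j * c j) \<le> (\<Sum>j<m. s j)"
proof -
  define g where "g j = (if j < m then s j - s m else 0)" for j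
  have g0: "0 \<le> g j" for j using decseqD[OF assms(1), of j m] by (simp add: g_def)
  have "(s j - s m) * c j \<le> g j" if "j < J" for j
  proof (cases "j < m")
    case True
    then have "0 \<le> s j - s m" using g0[of j] by (simp add: g_def)
    then have "(s j - s m) * c j \<le> (s j - s m) * 1" using assms(4)[OF that] by (rule mult_left_mono[rotated])
    then show ?thesis using True by (simp add: g_def)
  next
    case False
    then have "s j - s m \<le> 0" using decseqD[OF assms(1), of m j] by simp
    then have "(s j - s m) * c j \<le> 0" using assms(3)[OF that] by (rule mult_nonpos_nonneg)
    then show ?thesis using False by (simp add: g_def)
  qed
  then have "(\<Sum>j<J. (s j - s m) * c j) \<le> (\<Sum>j<J. g j)" by (intro sum_mono) auto
  also have "\<dots> \<le> (\<Sum>j<max J m. g j)" using g0 by (intro sum_mono2) auto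
  also have "\<dots> = (\<Sum>j<m. g j)" by (rule sum.mono_neutral_right) (auto simp: g_def)
  also have "\<dots> = (\<Sum>j<m. s j - s m)" by (rule sum.cong) (auto simp: g_def)
  finally have "(\<Sum>j<J. s j * c j) \<le> (\<Sum>j<m. s j) - real m * s m + s m * (\<Sum>j<J. c j)"
    by (simp add: left_diff_distrib sum_subtractf sum_distrib_left)
  also have "s m * (\<Sum>j<J. c j) \<le> s m * real m" by (rule mult_left_mono[OF assms(5,2)])
  finally show ?thesis by simp
qed

section \<open>The variational formula for the ideal norm\<close>

context symmetric_norming
begin

text \<open>For an index set \<open>I\<close> the Schmidt expansion bounds the sum of the
  coefficients by a weighted sum of singular values. Both Bessel properties make each weight
  \<open>c j\<close> at most 1 and their total at most \<open>card I\<close>, so the sum is at most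
  that of the \<open>card I\<close> largest singular values, as majorization requires.\<close>

lemma bessel_le_singular_values:
  fixes A :: "'h::complex_hilbert_space \<Rightarrow>\<^sub>L 'h"
  assumes sys: "singular_system A s u v" and xy: "bessel n x" "bessel n y"
  shows "\<Phi> (cut n (\<lambda>i. cinner (A (x i)) (y i))) \<le> \<Phi> (cut n s)"
proof -
  note simps = singular_system_simps[OF sys]
  have "\<Phi> (cut n (\<lambda>i. cinner (A (x i)) (y i))) = \<Phi> (cut n (\<lambda>i. of_real (cmod (cinner (A (x i)) (y i)))))"
    by (rule cong_cmod_cut) simp
  also have "\<dots> \<le> \<Phi> (cut n s)"
  proof (rule majorization)
    fix I assume I: "I \<subseteq> {..<n}"
    then have fin: "finite I" by (rule finite_subset) simp
    \<comment> \<open>The expansion is truncated at \<open>J\<close> so that only finite sums are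
      interchanged; the bound does not depend on \<open>J\<close>.\<close>
    define S where "S J i = (\<Sum>j<J. of_real (s j) * cinner (x i) (v j) * cinner (u j) (y i))" for J i
    have "(\<lambda>J. \<Sum>i\<in>I. cmod (S J i)) \<longlonglongrightarrow> (\<Sum>i\<in>I. cmod (cinner (A (x i)) (y i)))"
      unfolding S_def by (rule tendsto_sum, rule tendsto_norm, rule singular_system_cinner[OF sys])
    moreover have "(\<Sum>i\<in>I. cmod (S J i)) \<le> (\<Sum>i<card I. s i)" for J
    proof -
      define c where "c j = (\<Sum>i\<in>I. cmod (cinner (x i) (v j)) * cmod (cinner (u j) (y i)))" for j
      have "cmod (S J i) \<le> (\<Sum>j<J. s j * (cmod (cinner (x i) (v j)) * cmod (cinner (u j) (y i))))" for i
        unfolding S_def by (rule sum_norm_le) (use simps(3) in \<open>simp add: norm_mult\<close>)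
      then have "(\<Sum>i\<in>I. cmod (S J i)) \<le>
          (\<Sum>i\<in>I. \<Sum>j<J. s j * (cmod (cinner (x i) (v j)) * cmod (cinner (u j) (y i))))"
        by (intro sum_mono) auto
      also have "\<dots> = (\<Sum>j<J. s j * c j)"
        unfolding c_def sum_distrib_left by (rule sum.swap)
      also have "\<dots> \<le> (\<Sum>i<card I. s i)"
      proof (rule weighted_sum_le_initial_sum[OF simps(2,3)])
        show "0 \<le> c j" for j unfolding c_def by (intro sum_nonneg) simp
        show "c j \<le> 1" for j
        proof -
          have "c j \<le> (\<Sum>i<n. cmod (cinner (x i) (v j)) * cmod (cinner (u j) (y i)))"
            unfolding c_def by (rule sum_mono2) (use I in auto)
          also have "\<dots> \<le> norm (v j) * norm (u j)" by (rule bessel_sum_mult[OF xy])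
          also have "\<dots> \<le> 1 * 1"
            by (intro mult_mono orthonormal0_norm_le simps) auto
          finally show ?thesis by simp
        qed
        have "(\<Sum>j<J. c j) = (\<Sum>i\<in>I. \<Sum>j<J. cmod (cinner (x i) (v j)) * cmod (cinner (u j) (y i)))"
          unfolding c_def by (rule sum.swap)
        also have "\<dots> \<le> (\<Sum>i\<in>I. 1)"
        proof (rule sum_mono)
          fix i assume "i \<in> I"
          then have "i < n" using I by auto
          have "(\<Sum>j<J. cmod (cinner (u j) (y i)) * cmod (cinner (x i) (v j))) \<le> norm (y i) * norm (x i)"
            by (rule bessel_sum_mult[OF orthonormal0_bessel[OF simps(5)] orthonormal0_bessel[OF simps(6)]])
          also have "\<dots> \<le> 1 * 1"
            by (intro mult_mono bessel_norm_le[OF _ \<open>i < n\<close>] xy) auto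
          finally show "(\<Sum>j<J. cmod (cinner (x i) (v j)) * cmod (cinner (u j) (y i))) \<le> 1"
            by (simp add: mult.commute)
        qed
        finally show "(\<Sum>j<J. c j) \<le> real (card I)" by simp
      qed
      finally show ?thesis .
    qed
    ultimately show "(\<Sum>i\<in>I. cmod (cinner (A (x i)) (y i))) \<le> (\<Sum>i<card I. s i)"
      using LIMSEQ_le_const2 by blast
  qed simp
  finally show ?thesis .
qed

lemma C_norm_upper:
  fixes A :: "'h::complex_hilbert_space \<Rightarrow>\<^sub>L 'h"
  assumes e: "orthonormal0_basis (e :: nat \<Rightarrow> 'h)" and A: "A \<in> C_ideal \<Phi>"
    and xy: "bessel n x" "bessel n y"
  shows "\<Phi> (cut n (\<lambda>i. cinner (A (x i)) (y i))) \<le> C_norm \<Phi> A"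
proof -
  have "A \<in> compact_ops" using A by (simp add: C_ideal_def)
  then obtain s u v where sys: "singular_system A s u v" by (rule singular_system_exists)
  have s: "singular_values A = s" by (rule singular_values_eq[OF e sys])
  \<comment> \<open>Membership in the ideal excludes the value \<open>\<infinity>\<close>, at which
    \<open>C_norm\<close> would return 0 and the estimate would be lost.\<close>
  have fin: "\<bar>sn_ext \<Phi> s\<bar> \<noteq> \<infinity>"
    using A sn_ext_nonneg[of s] by (auto simp: C_ideal_def sn_space_def s)
  have "\<Phi> (cut n (\<lambda>i. cinner (A (x i)) (y i))) \<le> \<Phi> (cut n s)"
    by (rule bessel_le_singular_values[OF sys xy])
  also have "ereal \<dots> \<le> sn_ext \<Phi> s" unfolding sn_ext_SUP by (rule SUP_upper) simp
  then have "\<Phi> (cut n s) \<le> C_norm \<Phi> A"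
    unfolding C_norm_def s using fin by (metis ereal_less_eq(3) ereal_real)
  finally show ?thesis .
qed

text \<open>The singular vectors \<open>v\<close> and \<open>u\<close> are themselves admissible
  Bessel families with coefficients \<open>s i\<close>, so a bound over all families bounds every
  truncation of the singular values. Since it also yields membership, this is the way into the ideal
  for sums, multiples and compressions.\<close>

lemma C_norm_least:
  fixes A :: "'h::complex_hilbert_space \<Rightarrow>\<^sub>L 'h"
  assumes e: "orthonormal0_basis (e :: nat \<Rightarrow> 'h)" and A: "A \<in> compact_ops"
    and le: "\<And>n x y. bessel n x \<Longrightarrow> bessel n y \<Longrightarrow> \<Phi> (cut n (\<lambda>i. cinner (A (x i)) (y i))) \<le> c"
  shows "A \<in> C_ideal \<Phi>" "C_norm \<Phi> A \<le> c"
proof -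
  obtain s u v where sys: "singular_system A s u v"
    by (rule singular_system_exists[OF A])
  have s: "singular_values A = s" by (rule singular_values_eq[OF e sys])
  note simps = singular_system_simps[OF sys]
  have "\<Phi> (cut n s) \<le> c" for n
  proof -
    have "cinner (A (v i)) (u i) = of_real (s i)" for i
      using simps(3)[of i] simps(7)[of i]
      by (cases "s i = 0") (auto simp: singular_system_apply_v[OF sys] cinner_scaleC_left cinner_self)
    then show ?thesis using le[OF orthonormal0_bessel[OF simps(6)] orthonormal0_bessel[OF simps(5)], of n] by simp
  qed
  then have ext: "sn_ext \<Phi> s \<le> ereal c" unfolding sn_ext_SUP by (intro SUP_least) simp
  then show "A \<in> C_ideal \<Phi>"
    using A simps(4) by (auto simp: C_ideal_def sn_space_def s intro: le_less_trans tendsto_of_real[where a = 0, simplified])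
  show "C_norm \<Phi> A \<le> c"
    using ext order_trans[OF sn_ext_nonneg ext] unfolding C_norm_def s by (simp add: real_le_ereal_iff)
qed

end

section \<open>The ideals of compact operators\<close>

lemma compact_opsI:
  fixes A :: "'h::complex_hilbert_space \<Rightarrow>\<^sub>L 'h"
  assumes "A \<in> bounded_ops" "compact K" "\<And>x. norm x \<le> 1 \<Longrightarrow> A x \<in> K"
  shows "A \<in> compact_ops"
proof -
  have "closure (blinfun_apply A ` cball 0 1) \<subseteq> K"
    using assms(2,3) by (intro closure_minimal compact_imp_closed) auto
  then have "compact (K \<inter> closure (blinfun_apply A ` cball 0 1))"
    using assms(2) by (intro compact_Int_closed) auto
  then show ?thesis
    using assms(1) \<open>closure _ \<subseteq> K\<close> by (simp add: compact_ops_def Int_absorb1)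
qed

lemma compact_ops_imp_bounded: "A \<in> compact_ops \<Longrightarrow> A \<in> bounded_ops"
  by (simp add: compact_ops_def)

lemma compact_opsD:
  fixes A :: "'h::complex_hilbert_space \<Rightarrow>\<^sub>L 'h"
  assumes "A \<in> compact_ops"
  shows "compact (closure (blinfun_apply A ` cball 0 1))"
    "norm x \<le> 1 \<Longrightarrow> A x \<in> closure (blinfun_apply A ` cball 0 1)"
  using assms closure_subset[of "blinfun_apply A ` cball 0 1"] by (auto simp: compact_ops_def)

lemma compact_ops_add:
  fixes A B :: "'h::complex_hilbert_space \<Rightarrow>\<^sub>L 'h"
  assumes "A \<in> compact_ops" "B \<in> compact_ops" shows "A + B \<in> compact_ops"
proof (rule compact_opsI)
  show "A + B \<in> bounded_ops" using assms by (intro bounded_ops_add compact_ops_imp_bounded)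
  show "compact {a + b | a b. a \<in> closure (blinfun_apply A ` cball 0 1) \<and> b \<in> closure (blinfun_apply B ` cball 0 1)}"
    by (rule compact_sums[OF compact_opsD(1)[OF assms(1)] compact_opsD(1)[OF assms(2)]])
  show "(A + B) x \<in> {a + b | a b. a \<in> closure (blinfun_apply A ` cball 0 1) \<and> b \<in> closure (blinfun_apply B ` cball 0 1)}"
    if "norm x \<le> 1" for x
    using compact_opsD(2)[OF assms(1) that] compact_opsD(2)[OF assms(2) that]
    unfolding blinfun.add_left by blast
qed

lemma compact_ops_scale:
  fixes A :: "'h::complex_hilbert_space \<Rightarrow>\<^sub>L 'h"
  assumes "A \<in> compact_ops" shows "c *\<^sub>C A \<in> compact_ops"
proof (rule compact_opsI)
  show "c *\<^sub>C A \<in> bounded_ops" using assms by (intro bounded_ops_scale compact_ops_imp_bounded)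
  show "compact ((\<lambda>y. c *\<^sub>C y) ` closure (blinfun_apply A ` cball 0 1))"
    by (intro compact_continuous_image compact_opsD(1)[OF assms] linear_continuous_on bounded_linear_scaleC_right)
  show "(c *\<^sub>C A) x \<in> (\<lambda>y. c *\<^sub>C y) ` closure (blinfun_apply A ` cball 0 1)" if "norm x \<le> 1" for x
    unfolding blinfun_apply_scaleC by (rule imageI, rule compact_opsD(2)[OF assms that])
qed

section \<open>Rank-one operators and compressions\<close>

definition rank_one :: "'h::complex_hilbert_space \<Rightarrow> 'h \<Rightarrow> 'h \<Rightarrow>\<^sub>L 'h" where
  "rank_one f g = Blinfun (\<lambda>x. cinner x g *\<^sub>C f)"

lemma rank_one_apply: "rank_one f g x = cinner x g *\<^sub>C f"
proof -
  have "bounded_linear (\<lambda>x. cinner x g *\<^sub>C f)"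
  proof (rule bounded_linear_intro)
    show "norm (cinner x g *\<^sub>C f) \<le> norm x * (norm g * norm f)" for x
      using mult_right_mono[OF cinner_Cauchy_Schwarz[of x g], of "norm f"] by (simp add: norm_scaleC mult_ac)
  qed (simp_all add: cinner_add_left scaleC_add_left cinner_scaleC_left scaleC_scaleC flip: scaleC_of_real)
  then show ?thesis by (simp add: rank_one_def bounded_linear_Blinfun_apply)
qed

lemma rank_one_compact: "rank_one f g \<in> compact_ops"
proof (rule compact_opsI)
  show "rank_one f g \<in> bounded_ops"
    by (simp add: bounded_ops_def rank_one_apply cinner_scaleC_left scaleC_scaleC)
  have "bounded_linear (\<lambda>z. z *\<^sub>C f)"
    by (rule bounded_linear_intro[where K = "norm f"])
      (simp_all add: scaleC_add_left norm_scaleC scaleR_conv_of_real flip: scaleC_of_real scaleC_scaleC)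
  then show "compact ((\<lambda>z. z *\<^sub>C f) ` cball 0 (norm g))"
    by (intro compact_continuous_image linear_continuous_on) auto
  show "rank_one f g x \<in> (\<lambda>z. z *\<^sub>C f) ` cball 0 (norm g)" if "norm x \<le> 1" for x
  proof -
    have "cmod (cinner x g) \<le> norm x * norm g" by (rule cinner_Cauchy_Schwarz)
    also have "\<dots> \<le> 1 * norm g" using that by (rule mult_right_mono) simp
    finally show ?thesis by (auto simp: rank_one_apply)
  qed
qed

text \<open>This is \<open>P_n A P_n\<close> written out as a finite matrix, so that a functional
  applied to it is a finite combination of matrix entries of \<open>A\<close>.\<close>

definition compress ::
    "(nat \<Rightarrow> 'h::complex_hilbert_space) \<Rightarrow> nat \<Rightarrow> ('h \<Rightarrow>\<^sub>L 'h) \<Rightarrow> 'h \<Rightarrow>\<^sub>L 'h" where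
  "compress e n A = (\<Sum>i<n. \<Sum>j<n. cinner (A (e j)) (e i) *\<^sub>C rank_one (e i) (e j))"

lemma cinner_compress:
  fixes A :: "'h::complex_hilbert_space \<Rightarrow>\<^sub>L 'h"
  assumes "A \<in> bounded_ops"
  shows "cinner (compress e n A x) y = cinner (A (proj e n x)) (proj e n y)"
proof -
  have "cinner (compress e n A x) y = (\<Sum>i<n. \<Sum>j<n. cinner (A (e j)) (e i) * (cinner x (e j) * cinner (e i) y))"
    unfolding compress_def blinfun.sum_left cinner_sum_left blinfun_apply_scaleC cinner_scaleC_left rank_one_apply ..
  also have "\<dots> = cinner (A (proj e n x)) (proj e n y)"
    unfolding proj_def blinfun.sum_right cinner_sum_right cinner_sum_left cinner_scaleC_right
      bounded_ops_scaleC[OF assms] cinner_scaleC_left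
    by (intro sum.cong refl) (simp add: cinner_commute[of _ y] sum_distrib_left mult_ac)
  finally show ?thesis .
qed

lemma compress_add: "compress e n (A + B) = compress e n A + compress e n B"
  by (simp add: compress_def blinfun.add_left cinner_add_left scaleC_add_left sum.distrib)

lemma compress_scale: "compress e n (c *\<^sub>C A) = c *\<^sub>C compress e n A"
  by (simp add: compress_def blinfun_apply_scaleC cinner_scaleC_left complex_vector.scale_sum_right scaleC_scaleC)

text \<open>Reduces every statement about differences to closure under sums and complex
  multiples.\<close>

lemma diff_eq_add_scaleC: "x - y = x + (-1) *\<^sub>C (y :: 'v::complex_vector)"
  by (simp add: complex_vector.scale_minus_left scaleC_one)

lemma compress_diff: "compress e n (A - B) = compress e n A - compress e n B"
  by (simp only: diff_eq_add_scaleC compress_add compress_scale)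

lemma compress_finite_rank:
  fixes A :: "'h::complex_hilbert_space \<Rightarrow>\<^sub>L 'h"
  assumes "A \<in> bounded_ops" shows "compress e n A \<in> finite_rank_ops"
proof -
  have "compress e n A \<in> bounded_ops"
    unfolding compress_def
    by (intro bounded_ops_sum bounded_ops_scale compact_ops_imp_bounded rank_one_compact)
  moreover have "range (compress e n A) \<subseteq> cspan (e ` {..<n})"
  proof (rule image_subsetI)
    fix x
    show "compress e n A x \<in> cspan (e ` {..<n})"
      unfolding compress_def blinfun.sum_left blinfun_apply_scaleC rank_one_apply
      by (rule complex_vector.span_sum, rule complex_vector.span_sum, rule complex_vector.span_scale,
          rule complex_vector.span_scale, rule complex_vector.span_base) simp
  qed
  ultimately show ?thesis by (auto simp: finite_rank_ops_def intro!: exI[of _ "e ` {..<n}"])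
qed

locale separable_ideal = symmetric_norming \<Phi>
  for \<Phi> :: "(nat \<Rightarrow> complex) \<Rightarrow> real" +
  fixes e :: "nat \<Rightarrow> 'h::complex_hilbert_space"
  assumes basis: "orthonormal0_basis e"
begin

abbreviation ideal :: "('h \<Rightarrow>\<^sub>L 'h) set" where "ideal \<equiv> C_ideal \<Phi>"
abbreviation nrm :: "('h \<Rightarrow>\<^sub>L 'h) \<Rightarrow> real" where "nrm \<equiv> C_norm \<Phi>"

lemma ortho: "orthonormal0 e" and proj_tendsto: "(\<lambda>n. proj e n x) \<longlonglongrightarrow> x"
  using basis by (auto simp: orthonormal0_basis_def)

lemma ideal_compact: "A \<in> ideal \<Longrightarrow> A \<in> compact_ops"
  by (simp add: C_ideal_def)

lemma ideal_bounded: "A \<in> ideal \<Longrightarrow> A \<in> bounded_ops"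
  by (intro compact_ops_imp_bounded ideal_compact)

lemmas nrm_upper = C_norm_upper[OF basis]
lemmas nrm_least = C_norm_least[OF basis]

text \<open>The empty Bessel family already witnesses the bound.\<close>

lemma nrm_nonneg: "A \<in> ideal \<Longrightarrow> 0 \<le> nrm A"
  by (rule order_trans[OF nonneg[OF cut_finsupp] nrm_upper[of A 0]]) (auto simp: bessel_def)

text \<open>Matrix coefficients are additive, whereas individual singular values are not
  subadditive; the variational formula reduces the triangle inequality to the one for
  \<open>\<Phi>\<close>.\<close>

lemma ideal_add:
  assumes "A \<in> ideal" "B \<in> ideal"
  shows "A + B \<in> ideal" "nrm (A + B) \<le> nrm A + nrm B"
proof -
  have c: "A + B \<in> compact_ops" using assms by (intro compact_ops_add ideal_compact)
  have *: "\<Phi> (cut n (\<lambda>i. cinner ((A + B) (x i)) (y i))) \<le> nrm A + nrm B"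
    if "bessel n x" "bessel n y" for n x y
    using triangle_cut[of n "\<lambda>i. cinner (A (x i)) (y i)" "\<lambda>i. cinner (B (x i)) (y i)"]
      nrm_upper[OF assms(1) that] nrm_upper[OF assms(2) that]
    by (simp add: blinfun.add_left cinner_add_left)
  show "A + B \<in> ideal" "nrm (A + B) \<le> nrm A + nrm B"
    by (rule nrm_least[OF c *], assumption+)+
qed

lemma ideal_scale:
  assumes "A \<in> ideal"
  shows "c *\<^sub>C A \<in> ideal" "nrm (c *\<^sub>C A) \<le> cmod c * nrm A"
proof -
  have k: "c *\<^sub>C A \<in> compact_ops" using assms by (intro compact_ops_scale ideal_compact)
  have *: "\<Phi> (cut n (\<lambda>i. cinner ((c *\<^sub>C A) (x i)) (y i))) \<le> cmod c * nrm A"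
    if "bessel n x" "bessel n y" for n x y
    using mult_left_mono[OF nrm_upper[OF assms that], of "cmod c"]
    by (simp add: blinfun_apply_scaleC cinner_scaleC_left scale_cut)
  show "c *\<^sub>C A \<in> ideal" "nrm (c *\<^sub>C A) \<le> cmod c * nrm A"
    by (rule nrm_least[OF k *], assumption+)+
qed

lemma ideal_diff:
  assumes "A \<in> ideal" "B \<in> ideal"
  shows "A - B \<in> ideal" "nrm (A - B) \<le> nrm A + nrm B"
  using ideal_add[OF assms(1) ideal_scale(1)[OF assms(2)], of "-1"] ideal_scale(2)[OF assms(2), of "-1"]
  by (simp_all only: diff_eq_add_scaleC) simp

text \<open>The two projections move onto the two Bessel families, which stay Bessel, so the
  supremum runs over fewer pairs.\<close>

lemma ideal_compress:
  assumes "A \<in> ideal"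
  shows "compress e n A \<in> ideal" "nrm (compress e n A) \<le> nrm A"
proof -
  have k: "compress e n A \<in> compact_ops"
  proof -
    have z: "0 \<in> (compact_ops :: ('h \<Rightarrow>\<^sub>L 'h) set)"
      using compact_ops_scale[OF rank_one_compact, of 0] by simp
    have "(\<Sum>i\<in>I. f i) \<in> compact_ops" if "\<And>i. f i \<in> compact_ops" for f :: "nat \<Rightarrow> 'h \<Rightarrow>\<^sub>L 'h" and I
      using that by (induction I rule: infinite_finite_induct) (simp_all add: z compact_ops_add)
    then show ?thesis unfolding compress_def by (simp add: compact_ops_scale rank_one_compact)
  qed
  have *: "\<Phi> (cut m (\<lambda>i. cinner (compress e n A (x i)) (y i))) \<le> nrm A"
    if "bessel m x" "bessel m y" for m x y
    unfolding cinner_compress[OF ideal_bounded[OF assms]]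
    by (rule nrm_upper[OF assms bessel_proj[OF ortho that(1)] bessel_proj[OF ortho that(2)]])
  show "compress e n A \<in> ideal" "nrm (compress e n A) \<le> nrm A"
    by (rule nrm_least[OF k *], assumption+)+
qed

lemma ideal_rank_one:
  shows "rank_one f g \<in> ideal" "nrm (rank_one f g) \<le> norm f * norm g"
proof -
  have *: "\<Phi> (cut n (\<lambda>i. cinner (rank_one f g (x i)) (y i))) \<le> norm f * norm g"
    if "bessel n x" "bessel n y" for n x y
  proof -
    have "\<Phi> (cut n (\<lambda>i. cinner (rank_one f g (x i)) (y i))) \<le> (\<Sum>i<n. cmod (cinner (rank_one f g (x i)) (y i)))"
      by (rule le_sum_cut)
    also have "\<dots> \<le> norm g * norm f"
      using bessel_sum_mult[OF that, of g f] by (simp add: rank_one_apply cinner_scaleC_left norm_mult)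
    finally show ?thesis by (simp add: mult.commute)
  qed
  show "rank_one f g \<in> ideal" "nrm (rank_one f g) \<le> norm f * norm g"
    by (rule nrm_least[OF rank_one_compact *], assumption+)+
qed

text \<open>One fixed sequence of approximants, the same for all operators, replaces the arbitrary
  finite-rank ones. Applied to \<open>A t\<close> it gives a sequence of functions of
  \<open>t\<close> to which dominated convergence can be applied.\<close>

definition approximable :: "('h \<Rightarrow>\<^sub>L 'h) set" where
  "approximable = {A \<in> ideal. (\<lambda>n. nrm (A - compress e n A)) \<longlonglongrightarrow> 0}"

lemma approximableI:
  assumes "A \<in> ideal" "\<And>n. nrm (A - compress e n A) \<le> b n" "b \<longlonglongrightarrow> 0"
  shows "A \<in> approximable"
proof -
  have "(\<lambda>n. nrm (A - compress e n A)) \<longlonglongrightarrow> 0"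
    by (rule tendsto_sandwich[OF _ _ tendsto_const assms(3)])
      (use assms(1,2) in \<open>auto intro!: always_eventually nrm_nonneg ideal_diff ideal_compress\<close>)
  then show ?thesis using assms(1) by (simp add: approximable_def)
qed

lemma approximable_add:
  assumes "A \<in> approximable" "B \<in> approximable" shows "A + B \<in> approximable"
proof (rule approximableI)
  have A: "A \<in> ideal" "(\<lambda>n. nrm (A - compress e n A)) \<longlonglongrightarrow> 0"
    and B: "B \<in> ideal" "(\<lambda>n. nrm (B - compress e n B)) \<longlonglongrightarrow> 0"
    using assms by (auto simp: approximable_def)
  show "A + B \<in> ideal" by (intro ideal_add A B)
  show "nrm ((A + B) - compress e n (A + B)) \<le> nrm (A - compress e n A) + nrm (B - compress e n B)" for n
  proof -
    have eq: "(A + B) - compress e n (A + B) = (A - compress e n A) + (B - compress e n B)"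
      by (simp add: compress_add)
    show ?thesis unfolding eq by (intro ideal_add ideal_diff ideal_compress A B)
  qed
  show "(\<lambda>n. nrm (A - compress e n A) + nrm (B - compress e n B)) \<longlonglongrightarrow> 0"
    by (rule tendsto_add_zero[OF A(2) B(2)])
qed

lemma approximable_scale:
  assumes "A \<in> approximable" shows "c *\<^sub>C A \<in> approximable"
proof (rule approximableI)
  have A: "A \<in> ideal" "(\<lambda>n. nrm (A - compress e n A)) \<longlonglongrightarrow> 0"
    using assms by (auto simp: approximable_def)
  show "c *\<^sub>C A \<in> ideal" by (intro ideal_scale A)
  show "nrm (c *\<^sub>C A - compress e n (c *\<^sub>C A)) \<le> cmod c * nrm (A - compress e n A)" for n
  proof -
    have eq: "c *\<^sub>C A - compress e n (c *\<^sub>C A) = c *\<^sub>C (A - compress e n A)"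
      by (simp add: compress_scale complex_vector.scale_right_diff_distrib)
    show ?thesis unfolding eq by (intro ideal_scale ideal_diff ideal_compress A)
  qed
  show "(\<lambda>n. cmod c * nrm (A - compress e n A)) \<longlonglongrightarrow> 0"
    by (rule tendsto_mult_right_zero[OF A(2)])
qed

text \<open>Compression just projects both vectors, and the error splits by changing one vector at a
  time.\<close>

lemma approximable_rank_one: "rank_one f g \<in> approximable"
proof (rule approximableI[OF ideal_rank_one(1)])
  fix n
  have "rank_one f g - compress e n (rank_one f g) =
      rank_one (f - proj e n f) g + rank_one (proj e n f) (g - proj e n g)"
  proof (rule bounded_ops_eqI)
    fix x y
    show "cinner ((rank_one f g - compress e n (rank_one f g)) x) y =
      cinner ((rank_one (f - proj e n f) g + rank_one (proj e n f) (g - proj e n g)) x) y"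
      by (simp add: blinfun.diff_left blinfun.add_left cinner_diff_left cinner_add_left rank_one_apply
        cinner_compress[OF ideal_bounded[OF ideal_rank_one(1)]] cinner_scaleC_left cinner_diff_right
        cinner_proj_left algebra_simps)
  qed
  then have "nrm (rank_one f g - compress e n (rank_one f g)) \<le>
      nrm (rank_one (f - proj e n f) g) + nrm (rank_one (proj e n f) (g - proj e n g))"
    using ideal_add(2)[OF ideal_rank_one(1) ideal_rank_one(1)] by simp
  also have "\<dots> \<le> norm (f - proj e n f) * norm g + norm (proj e n f) * norm (g - proj e n g)"
    by (intro add_mono ideal_rank_one)
  finally show "nrm (rank_one f g - compress e n (rank_one f g)) \<le>
      norm (f - proj e n f) * norm g + norm (proj e n f) * norm (g - proj e n g)" .
next
  have "(\<lambda>n. norm (f - proj e n f) * norm g + norm (proj e n f) * norm (g - proj e n g)) \<longlonglongrightarrow>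
      norm (f - f) * norm g + norm f * norm (g - g)"
    by (intro tendsto_intros proj_tendsto)
  then show "(\<lambda>n. norm (f - proj e n f) * norm g + norm (proj e n f) * norm (g - proj e n g)) \<longlonglongrightarrow> 0"
    by simp
qed

lemma approximable_sum: "(\<And>i. i \<in> I \<Longrightarrow> f i \<in> approximable) \<Longrightarrow> (\<Sum>i\<in>I. f i) \<in> approximable"
proof (induction I rule: infinite_finite_induct)
  have "0 \<in> approximable" using approximable_scale[OF approximable_rank_one, of 0] by simp
  then show "(\<Sum>i\<in>I. f i) \<in> approximable" if "infinite I" for I using that by simp
  show "(\<Sum>i\<in>{}. f i) \<in> approximable" using \<open>0 \<in> approximable\<close> by simp
qed (auto intro: approximable_add)

lemma approximable_compress: "compress e n A \<in> approximable"
  unfolding compress_def by (intro approximable_sum approximable_scale approximable_rank_one)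

text \<open>The Schmidt expansion terminates, leaving a finite sum of rank-one operators.\<close>

lemma approximable_finite_rank:
  assumes "F \<in> ideal" "F \<in> finite_rank_ops" shows "F \<in> approximable"
proof -
  obtain s u v where sys: "singular_system F s u v"
    using ideal_compact[OF assms(1)] by (rule singular_system_exists)
  obtain m where m: "\<And>n. m \<le> n \<Longrightarrow> s n = 0"
    using singular_system_finite_rank[OF sys assms(2)] by blast
  have "F = (\<Sum>i<m. of_real (s i) *\<^sub>C rank_one (u i) (v i))"
  proof (rule blinfun_eqI)
    fix x
    let ?f = "\<lambda>n. \<Sum>i<n. (complex_of_real (s i) * cinner x (v i)) *\<^sub>C u i"
    have "?f n = ?f m" if "m \<le> n" for n
      by (rule sum.mono_neutral_right) (use that m in auto)
    then have "?f \<longlonglongrightarrow> ?f m"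
      by (intro tendsto_eventually eventually_sequentiallyI[of m])
    then have "F x = ?f m" using singular_system_simps(9)[OF sys] LIMSEQ_unique by blast
    then show "F x = (\<Sum>i<m. of_real (s i) *\<^sub>C rank_one (u i) (v i)) x"
      by (simp add: blinfun.sum_left blinfun_apply_scaleC rank_one_apply scaleC_scaleC)
  qed
  moreover have "(\<Sum>i<m. of_real (s i) *\<^sub>C rank_one (u i) (v i)) \<in> approximable"
    by (intro approximable_sum approximable_scale approximable_rank_one)
  ultimately show ?thesis by simp
qed

text \<open>Compressions are themselves finite-rank approximants, which gives one inclusion. For the
  other, contractivity of compression transfers the approximation from an arbitrary finite-rank
  operator to the fixed sequence.\<close>

lemma C0_ideal_eq_approximable: "C0_ideal \<Phi> = approximable"
proof
  show "approximable \<subseteq> C0_ideal \<Phi>"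
  proof
    fix A assume "A \<in> approximable"
    then have A: "A \<in> ideal" "(\<lambda>n. nrm (A - compress e n A)) \<longlonglongrightarrow> 0"
      by (auto simp: approximable_def)
    have "\<exists>F \<in> ideal \<inter> finite_rank_ops. nrm (A - F) < \<epsilon>" if \<epsilon>: "\<epsilon> > 0" for \<epsilon>
    proof -
      obtain n where "nrm (A - compress e n A) < \<epsilon>"
        using order_tendstoD(2)[OF A(2) \<epsilon>] by (auto simp: eventually_sequentially)
      then show ?thesis
        using ideal_compress(1)[OF A(1)] compress_finite_rank[OF ideal_bounded[OF A(1)]] by blast
    qed
    then show "A \<in> C0_ideal \<Phi>" using A(1) by (simp add: C0_ideal_def)
  qed
  show "C0_ideal \<Phi> \<subseteq> approximable"
  proof
    fix A :: "'h \<Rightarrow>\<^sub>L 'h" assume A0: "A \<in> C0_ideal \<Phi>"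
    then have A: "A \<in> ideal" by (simp add: C0_ideal_def)
    have "(\<lambda>n. nrm (A - compress e n A)) \<longlonglongrightarrow> 0"
    proof (rule LIMSEQ_I)
      fix \<epsilon> :: real assume "\<epsilon> > 0"
      then have "\<epsilon> / 3 > 0" by simp
      then have "\<exists>F \<in> ideal \<inter> finite_rank_ops. nrm (A - F) < \<epsilon> / 3"
        using A0 unfolding C0_ideal_def by blast
      then obtain F where F: "F \<in> ideal" "F \<in> finite_rank_ops" "nrm (A - F) < \<epsilon> / 3"
        by blast
      have "(\<lambda>n. nrm (F - compress e n F)) \<longlonglongrightarrow> 0"
        using approximable_finite_rank[OF F(1,2)] by (simp add: approximable_def)
      then have "\<forall>\<^sub>F n in sequentially. nrm (F - compress e n F) < \<epsilon> / 3"
        using \<open>\<epsilon> > 0\<close> by (intro order_tendstoD) auto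
      then obtain N where N: "\<And>n. n \<ge> N \<Longrightarrow> nrm (F - compress e n F) < \<epsilon> / 3"
        by (auto simp: eventually_sequentially)
      have "norm (nrm (A - compress e n A) - 0) < \<epsilon>" if "n \<ge> N" for n
      proof -
        have d: "A - F \<in> ideal" "F - compress e n F \<in> ideal"
          by (auto intro!: ideal_diff A F ideal_compress)
        \<comment> \<open>Three errors, each below a third of \<open>\<epsilon>\<close>:
          \<open>A - F\<close> itself, its compression, and the compression error of
          \<open>F\<close>.\<close>
        have eq: "A - compress e n A = ((A - F) + (F - compress e n F)) - compress e n (A - F)"
          by (simp add: compress_diff)
        have "nrm (A - compress e n A) \<le> nrm ((A - F) + (F - compress e n F)) + nrm (compress e n (A - F))"
          unfolding eq by (rule ideal_diff(2)[OF ideal_add(1)[OF d] ideal_compress(1)[OF d(1)]])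
        also have "\<dots> \<le> (nrm (A - F) + nrm (F - compress e n F)) + nrm (A - F)"
          by (intro add_mono ideal_add(2) ideal_compress(2) d)
        also have "\<dots> < \<epsilon>" using N[OF that] F(3) by simp
        finally show ?thesis
          using nrm_nonneg[OF ideal_diff(1)[OF A ideal_compress(1)[OF A]], of n] by simp
      qed
      then show "\<exists>N. \<forall>n\<ge>N. norm (nrm (A - compress e n A) - 0) < \<epsilon>" by blast
    qed
    then show "A \<in> approximable" using A by (simp add: approximable_def)
  qed
qed

end

section \<open>Integration\<close>

text \<open>\<open>G\<close> may take values in a type without a norm, such as sequences, with
  \<open>H\<close> reading off a number or vector. Levels where \<open>H\<close> vanishes are exempt
  from integrability because they may have infinite measure.\<close>

lemma integral_simple_function_comp:
  fixes H :: "'b \<Rightarrow> 'c::{banach, second_countable_topology}"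
  assumes G: "simple_function M G"
    and int: "\<And>a. a \<in> G ` space M \<Longrightarrow> H a \<noteq> 0 \<Longrightarrow> integrable M (indicator (G -` {a} \<inter> space M) :: _ \<Rightarrow> real)"
  shows "(LINT t|M. H (G t)) = (\<Sum>a\<in>G ` space M. measure M (G -` {a} \<inter> space M) *\<^sub>R H a)"
proof -
  have fin: "finite (G ` space M)" using G by (simp add: simple_function_def)
  have "(LINT t|M. H (G t)) = (LINT t|M. (\<Sum>a\<in>G ` space M. indicator (G -` {a} \<inter> space M) t *\<^sub>R H a))"
  proof (rule Bochner_Integration.integral_cong[OF refl])
    fix t assume t: "t \<in> space M"
    have "(\<Sum>a\<in>G ` space M. indicator (G -` {a} \<inter> space M) t *\<^sub>R H a) =
        (\<Sum>a\<in>G ` space M. if a = G t then H (G t) else 0)"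
      by (rule sum.cong) (use t in auto)
    then show "H (G t) = (\<Sum>a\<in>G ` space M. indicator (G -` {a} \<inter> space M) t *\<^sub>R H a)"
      using fin t by simp
  qed
  also have "\<dots> = (\<Sum>a\<in>G ` space M. LINT t|M. indicator (G -` {a} \<inter> space M) t *\<^sub>R H a)"
  proof (rule Bochner_Integration.integral_sum)
    show "integrable M (\<lambda>t. indicator (G -` {a} \<inter> space M) t *\<^sub>R H a)" if "a \<in> G ` space M" for a
      using int[OF that] by (cases "H a = 0") auto
  qed
  also have "\<dots> = (\<Sum>a\<in>G ` space M. measure M (G -` {a} \<inter> space M) *\<^sub>R H a)"
  proof (rule sum.cong[OF refl])
    fix a assume "a \<in> G ` space M"
    then show "(LINT t|M. indicator (G -` {a} \<inter> space M) t *\<^sub>R H a) = measure M (G -` {a} \<inter> space M) *\<^sub>R H a"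
      using int[of a] by (cases "H a = 0") simp_all
  qed
  finally show ?thesis .
qed

lemma integrable_simple_approximation:
  fixes f :: "'t \<Rightarrow> complex"
  assumes "integrable M f"
  obtains s where "\<And>k. simple_function M (s k)" "\<And>t. t \<in> space M \<Longrightarrow> (\<lambda>k. s k t) \<longlonglongrightarrow> f t"
    "\<And>k t. t \<in> space M \<Longrightarrow> cmod (s k t) \<le> 2 * cmod (f t)" "\<And>k. integrable M (s k)"
proof -
  have "f \<in> borel_measurable M" using assms by auto
  from borel_measurable_implies_sequence_metric[OF this, of 0]
  obtain s where "\<forall>k. simple_function M (s k)" "\<forall>t\<in>space M. (\<lambda>k. s k t) \<longlonglongrightarrow> f t"
    "\<forall>k. \<forall>t\<in>space M. dist (s k t) 0 \<le> 2 * dist (f t) 0"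
    by blast
  then have s: "\<And>k. simple_function M (s k)" "\<And>t. t \<in> space M \<Longrightarrow> (\<lambda>k. s k t) \<longlonglongrightarrow> f t"
    "\<And>k t. t \<in> space M \<Longrightarrow> cmod (s k t) \<le> 2 * cmod (f t)"
    by simp_all
  have "integrable M (s k)" for k
  proof (rule Bochner_Integration.integrable_bound)
    show "integrable M (\<lambda>t. 2 * cmod (f t))" using assms by auto
    show "s k \<in> borel_measurable M" by (rule borel_measurable_simple_function[OF s(1)])
  qed (use s(3) in auto)
  with s show thesis by (rule that)
qed

text \<open>Chebyshev's inequality: the indicator is dominated by \<open>cmod (f t)\<close> divided
  by \<open>c\<close>.\<close>

lemma integrable_indicator_level:
  fixes f :: "'t \<Rightarrow> complex"
  assumes "integrable M f" "A \<in> sets M" "c > 0" "\<And>t. t \<in> A \<Longrightarrow> c \<le> cmod (f t)"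
  shows "integrable M (indicator A :: _ \<Rightarrow> real)"
proof (rule Bochner_Integration.integrable_bound)
  show "integrable M (\<lambda>t. inverse c * cmod (f t))" using assms(1) by auto
  show "AE t in M. norm (indicator A t :: real) \<le> norm (inverse c * cmod (f t))"
    using assms(3,4) by (intro AE_I2) (auto simp: indicator_def field_simps)
qed (use assms(2) in simp)

lemma integrable_imp_mu_measurable:
  fixes f :: "'t \<Rightarrow> complex"
  assumes "integrable M f" shows "mu_measurable M f"
proof -
  obtain s where s: "\<And>k. simple_function M (s k)" "\<And>t. t \<in> space M \<Longrightarrow> (\<lambda>k. s k t) \<longlonglongrightarrow> f t"
    and int: "\<And>k. integrable M (s k)"
    using integrable_simple_approximation[OF assms] by metis
  have "mu_simple M (s k)" for k
  proof -
    \<comment> \<open>The value 0 is left out, since its level set may have infinite measure and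
      contributes nothing to the sum.\<close>
    define Y where "Y = s k ` space M - {0}"
    have fin: "finite Y" using s(1)[of k] by (simp add: Y_def simple_function_def)
    from ex_bij_betw_nat_finite[OF fin] obtain h where h: "bij_betw h {..<card Y} Y"
      by (auto simp: atLeast0LessThan)
    define A where "A j = s k -` {h j} \<inter> space M" for j
    have hY: "h j \<in> Y" if "j < card Y" for j using bij_betwE[OF h] that by blast
    have A: "A j \<in> sets M" if "j < card Y" for j
      using hY[OF that] s(1)[of k] by (auto simp: A_def Y_def simple_function_def)
    have "emeasure M (A j) < \<infinity>" if "j < card Y" for j
    proof -
      have "integrable M (indicator (A j) :: _ \<Rightarrow> real)"
        by (rule integrable_indicator_level[OF int[of k] A[OF that], of "cmod (h j)"])
          (use hY[OF that] in \<open>auto simp: A_def Y_def\<close>)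
      then show ?thesis using A[OF that] by (auto simp: integrable_indicator_iff A_def)
    qed
    moreover have "disjoint_family_on A {..<card Y}"
    proof (unfold disjoint_family_on_def, intro ballI impI)
      fix i j assume "i \<in> {..<card Y}" "j \<in> {..<card Y}" "i \<noteq> j"
      then have "h i \<noteq> h j" using h by (meson bij_betw_imp_inj_on inj_onD)
      then show "A i \<inter> A j = {}" by (auto simp: A_def)
    qed
    moreover have "s k t = (\<Sum>j<card Y. h j * indicator (A j) t)" if t: "t \<in> space M" for t
    proof -
      have "(\<Sum>j<card Y. h j * indicator (A j) t) = (\<Sum>j<card Y. (\<lambda>y. if y = s k t then y else 0) (h j))"
        by (rule sum.cong) (use t in \<open>auto simp: A_def indicator_def\<close>)
      also have "\<dots> = (\<Sum>y\<in>Y. if y = s k t then y else 0)" by (rule sum.reindex_bij_betw[OF h])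
      also have "\<dots> = s k t" using fin t by (auto simp: Y_def)
      finally show ?thesis ..
    qed
    ultimately show ?thesis unfolding mu_simple_def using A
      by (intro exI[of _ "card Y"] exI[of _ h] exI[of _ A]) auto
  qed
  then show ?thesis unfolding mu_measurable_def using s(2) by (intro exI[of _ s]) auto
qed

section \<open>Jensen's inequality for symmetric norming functions\<close>

context symmetric_norming
begin

lemma triangle_sum_cut:
  "\<Phi> (cut n (\<lambda>i. \<Sum>a\<in>B. g a i)) \<le> (\<Sum>a\<in>B. \<Phi> (cut n (g a)))"
proof (induction B rule: infinite_finite_induct)
  case (insert b B)
  have "\<Phi> (cut n (\<lambda>i. \<Sum>a\<in>insert b B. g a i)) = \<Phi> (cut n (\<lambda>i. g b i + (\<Sum>a\<in>B. g a i)))"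
    using insert by simp
  also have "\<dots> \<le> \<Phi> (cut n (g b)) + \<Phi> (cut n (\<lambda>i. \<Sum>a\<in>B. g a i))" by (rule triangle_cut)
  finally show ?case using insert by simp
qed simp_all

text \<open>Only finitely many coordinates matter, so the map is continuous for the product topology
  and measurability can be checked coordinatewise.\<close>

lemma measurable_cut:
  assumes "\<And>i. i < n \<Longrightarrow> (\<lambda>t. f t i) \<in> borel_measurable M"
  shows "(\<lambda>t. \<Phi> (cut n (f t))) \<in> borel_measurable M"
proof -
  have "continuous_on UNIV (\<lambda>a. \<Phi> (cut n a))"
    unfolding continuous_on_def
  proof (intro ballI tendsto_cut)
    fix a :: "nat \<Rightarrow> complex" and i :: nat
    have "continuous_on UNIV (\<lambda>a. a i :: complex)" by (rule continuous_on_product_coordinates)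
    then show "((\<lambda>b. b i) \<longlongrightarrow> a i) (at a within UNIV)" by (simp add: continuous_on_def)
  qed
  then have "(\<lambda>a. \<Phi> (cut n a)) \<in> borel_measurable borel" by (rule borel_measurable_continuous_onI)
  moreover have "(\<lambda>t. cut n (f t)) \<in> borel_measurable M"
  proof (rule measurable_coordinatewise_then_product)
    show "(\<lambda>t. cut n (f t) i) \<in> borel_measurable M" for i
      using assms[of i] by (cases "i < n") (simp_all add: cut_def)
  qed
  ultimately have "(\<lambda>t. \<Phi> (cut n (cut n (f t)))) \<in> borel_measurable M" by (rule measurable_compose[rotated])
  then show ?thesis by simp
qed

lemma integrable_cut:
  assumes "\<And>i. i < n \<Longrightarrow> integrable M (\<lambda>t. f t i)"
  shows "integrable M (\<lambda>t. \<Phi> (cut n (f t)))"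
proof (rule Bochner_Integration.integrable_bound)
  show "integrable M (\<lambda>t. \<Sum>i<n. cmod (f t i))" using assms by (intro Bochner_Integration.integrable_sum) auto
  show "(\<lambda>t. \<Phi> (cut n (f t))) \<in> borel_measurable M" by (rule measurable_cut) (use assms in auto)
  show "AE t in M. norm (\<Phi> (cut n (f t))) \<le> norm (\<Sum>i<n. cmod (f t i))"
    using le_sum_cut nonneg[OF cut_finsupp] by (intro AE_I2) (simp add: sum_nonneg)
qed

text \<open>On a common refinement of the level sets both integrals are finite weighted sums, and
  the claim is the triangle inequality with nonnegative weights.\<close>

lemma cut_integral_le_simple:
  assumes s: "\<And>i. i < n \<Longrightarrow> simple_function M (\<lambda>t. s t i)" "\<And>i. i < n \<Longrightarrow> integrable M (\<lambda>t. s t i)"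
  shows "\<Phi> (cut n (\<lambda>i. LINT t|M. s t i)) \<le> (LINT t|M. \<Phi> (cut n (s t)))"
proof -
  \<comment> \<open>Collecting the coordinates in one sequence-valued simple function makes its
    levels the common refinement.\<close>
  define G where "G t = cut n (s t)" for t
  have G: "simple_function M G"
    unfolding simple_function_def
  proof (intro conjI ballI)
    let ?V = "\<Union>i<n. (\<lambda>t. s t i) ` space M"
    have fin: "finite {a. \<forall>i. (i \<in> {..<n} \<longrightarrow> a i \<in> ?V) \<and> (i \<notin> {..<n} \<longrightarrow> a i = 0)}"
    proof (rule finite_set_of_finite_funs)
      show "finite ?V" using s(1) by (intro finite_UN_I) (simp_all add: simple_function_def)
    qed simp
    show "finite (G ` space M)"
    proof (rule finite_subset[OF image_subsetI fin])
      fix t assume "t \<in> space M"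
      then have "s t i \<in> ?V" if "i < n" for i using that by blast
      then show "G t \<in> {a. \<forall>i. (i \<in> {..<n} \<longrightarrow> a i \<in> ?V) \<and> (i \<notin> {..<n} \<longrightarrow> a i = 0)}"
        by (simp add: G_def cut_def)
    qed
    fix a
    have "G \<in> borel_measurable M"
    proof (rule measurable_coordinatewise_then_product)
      show "(\<lambda>t. G t i) \<in> borel_measurable M" for i
        using borel_measurable_simple_function[OF s(1), of i] by (cases "i < n") (auto simp: G_def cut_def)
    qed
    then show "G -` {a} \<inter> space M \<in> sets M" by (rule measurable_sets) simp
  qed
  have ind: "integrable M (indicator (G -` {a} \<inter> space M) :: _ \<Rightarrow> real)"
    if a: "a \<in> G ` space M" "i < n" "a i \<noteq> 0" for a i
  proof (rule integrable_indicator_level[OF s(2)[OF a(2)], of _ "cmod (a i)"])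
    show "G -` {a} \<inter> space M \<in> sets M" using G a(1) unfolding simple_function_def by blast
    show "cmod (a i) \<le> cmod (s t i)" if "t \<in> G -` {a} \<inter> space M" for t
      using that a(2) by (auto simp: G_def cut_def)
  qed (use a in simp)
  define w where "w a = measure M (G -` {a} \<inter> space M)" for a
  have "(LINT t|M. s t i) = (\<Sum>a\<in>G ` space M. of_real (w a) * a i)" if "i < n" for i
  proof -
    have "(LINT t|M. s t i) = (LINT t|M. (\<lambda>a. a i) (G t))" using that by (simp add: G_def cut_def)
    also have "\<dots> = (\<Sum>a\<in>G ` space M. w a *\<^sub>R a i)"
      unfolding w_def by (rule integral_simple_function_comp[OF G]) (rule ind[OF _ that])
    finally show ?thesis by (simp add: scaleR_conv_of_real)
  qed
  then have "\<Phi> (cut n (\<lambda>i. LINT t|M. s t i)) = \<Phi> (cut n (\<lambda>i. \<Sum>a\<in>G ` space M. of_real (w a) * a i))"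
    by (intro cong_cmod_cut) simp
  also have "\<dots> \<le> (\<Sum>a\<in>G ` space M. \<Phi> (cut n (\<lambda>i. of_real (w a) * a i)))"
    by (rule triangle_sum_cut)
  also have "\<dots> = (\<Sum>a\<in>G ` space M. w a *\<^sub>R \<Phi> (cut n a))"
    unfolding scale_cut by (simp add: w_def)
  also have "\<dots> = (LINT t|M. \<Phi> (cut n (G t)))"
    unfolding w_def
  proof (rule integral_simple_function_comp[OF G, symmetric])
    \<comment> \<open>A value with nonzero \<open>\<Phi>\<close> has a nonzero coordinate, and
      integrability of that coordinate makes the level set integrable.\<close>
    fix a assume a: "a \<in> G ` space M" "\<Phi> (cut n a) \<noteq> 0"
    have "\<exists>i<n. a i \<noteq> 0"
    proof (rule ccontr)
      assume "\<not> ?thesis"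
      then have "cut n a = cut n (\<lambda>i. 0)" by (auto simp: cut_def)
      then show False using a(2) by simp
    qed
    then show "integrable M (indicator (G -` {a} \<inter> space M) :: _ \<Rightarrow> real)" using ind a(1) by blast
  qed
  also have "\<dots> = (LINT t|M. \<Phi> (cut n (s t)))" by (simp add: G_def)
  finally show ?thesis .
qed

text \<open>Both sides are limits along simple approximations: the left by continuity of
  \<open>\<Phi>\<close> on truncations, the right by dominated convergence.\<close>

lemma cut_integral_le:
  assumes f: "\<And>i. i < n \<Longrightarrow> integrable M (\<lambda>t. f t i)"
  shows "\<Phi> (cut n (\<lambda>i. LINT t|M. f t i)) \<le> (LINT t|M. \<Phi> (cut n (f t)))"
proof -
  have "\<forall>i. \<exists>s. i < n \<longrightarrow> (\<forall>k. simple_function M (s k)) \<and> (\<forall>t\<in>space M. (\<lambda>k. s k t) \<longlonglongrightarrow> f t i) \<and>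
    (\<forall>k. \<forall>t\<in>space M. cmod (s k t) \<le> 2 * cmod (f t i)) \<and> (\<forall>k. integrable M (s k))"
  proof
    fix i
    show "\<exists>s. i < n \<longrightarrow> (\<forall>k. simple_function M (s k)) \<and> (\<forall>t\<in>space M. (\<lambda>k. s k t) \<longlonglongrightarrow> f t i) \<and>
      (\<forall>k. \<forall>t\<in>space M. cmod (s k t) \<le> 2 * cmod (f t i)) \<and> (\<forall>k. integrable M (s k))"
    proof (cases "i < n")
      case True
      from integrable_simple_approximation[OF f[OF True]] show ?thesis by metis
    qed simp
  qed
  then obtain s where s: "\<And>i k. i < n \<Longrightarrow> simple_function M (s i k)"
    "\<And>i t. i < n \<Longrightarrow> t \<in> space M \<Longrightarrow> (\<lambda>k. s i k t) \<longlonglongrightarrow> f t i"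
    "\<And>i k t. i < n \<Longrightarrow> t \<in> space M \<Longrightarrow> cmod (s i k t) \<le> 2 * cmod (f t i)"
    "\<And>i k. i < n \<Longrightarrow> integrable M (s i k)"
    by metis
  have "(\<lambda>k. \<Phi> (cut n (\<lambda>i. LINT t|M. s i k t))) \<longlonglongrightarrow> \<Phi> (cut n (\<lambda>i. LINT t|M. f t i))"
  proof (rule tendsto_cut)
    fix i assume i: "i < n"
    show "(\<lambda>k. LINT t|M. s i k t) \<longlonglongrightarrow> (LINT t|M. f t i)"
    proof (rule integral_dominated_convergence[where w = "\<lambda>t. 2 * cmod (f t i)"])
      show "integrable M (\<lambda>t. 2 * cmod (f t i))" using f[OF i] by auto
    qed (use f[OF i] s(2,3,4)[OF i] in auto)
  qed
  moreover have "(\<lambda>k. LINT t|M. \<Phi> (cut n (\<lambda>i. s i k t))) \<longlonglongrightarrow> (LINT t|M. \<Phi> (cut n (f t)))"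
  proof (rule integral_dominated_convergence[where w = "\<lambda>t. \<Sum>i<n. 2 * cmod (f t i)"])
    show "integrable M (\<lambda>t. \<Sum>i<n. 2 * cmod (f t i))"
      using f by (intro Bochner_Integration.integrable_sum) auto
    show "(\<lambda>t. \<Phi> (cut n (f t))) \<in> borel_measurable M"
      by (rule measurable_cut) (use f in auto)
    show "(\<lambda>t. \<Phi> (cut n (\<lambda>i. s i k t))) \<in> borel_measurable M" for k
      by (rule measurable_cut) (use s(4) in auto)
    show "AE t in M. (\<lambda>k. \<Phi> (cut n (\<lambda>i. s i k t))) \<longlonglongrightarrow> \<Phi> (cut n (f t))"
      by (rule AE_I2, rule tendsto_cut) (rule s(2))
    show "AE t in M. norm (\<Phi> (cut n (\<lambda>i. s i k t))) \<le> (\<Sum>i<n. 2 * cmod (f t i))" for k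
    proof (rule AE_I2)
      fix t assume t: "t \<in> space M"
      have "\<Phi> (cut n (\<lambda>i. s i k t)) \<le> (\<Sum>i<n. cmod (s i k t))" by (rule le_sum_cut)
      also have "\<dots> \<le> (\<Sum>i<n. 2 * cmod (f t i))" using s(3)[OF _ t] by (intro sum_mono) auto
      finally show "norm (\<Phi> (cut n (\<lambda>i. s i k t))) \<le> (\<Sum>i<n. 2 * cmod (f t i))"
        using nonneg[OF cut_finsupp] by simp
    qed
  qed
  moreover have "\<Phi> (cut n (\<lambda>i. LINT t|M. s i k t)) \<le> (LINT t|M. \<Phi> (cut n (\<lambda>i. s i k t)))" for k
    using cut_integral_le_simple[where s = "\<lambda>t i. s i k t"] s(1,4) by blast
  ultimately show ?thesis by (meson LIMSEQ_le)
qed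

text \<open>Homogeneity pulls the indicator out of \<open>\<Phi>\<close>.\<close>

lemma cut_set_integral_le:
  assumes f: "\<And>i. i < n \<Longrightarrow> integrable M (\<lambda>t. f t i)" and E: "E \<in> sets M"
  shows "\<Phi> (cut n (\<lambda>i. LINT t:E|M. f t i)) \<le> (LINT t:E|M. \<Phi> (cut n (f t)))"
proof -
  have *: "\<Phi> (cut n (\<lambda>i. indicator E t *\<^sub>R f t i)) = indicator E t *\<^sub>R \<Phi> (cut n (f t))" for t
    by (simp add: scaleR_conv_of_real scale_cut)
  have "\<Phi> (cut n (\<lambda>i. LINT t|M. indicator E t *\<^sub>R f t i)) \<le> (LINT t|M. \<Phi> (cut n (\<lambda>i. indicator E t *\<^sub>R f t i)))"
    by (rule cut_integral_le) (use f E in \<open>auto intro: integrable_mult_indicator\<close>)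
  then show ?thesis unfolding set_lebesgue_integral_def * .
qed

end

text \<open>The sets come from the functions, as nothing makes \<open>M\<close> itself
  \<sigma>-finite. The majorant \<open>g\<close> is a weighted sum of all the moduli: pointwise
  boundedness makes it finite, the weights make it integrable, and \<open>S k\<close> collects the
  points where \<open>real k * g t\<close> dominates every term.\<close>

lemma exhausting_sets:
  fixes u :: "nat \<Rightarrow> 't \<Rightarrow> real"
  assumes int: "\<And>n. integrable M (u n)"
    and bdd: "\<And>t. t \<in> space M \<Longrightarrow> \<exists>B. \<forall>n. \<bar>u n t\<bar> \<le> B"
  obtains S g where "incseq S" "S 0 = {}" "\<And>k. S k \<in> sets M" "(\<Union>k. S k) = space M"
    "integrable M g" "\<And>k n t. t \<in> S k \<Longrightarrow> \<bar>u n t\<bar> \<le> real k * g t"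
proof -
  \<comment> \<open>Dividing by \<open>1 + c n\<close> caps each integral by 1, so the factors
    \<open>(1/2)^n\<close> make the integrals summable; the summand 1 avoids division by
    zero.\<close>
  define c where "c n = (LINT t|M. \<bar>u n t\<bar>)" for n
  have c: "c n \<ge> 0" for n by (simp add: c_def)
  define a where "a n t = (1/2)^n * (\<bar>u n t\<bar> / (1 + c n))" for n t
  have a0: "0 \<le> a n t" for n t using c[of n] by (simp add: a_def)
  have aint: "integrable M (a n)" for n unfolding a_def using int[of n] by auto
  have summ: "summable (\<lambda>n. a n t)" if t: "t \<in> space M" for t
  proof -
    obtain B where B: "\<And>n. \<bar>u n t\<bar> \<le> B" using bdd[OF t] by blast
    show ?thesis
    proof (rule summable_comparison_test'[where g = "\<lambda>n. B * (1/2)^n"])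
      show "summable (\<lambda>n. B * (1/2)^n)" by (intro summable_mult summable_geometric) simp
      fix n
      have "\<bar>u n t\<bar> / (1 + c n) \<le> \<bar>u n t\<bar> / 1" using c[of n] by (intro divide_left_mono) auto
      also have "\<dots> \<le> B" using B by simp
      finally have "\<bar>u n t\<bar> / (1 + c n) \<le> B" .
      from mult_left_mono[OF this, of "(1/2)^n"] have "a n t \<le> B * (1/2)^n"
        by (simp add: a_def mult.commute)
      then show "norm (a n t) \<le> B * (1/2)^n" using a0[of n t] by simp
    qed
  qed
  define g where "g t = (\<Sum>n. a n t)" for t
  have gint: "integrable M g"
    unfolding g_def
  proof (rule integrable_suminf[OF aint])
    show "AE t in M. summable (\<lambda>n. norm (a n t))" using summ a0 by (intro AE_I2) simp
    show "summable (\<lambda>n. LINT t|M. norm (a n t))"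
    proof (rule summable_comparison_test'[where g = "\<lambda>n. (1/2)^n"])
      show "summable (\<lambda>n. (1/2 :: real)^n)" by (rule summable_geometric) simp
      fix n
      have "(LINT t|M. norm (a n t)) = (1/2)^n * (c n / (1 + c n))"
        using a0 int[of n] by (simp add: a_def c_def)
      also have "\<dots> \<le> (1/2)^n * 1" using c[of n] by (intro mult_left_mono) (auto simp: field_simps)
      finally show "norm (LINT t|M. norm (a n t)) \<le> (1/2)^n"
        by (simp add: abs_of_nonneg integral_nonneg_AE)
    qed
  qed
  have ag: "a n t \<le> g t" if t: "t \<in> space M" for n t
    unfolding g_def using sum_le_suminf[OF summ[OF t], of "{n}"] a0 by simp
  \<comment> \<open>\<open>S 0\<close> is empty so that the successive differences of the sets cover
    the whole space.\<close>
  define S where "S k = (if k = 0 then {} else {t \<in> space M. \<forall>n. \<bar>u n t\<bar> \<le> real k * g t})" for k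
  have g0: "0 \<le> g t" if "t \<in> space M" for t using ag[OF that, of 0] a0[of 0 t] by linarith
  show thesis
  proof (rule that[OF _ _ _ _ gint, of S])
    show "incseq S"
    proof (rule incseq_SucI, rule subsetI)
      fix k t assume t: "t \<in> S k"
      then have sp: "t \<in> space M" and le: "\<bar>u n t\<bar> \<le> real k * g t" for n
        by (auto simp: S_def split: if_splits)
      have "real k * g t \<le> real (Suc k) * g t" using g0[OF sp] by (intro mult_right_mono) auto
      then have "\<bar>u n t\<bar> \<le> real (Suc k) * g t" for n using le[of n] by linarith
      then show "t \<in> S (Suc k)" using sp unfolding S_def by simp
    qed
    show "S k \<in> sets M" for k
    proof -
      have [measurable]: "u n \<in> borel_measurable M" "g \<in> borel_measurable M" for n
        using int[of n] gint by auto
      have "{t \<in> space M. \<forall>n. \<bar>u n t\<bar> \<le> real k * g t} \<in> sets M" by measurable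
      then show ?thesis by (simp add: S_def)
    qed
    show "(\<Union>k. S k) = space M"
    proof
      show "(\<Union>k. S k) \<subseteq> space M" by (auto simp: S_def split: if_splits)
      show "space M \<subseteq> (\<Union>k. S k)"
      proof
        fix t assume t: "t \<in> space M"
        obtain B where B: "\<And>n. \<bar>u n t\<bar> \<le> B" using bdd[OF t] by blast
        have "\<exists>k>0. \<forall>n. \<bar>u n t\<bar> \<le> real k * g t"
        \<comment> \<open>If some \<open>u m t\<close> is nonzero then \<open>g t > 0\<close> and a
          multiple of it exceeds the bound \<open>B\<close>; if all vanish, any positive
          \<open>k\<close> will do.\<close>
        proof (cases "\<exists>m. u m t \<noteq> 0")
          case True
          then obtain m where "u m t \<noteq> 0" by blast
          then have "0 < a m t" using c[of m] by (simp add: a_def)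
          then have "0 < g t" using ag[OF t, of m] by linarith
          obtain k where k: "B / g t < real k" using reals_Archimedean2 by blast
          then have "B \<le> real (Suc k) * g t" using \<open>0 < g t\<close> by (simp add: field_simps)
          then have "\<forall>n. \<bar>u n t\<bar> \<le> real (Suc k) * g t" using B order_trans by blast
          then show ?thesis by blast
        next
          case False
          then show ?thesis using g0[OF t] by (intro exI[of _ 1]) auto
        qed
        then show "t \<in> (\<Union>k. S k)" using t by (auto simp: S_def)
      qed
    qed
    show "\<bar>u n t\<bar> \<le> real k * g t" if "t \<in> S k" for k n t
      using that by (auto simp: S_def split: if_splits)
  qed (simp add: S_def)
qed

section \<open>Integrability from convergent integrals along exhausting sets\<close>

lemma set_integral_incseq:
  fixes f :: "'t \<Rightarrow> complex"
  assumes "integrable M f" "E \<in> sets M" "incseq S" "\<And>k. S k \<in> sets M" "(\<Union>k. S k) = space M"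
  shows "(\<lambda>k. LINT t:E \<inter> S k|M. f t) \<longlonglongrightarrow> (LINT t:E|M. f t)"
proof -
  have u: "(\<Union>k. E \<inter> S k) = E" using assms(2,5) sets.sets_into_space by fastforce
  have "(\<lambda>k. LINT t:E \<inter> S k|M. f t) \<longlonglongrightarrow> (LINT t:(\<Union>k. E \<inter> S k)|M. f t)"
  proof (rule set_integral_cont_up)
    show "incseq (\<lambda>k. E \<inter> S k)" using assms(3) by (auto simp: incseq_def)
    show "set_integrable M (\<Union>k. E \<inter> S k) f"
      unfolding u set_integrable_def using assms(1,2) by (auto intro: integrable_mult_indicator)
  qed (use assms in auto)
  then show ?thesis unfolding u .
qed

text \<open>On the set \<open>E\<close> where \<open>u\<close> is positive the integrals over
  \<open>E \<inter> S k\<close> increase with \<open>k\<close>; their convergence supplies the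
  finite limit that monotone convergence needs.\<close>

lemma integrable_if_set_integrals_convergent_real:
  fixes u :: "'t \<Rightarrow> real"
  assumes u: "u \<in> borel_measurable M" and S: "incseq S" "\<And>k. S k \<in> sets M" "(\<Union>k. S k) = space M"
    and int: "\<And>k. set_integrable M (S k) u"
    and conv: "\<And>E. E \<in> sets M \<Longrightarrow> convergent (\<lambda>k. LINT t:E \<inter> S k|M. u t)"
  shows "integrable M (\<lambda>t. max 0 (u t))"
proof -
  define E where "E = {t \<in> space M. 0 < u t}"
  have E: "E \<in> sets M" using u unfolding E_def by measurable
  obtain L where L: "(\<lambda>k. LINT t:E \<inter> S k|M. u t) \<longlonglongrightarrow> L" using conv[OF E] by (auto simp: convergent_def)
  have eq: "indicator (E \<inter> S k) t *\<^sub>R u t = indicator (S k) t * max 0 (u t)" if "t \<in> space M" for k t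
    using that by (auto simp: E_def indicator_def)
  show ?thesis
  proof (rule integrable_monotone_convergence[where f = "\<lambda>k t. indicator (E \<inter> S k) t *\<^sub>R u t"])
    show "integrable M (\<lambda>t. indicator (E \<inter> S k) t *\<^sub>R u t)" for k
      using set_integrable_subset[OF int[of k], of "E \<inter> S k"] E S(2)[of k] by (simp add: set_integrable_def)
    show "AE t in M. mono (\<lambda>k. indicator (E \<inter> S k) t *\<^sub>R u t)"
    proof (rule AE_I2)
      fix t assume t: "t \<in> space M"
      have "indicator (S j) t * max 0 (u t) \<le> indicator (S k) t * max 0 (u t)" if "j \<le> k" for j k
        using incseqD[OF S(1) that] by (intro mult_right_mono) (auto simp: indicator_def)
      then show "mono (\<lambda>k. indicator (E \<inter> S k) t *\<^sub>R u t)" unfolding eq[OF t] by (rule monoI)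
    qed
    show "AE t in M. (\<lambda>k. indicator (E \<inter> S k) t *\<^sub>R u t) \<longlonglongrightarrow> max 0 (u t)"
    proof (rule AE_I2)
      fix t assume t: "t \<in> space M"
      then obtain K where K: "t \<in> S K" using S(3) by blast
      have "indicator (E \<inter> S k) t *\<^sub>R u t = max 0 (u t)" if "K \<le> k" for k
        unfolding eq[OF t] using incseqD[OF S(1) that] K by auto
      then show "(\<lambda>k. indicator (E \<inter> S k) t *\<^sub>R u t) \<longlonglongrightarrow> max 0 (u t)"
        by (intro tendsto_eventually eventually_sequentiallyI[of K])
    qed
    show "(\<lambda>k. LINT t|M. indicator (E \<inter> S k) t *\<^sub>R u t) \<longlonglongrightarrow> L"
      using L by (simp add: set_lebesgue_integral_def)
  qed (use u in measurable)
qed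

text \<open>The real case is applied to \<open>Re\<close>, \<open>Im\<close> and their negatives,
  giving the positive and negative parts of both components.\<close>

lemma integrable_if_set_integrals_convergent:
  fixes f :: "'t \<Rightarrow> complex"
  assumes f: "f \<in> borel_measurable M" and S: "incseq S" "\<And>k. S k \<in> sets M" "(\<Union>k. S k) = space M"
    and int: "\<And>k. set_integrable M (S k) f"
    and conv: "\<And>E. E \<in> sets M \<Longrightarrow> convergent (\<lambda>k. LINT t:E \<inter> S k|M. f t)"
  shows "integrable M f"
proof -
  have real: "integrable M (\<lambda>t. T (f t))" if T: "bounded_linear T" for T :: "complex \<Rightarrow> real"
  proof -
    have pos: "integrable M (\<lambda>t. max 0 (T (f t)))" if T: "bounded_linear T" for T :: "complex \<Rightarrow> real"
    proof (rule integrable_if_set_integrals_convergent_real[OF _ S])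
      interpret bounded_linear T by (rule T)
      show "(\<lambda>t. T (f t)) \<in> borel_measurable M"
        using f by (rule measurable_compose) (rule borel_measurable_continuous_onI[OF linear_continuous_on[OF T]])
      show i: "set_integrable M (S k) (\<lambda>t. T (f t))" for k
        using integrable_bounded_linear[OF T int[of k, unfolded set_integrable_def]]
        by (simp add: set_integrable_def scaleR)
      fix E assume E: "E \<in> sets M"
      have eq: "(LINT t:E \<inter> S k|M. T (f t)) = T (LINT t:E \<inter> S k|M. f t)" for k
      proof -
        have "set_integrable M (E \<inter> S k) f"
          by (rule set_integrable_subset[OF int[of k]]) (use E S(2) in auto)
        from integral_bounded_linear[OF T this[unfolded set_integrable_def]]
        show ?thesis by (simp add: set_lebesgue_integral_def scaleR)
      qed
      obtain L where "(\<lambda>k. LINT t:E \<inter> S k|M. f t) \<longlonglongrightarrow> L"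
        using conv[OF E] by (auto simp: convergent_def)
      from tendsto[OF this] show "convergent (\<lambda>k. LINT t:E \<inter> S k|M. T (f t))"
        unfolding eq by (rule convergentI)
    qed
    have "integrable M (\<lambda>t. max 0 (T (f t)) - max 0 (- T (f t)))"
      using pos[OF T] pos[OF bounded_linear_minus[OF T]] by (rule Bochner_Integration.integrable_diff)
    moreover have "max 0 x - max 0 (- x) = x" for x :: real by (simp add: max_def)
    ultimately show ?thesis by simp
  qed
  have "integrable M (\<lambda>t. complex_of_real (Re (f t)) + \<i> * complex_of_real (Im (f t)))"
    using real[OF bounded_linear_Re] real[OF bounded_linear_Im] by auto
  then show ?thesis by (simp flip: complex_eq)
qed

text \<open>By Baire, the closed sets of points where the family is bounded by \<open>n\<close>
  cannot all have empty interior. Only real linearity enters, so conjugate-linear maps qualify as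
  well.\<close>

lemma uniform_boundedness:
  fixes F :: "('a::banach \<Rightarrow> 'b::real_normed_vector) set"
  assumes lin: "\<And>L. L \<in> F \<Longrightarrow> bounded_linear L" and bdd: "\<And>x. \<exists>B. \<forall>L\<in>F. norm (L x) \<le> B"
  obtains C where "\<And>L x. L \<in> F \<Longrightarrow> norm (L x) \<le> C * norm x"
proof -
  define T where "T n = {x. \<forall>L\<in>F. norm (L x) \<le> real n}" for n
  have closed: "closed (T n)" for n
  proof -
    have "T n = (\<Inter>L\<in>F. {x. norm (L x) \<le> real n})" by (auto simp: T_def)
    also have "closed \<dots>"
      by (intro closed_INT ballI closed_Collect_le continuous_on_norm linear_continuous_on lin continuous_on_const)
    finally show ?thesis .
  qed
  have cover: "(\<Union>n. T n) = UNIV"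
  proof -
    have "\<exists>n. x \<in> T n" for x
    proof -
      obtain B where B: "\<forall>L\<in>F. norm (L x) \<le> B" using bdd by blast
      obtain n where n: "B \<le> real n" using real_arch_simple by blast
      have "norm (L x) \<le> real n" if "L \<in> F" for L
        using bspec[OF B that] n by linarith
      then have "x \<in> T n" by (simp add: T_def)
      then show ?thesis by (rule exI)
    qed
    then show ?thesis by auto
  qed
  have "\<exists>n. interior (T n) \<noteq> {}"
  proof (rule ccontr)
    assume no: "\<not> ?thesis"
    have "Met_TC.mtopology interior_of \<Union>(range T) = {}"
      by (rule Met_TC.metric_Baire_category_alt) (use closed no complete_UNIV in auto)
    then show False using cover by simp
  qed
  then obtain n x0 where "x0 \<in> interior (T n)" by blast
  then obtain r where r: "r > 0" "cball x0 r \<subseteq> T n" by (auto simp: mem_interior_cball)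
  have "norm (L x) \<le> (2 * real n / r) * norm x" if L: "L \<in> F" for L x
  proof (cases "x = 0")
    case True
    then show ?thesis using linear_0[OF bounded_linear.linear[OF lin[OF L]]] by simp
  next
    case False
    interpret bounded_linear L by (rule lin[OF L])
    \<comment> \<open>Scaled to norm \<open>r\<close>, so that \<open>x0 + y\<close> stays in the
      ball. The difference of two values bounded by \<open>n\<close> gives the constant
      \<open>2 * real n / r\<close>.\<close>
    define y where "y = (r / norm x) *\<^sub>R x"
    have "x0 + y \<in> T n" "x0 \<in> T n" using r False by (auto simp: y_def dist_norm intro!: subsetD[OF r(2)])
    then have "norm (L (x0 + y)) \<le> real n" "norm (L x0) \<le> real n" using L by (auto simp: T_def)
    moreover have "norm (L y) \<le> norm (L (x0 + y)) + norm (L x0)"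
      using norm_triangle_ineq4[of "L (x0 + y)" "L x0"] by (simp add: add)
    ultimately have "norm (L y) \<le> 2 * real n" by linarith
    then show ?thesis using False r(1) by (simp add: y_def scaleR field_simps)
  qed
  then show thesis by (rule that)
qed

section \<open>Weak* integrals\<close>

lemma weak_star_integrable_bounded_ops: "weak_star_integrable M A \<Longrightarrow> t \<in> space M \<Longrightarrow> A t \<in> bounded_ops"
  by (simp add: weak_star_integrable_def)

lemma weak_star_integrable_cinner:
  fixes A :: "'t \<Rightarrow> 'h::complex_hilbert_space \<Rightarrow>\<^sub>L 'h"
  assumes "weak_star_integrable M A"
  shows "integrable M (\<lambda>t. cinner (A t f) g)"
proof -
  have q: "integrable M (\<lambda>t. cinner (A t f) f)" for f
    using assms by (simp add: weak_star_integrable_def)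
  have "integrable M (\<lambda>t. (cinner (A t (f + g)) (f + g) - cinner (A t (f - g)) (f - g)
    + \<i> * cinner (A t (f + \<i> *\<^sub>C g)) (f + \<i> *\<^sub>C g) - \<i> * cinner (A t (f - \<i> *\<^sub>C g)) (f - \<i> *\<^sub>C g)) / 4)"
    by (intro Bochner_Integration.integrable_diff Bochner_Integration.integrable_add
        integrable_mult_right integrable_divide q)
  then show ?thesis
    by (subst Bochner_Integration.integrable_cong[OF refl
        cinner_polarization[OF weak_star_integrable_bounded_ops[OF assms]]])
qed

lemma integrable_indicator_scaleR:
  fixes f :: "'t \<Rightarrow> complex"
  shows "integrable M f \<Longrightarrow> E \<in> sets M \<Longrightarrow> integrable M (\<lambda>t. indicator E t *\<^sub>R f t)"
  by (rule integrable_mult_indicator)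

lemma norm_sgn_le: "norm (sgn x) \<le> 1"
  by (simp add: norm_sgn)

lemma norm_scaleR_sgn: "norm x *\<^sub>R sgn x = x" for x :: "'a::real_normed_vector"
  by (cases "x = 0") (simp_all add: sgn_div_norm)

text \<open>The difficulty is that the form \<open>\<beta> E\<close> be bounded, as the operator
  norms of \<open>A t\<close> have no integrable majorant. Countably many matrix coefficients, along
  a dense sequence, give sets \<open>S k\<close> on which the whole form is dominated by
  \<open>real k * g t\<close>; the bounds over \<open>E \<inter> S k\<close> grow with
  \<open>k\<close>, and uniform boundedness, used once in each variable, removes the
  dependence.\<close>

lemma weak_star_integral_exists:
  fixes A :: "'t \<Rightarrow> 'h::complex_hilbert_space \<Rightarrow>\<^sub>L 'h"
  assumes sep: "separable_space (euclidean :: 'h topology)"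
    and wi: "weak_star_integrable M A" and E: "E \<in> sets M"
  obtains T where "T \<in> bounded_ops" "\<And>f g. cinner (T f) g = (LINT t:E|M. cinner (A t f) g)"
proof -
  obtain e :: "nat \<Rightarrow> 'h" where e: "orthonormal0_basis e" using orthonormal0_basis_exists[OF sep] by blast
  obtain d :: "nat \<Rightarrow> 'h" where d: "\<And>x \<epsilon>. \<epsilon> > 0 \<Longrightarrow> \<exists>n. dist (d n) x < \<epsilon>"
    using separable_dense_sequence[OF sep] by blast
  have dseq: "\<exists>a. (\<lambda>j. d (a j)) \<longlonglongrightarrow> x" for x
  proof -
    have "\<forall>j. \<exists>n. dist (d n) x < inverse (real (Suc j))" using d by simp
    then obtain a where "\<And>j. dist (d (a j)) x < inverse (real (Suc j))" by metis
    then have "(\<lambda>j. dist (d (a j)) x) \<longlonglongrightarrow> 0"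
      by (intro tendsto_sandwich[OF _ _ tendsto_const LIMSEQ_inverse_real_of_nat])
        (auto intro!: always_eventually less_imp_le)
    then show ?thesis using tendsto_dist_iff by blast
  qed
  note bo = weak_star_integrable_bounded_ops[OF wi] and int = weak_star_integrable_cinner[OF wi]
  \<comment> \<open>Normalizing bounds all coefficients at \<open>t\<close> by
    \<open>norm (A t)\<close>, as \<open>exhausting_sets\<close> requires; \<open>sgn 0 = 0\<close>
    takes care of zero vectors.\<close>
  define x where "x n = sgn (d n)" for n
  define u where "u k t = cmod (cinner (A t (x (fst (prod_decode k)))) (x (snd (prod_decode k))))" for k t
  have "\<exists>B. \<forall>k. \<bar>u k t\<bar> \<le> B" for t
  proof (intro exI allI)
    fix k
    have "u k t \<le> norm (A t (x (fst (prod_decode k)))) * norm (x (snd (prod_decode k)))"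
      unfolding u_def by (rule cinner_Cauchy_Schwarz)
    also have "\<dots> \<le> (norm (A t) * norm (x (fst (prod_decode k)))) * norm (x (snd (prod_decode k)))"
      by (intro mult_right_mono norm_blinfun) simp
    also have "\<dots> \<le> (norm (A t) * 1) * 1"
      unfolding x_def by (intro mult_mono norm_sgn_le) auto
    finally show "\<bar>u k t\<bar> \<le> norm (A t)" by (simp add: u_def)
  qed
  moreover have "integrable M (u k)" for k unfolding u_def by (rule integrable_norm[OF int])
  ultimately obtain S g where S: "incseq S" "\<And>k. S k \<in> sets M" "(\<Union>k. S k) = space M"
    and g: "integrable M g" and gS: "\<And>k n t. t \<in> S k \<Longrightarrow> \<bar>u n t\<bar> \<le> real k * g t"
    using exhausting_sets[of M u] by metis
  \<comment> \<open>The estimate holds for the dense sequence by construction and extends to all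
    vectors by continuity of the fixed operator \<open>A t\<close>.\<close>
  have bnd: "cmod (cinner (A t f) h) \<le> real k * g t * norm f * norm h" if t: "t \<in> S k" for k t f h
  proof -
    have dd: "cmod (cinner (A t (d m)) (d n)) \<le> real k * g t * norm (d m) * norm (d n)" for m n
    proof -
      have "cinner (A t (norm (d m) *\<^sub>R x m)) (norm (d n) *\<^sub>R x n) =
          of_real (norm (d m) * norm (d n)) * cinner (A t (x m)) (x n)"
        by (simp add: blinfun.scaleR_right cinner_scaleR_left cinner_scaleR_right)
      then have "cmod (cinner (A t (d m)) (d n)) = (norm (d m) * norm (d n)) * u (prod_encode (m, n)) t"
        by (simp add: x_def norm_scaleR_sgn u_def norm_mult)
      also have "\<dots> \<le> (norm (d m) * norm (d n)) * (real k * g t)"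
        using gS[OF t, of "prod_encode (m, n)"] by (intro mult_left_mono) (auto simp: u_def)
      finally show ?thesis by (simp add: mult_ac)
    qed
    obtain a b where a: "(\<lambda>j. d (a j)) \<longlonglongrightarrow> f" and b: "(\<lambda>j. d (b j)) \<longlonglongrightarrow> h" using dseq by metis
    have "(\<lambda>j. cmod (cinner (A t (d (a j))) (d (b j)))) \<longlonglongrightarrow> cmod (cinner (A t f) h)"
      by (intro tendsto_norm tendsto_cinner b blinfun.tendsto tendsto_const a)
    moreover have "(\<lambda>j. real k * g t * norm (d (a j)) * norm (d (b j))) \<longlonglongrightarrow> real k * g t * norm f * norm h"
      by (intro tendsto_mult tendsto_const tendsto_norm a b)
    ultimately show ?thesis using LIMSEQ_le dd by blast
  qed
  define \<beta> where "\<beta> E f h = (LINT t:E|M. cinner (A t f) h)" for E f h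
  note \<beta>_alt = \<beta>_def[unfolded set_lebesgue_integral_def]
  have int': "integrable M (\<lambda>t. indicator E t *\<^sub>R cinner (A t f) h)" if "E \<in> sets M" for E f h
    by (rule integrable_indicator_scaleR[OF int that])
  have add1: "\<beta> E (f + f') h = \<beta> E f h + \<beta> E f' h"
    and add2: "\<beta> E f (h + h') = \<beta> E f h + \<beta> E f h'" if "E \<in> sets M" for E f f' h h'
    unfolding \<beta>_alt
    by (simp_all add: blinfun.add_right cinner_add_left cinner_add_right scaleR_add_right
        Bochner_Integration.integral_add[OF int'[OF that] int'[OF that]])
  have scale1: "\<beta> E (c *\<^sub>C f) h = c * \<beta> E f h" if "E \<in> sets M" for E c f h
  proof -
    have "\<beta> E (c *\<^sub>C f) h = (LINT t|M. c * (indicator E t *\<^sub>R cinner (A t f) h))"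
      unfolding \<beta>_alt by (rule Bochner_Integration.integral_cong[OF refl])
        (simp add: bounded_ops_scaleC[OF bo] cinner_scaleC_left)
    then show ?thesis unfolding \<beta>_alt by (simp only: integral_mult_right_zero)
  qed
  have scale2: "\<beta> E f (c *\<^sub>C h) = cnj c * \<beta> E f h" if "E \<in> sets M" for E c f h
  proof -
    have "\<beta> E f (c *\<^sub>C h) = (LINT t|M. cnj c * (indicator E t *\<^sub>R cinner (A t f) h))"
      unfolding \<beta>_alt by (rule Bochner_Integration.integral_cong[OF refl])
        (simp add: cinner_scaleC_right)
    then show ?thesis unfolding \<beta>_alt by (simp only: integral_mult_right_zero)
  qed
  define G where "G = (LINT t|M. \<bar>g t\<bar>)"
  have ES: "E \<inter> S k \<in> sets M" for k using E S(2) by blast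
  have \<beta>_bound: "cmod (\<beta> (E \<inter> S k) f h) \<le> real k * G * norm f * norm h" for k f h
  proof -
    have "cmod (\<beta> (E \<inter> S k) f h) \<le> (LINT t|M. norm (indicator (E \<inter> S k) t *\<^sub>R cinner (A t f) h))"
      unfolding \<beta>_alt by (rule integral_norm_bound)
    also have "\<dots> \<le> (LINT t|M. real k * norm f * norm h * \<bar>g t\<bar>)"
    proof (rule integral_mono)
      show "integrable M (\<lambda>t. norm (indicator (E \<inter> S k) t *\<^sub>R cinner (A t f) h))"
        by (rule integrable_norm[OF int'[OF ES]])
      show "integrable M (\<lambda>t. real k * norm f * norm h * \<bar>g t\<bar>)"
        by (rule integrable_mult_right[OF integrable_abs[OF g]])
      show "norm (indicator (E \<inter> S k) t *\<^sub>R cinner (A t f) h) \<le> real k * norm f * norm h * \<bar>g t\<bar>" for t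
      proof (cases "t \<in> E \<inter> S k")
        case True
        then have "cmod (cinner (A t f) h) \<le> real k * g t * norm f * norm h" using bnd by blast
        also have "\<dots> = (real k * norm f * norm h) * g t" by (simp add: mult_ac)
        also have "\<dots> \<le> (real k * norm f * norm h) * \<bar>g t\<bar>" by (intro mult_left_mono) auto
        finally show ?thesis using True by simp
      qed simp
    qed
    finally show ?thesis by (simp add: G_def mult_ac)
  qed
  have lin1: "bounded_linear (\<lambda>f. \<beta> (E \<inter> S k) f h)" for k h
    by (rule bounded_linear_intro[where K = "real k * G * norm h"])
      (use \<beta>_bound in \<open>simp_all add: add1[OF ES] scale1[OF ES] scaleR_conv_of_real mult_ac flip: scaleC_of_real\<close>)
  \<comment> \<open>The form is conjugate-linear in \<open>h\<close>; \<open>bounded_linear\<close>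
    asks for real linearity only.\<close>
  have lin2: "bounded_linear (\<lambda>h. \<beta> (E \<inter> S k) f h)" for k f
  proof (rule bounded_linear_intro)
    show "norm (\<beta> (E \<inter> S k) f h) \<le> norm h * (real k * G * norm f)" for h
      using \<beta>_bound[of k f h] by (simp only: mult.commute[of "norm h"])
  qed (simp_all add: add2[OF ES] scale2[OF ES] scaleR_conv_of_real flip: scaleC_of_real)
  have lim: "(\<lambda>k. \<beta> (E \<inter> S k) f h) \<longlonglongrightarrow> \<beta> E f h" for f h
    unfolding \<beta>_def by (rule set_integral_incseq[OF int E S])
  \<comment> \<open>For fixed \<open>f\<close> and \<open>h\<close> the values converge in
    \<open>k\<close>, hence are bounded; the resulting \<open>C\<close> still depends on
    \<open>f\<close>.\<close>
  have first: "\<exists>C. \<forall>k h. cmod (\<beta> (E \<inter> S k) f h) \<le> C * norm h" for f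
  proof -
    have "\<exists>B. \<forall>L\<in>range (\<lambda>k h. \<beta> (E \<inter> S k) f h). norm (L h) \<le> B" for h
      using convergent_imp_Bseq[OF convergentI[OF lim[of f h]]] by (auto simp: Bseq_def)
    then obtain C where "\<And>L h. L \<in> range (\<lambda>k h. \<beta> (E \<inter> S k) f h) \<Longrightarrow> norm (L h) \<le> C * norm h"
      using uniform_boundedness[of "range (\<lambda>k h. \<beta> (E \<inter> S k) f h)"] lin2 by blast
    then show ?thesis by blast
  qed
  \<comment> \<open>The second application: these maps in \<open>f\<close> are pointwise bounded by
    the preceding step, uniformly over the unit ball of \<open>h\<close>.\<close>
  define F where "F = (\<lambda>(k, h) f. \<beta> (E \<inter> S k) f h) ` (UNIV \<times> cball 0 1)"
  have F_bdd: "\<exists>B. \<forall>L\<in>F. norm (L f) \<le> B" for f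
  proof -
    obtain C where C: "\<And>k h. cmod (\<beta> (E \<inter> S k) f h) \<le> C * norm h" using first by metis
    have "norm (L f) \<le> \<bar>C\<bar>" if "L \<in> F" for L
    proof -
      from that obtain k h where L: "L = (\<lambda>f. \<beta> (E \<inter> S k) f h)" "norm h \<le> 1" by (auto simp: F_def)
      have "cmod (\<beta> (E \<inter> S k) f h) \<le> C * norm h" by (rule C)
      also have "\<dots> \<le> \<bar>C\<bar> * 1" using L(2) by (intro mult_mono) auto
      finally show ?thesis by (simp add: L(1))
    qed
    then show ?thesis by blast
  qed
  have F_lin: "bounded_linear L" if "L \<in> F" for L
    using that lin1 by (auto simp: F_def)
  obtain C where C: "\<And>L f. L \<in> F \<Longrightarrow> norm (L f) \<le> C * norm f"
    using uniform_boundedness[of F, OF F_lin F_bdd] by blast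
  have "cmod (\<beta> E f h) \<le> C * norm f * norm h" for f h
  proof (rule LIMSEQ_le_const2[OF tendsto_norm[OF lim]], intro exI allI impI)
    fix k
    have "\<beta> (E \<inter> S k) f h = norm h *\<^sub>R \<beta> (E \<inter> S k) f (sgn h)"
      using linear_cmul[OF bounded_linear.linear[OF lin2], of k f "norm h" "sgn h"] by (simp add: norm_scaleR_sgn)
    then have "cmod (\<beta> (E \<inter> S k) f h) = norm h * cmod (\<beta> (E \<inter> S k) f (sgn h))" by simp
    also have "(\<lambda>f. \<beta> (E \<inter> S k) f (sgn h)) \<in> F"
      unfolding F_def by (rule image_eqI[of _ _ "(k, sgn h)"]) (simp_all add: norm_sgn_le)
    then have "norm h * cmod (\<beta> (E \<inter> S k) f (sgn h)) \<le> norm h * (C * norm f)"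
      by (intro mult_left_mono C[of "\<lambda>f. \<beta> (E \<inter> S k) f (sgn h)"]) auto
    finally show "cmod (\<beta> (E \<inter> S k) f h) \<le> C * norm f * norm h" by (simp add: mult_ac)
  qed
  then obtain T where "T \<in> bounded_ops" "\<And>f h. cinner (T f) h = \<beta> E f h"
    using sesquilinear_representation[OF e, of "\<beta> E" C] add1[OF E] add2[OF E] scale1[OF E] scale2[OF E]
    by blast
  then show thesis using that unfolding \<beta>_def by blast
qed

lemma weak_star_integral:
  fixes A :: "'t \<Rightarrow> 'h::complex_hilbert_space \<Rightarrow>\<^sub>L 'h"
  assumes "separable_space (euclidean :: 'h topology)" "weak_star_integrable M A" "E \<in> sets M"
  shows "cinner (weak_star_integral M A E f) g = (LINT t:E|M. cinner (A t f) g)"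
proof -
  obtain T where T: "T \<in> bounded_ops" "\<And>f g. cinner (T f) g = (LINT t:E|M. cinner (A t f) g)"
    using weak_star_integral_exists[OF assms] by blast
  have "weak_star_integral M A E = T"
    unfolding weak_star_integral_def
  proof (rule the_equality)
    show "T \<in> bounded_ops \<and> (\<forall>f g. cinner (T f) g = (LINT t:E|M. cinner (A t f) g))" using T by blast
    fix T' assume "T' \<in> bounded_ops \<and> (\<forall>f g. cinner (blinfun_apply T' f) g = (LINT t:E|M. cinner (A t f) g))"
    then show "T' = T" by (intro bounded_ops_eqI) (simp add: T(2))
  qed
  then show ?thesis using T(2) by simp
qed

section \<open>Pettis integrability\<close>

locale weak_star_measure = separable_ideal \<Phi> e
  for \<Phi> :: "(nat \<Rightarrow> complex) \<Rightarrow> real" and e :: "nat \<Rightarrow> 'h::complex_hilbert_space" +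
  fixes M :: "'t measure" and A :: "'t \<Rightarrow> 'h \<Rightarrow>\<^sub>L 'h"
  assumes separable: "separable_space (euclidean :: 'h topology)"
    and weak_star: "weak_star_integrable M A"
    and approximable: "\<And>t. t \<in> space M \<Longrightarrow> A t \<in> approximable"
    and integral_ideal: "\<And>E. E \<in> sets M \<Longrightarrow> weak_star_integral M A E \<in> ideal"
    and countably_additive: "countably_additive_in nrm M (weak_star_integral M A)"
begin

abbreviation \<nu> :: "'t set \<Rightarrow> 'h \<Rightarrow>\<^sub>L 'h" where "\<nu> \<equiv> weak_star_integral M A"

lemmas cinner_\<nu> = weak_star_integral[OF separable weak_star]
lemmas integrable_cinner = weak_star_integrable_cinner[OF weak_star]

lemma A_ideal: "t \<in> space M \<Longrightarrow> A t \<in> ideal"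
  using approximable by (simp add: approximable_def)

lemma \<nu>_empty: "\<nu> {} = 0"
  by (rule bounded_ops_eqI) (simp add: cinner_\<nu> set_lebesgue_integral_def)

lemma \<nu>_Un:
  assumes "E \<in> sets M" "F \<in> sets M" "E \<inter> F = {}" shows "\<nu> (E \<union> F) = \<nu> E + \<nu> F"
proof (rule bounded_ops_eqI)
  fix x y
  have "set_integrable M E (\<lambda>t. cinner (A t x) y)" "set_integrable M F (\<lambda>t. cinner (A t x) y)"
    using assms unfolding set_integrable_def
    by (auto intro: integrable_indicator_scaleR integrable_cinner)
  then have "(LINT t:E \<union> F|M. cinner (A t x) y) = (LINT t:E|M. cinner (A t x) y) + (LINT t:F|M. cinner (A t x) y)"
    by (rule set_integral_Un[OF assms(3)])
  then show "cinner (\<nu> (E \<union> F) x) y = cinner ((\<nu> E + \<nu> F) x) y"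
    using assms by (simp add: cinner_\<nu> blinfun.add_left cinner_add_left)
qed

text \<open>Countable additivity applied to the increments \<open>D i\<close> of the exhaustion
  inside \<open>E\<close>; their finite sums telescope from \<open>S 0 = {}\<close> to
  \<open>\<nu> (E \<inter> S k)\<close>.\<close>

lemma \<nu>_tendsto:
  assumes E: "E \<in> sets M" and S: "incseq S" "S 0 = {}" "\<And>k. S k \<in> sets M" "(\<Union>k. S k) = space M"
  shows "(\<lambda>k. nrm (\<nu> E - \<nu> (E \<inter> S k))) \<longlonglongrightarrow> 0"
proof -
  define D where "D i = E \<inter> (S (Suc i) - S i)" for i
  have D: "D i \<in> sets M" for i unfolding D_def using E S(3) by auto
  have "disjoint_family D"
  proof (unfold disjoint_family_on_def, intro ballI impI)
    have *: "D i \<inter> D j = {}" if "i < j" for i j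
      using incseqD[OF S(1), of "Suc i" j] that by (auto simp: D_def)
    fix i j :: nat assume "i \<noteq> j"
    then show "D i \<inter> D j = {}" using *[of i j] *[of j i] by (cases i j rule: linorder_cases) auto
  qed
  moreover have sum: "(\<Sum>i<k. \<nu> (D i)) = \<nu> (E \<inter> S k)" for k
  proof (induction k)
    case 0
    then show ?case by (simp add: S(2) \<nu>_empty)
  next
    case (Suc k)
    have "E \<inter> S (Suc k) = (E \<inter> S k) \<union> D k"
      using incseqD[OF S(1), of k "Suc k"] by (auto simp: D_def)
    moreover have "\<nu> ((E \<inter> S k) \<union> D k) = \<nu> (E \<inter> S k) + \<nu> (D k)"
    proof (rule \<nu>_Un[OF _ D])
      show "E \<inter> S k \<in> sets M" using E S(3) by (rule sets.Int)
      show "E \<inter> S k \<inter> D k = {}" by (auto simp: D_def)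
    qed
    ultimately show ?case using Suc by simp
  qed
  moreover have "(\<Union>i. D i) = E"
  proof
    show "(\<Union>i. D i) \<subseteq> E" by (auto simp: D_def)
    show "E \<subseteq> (\<Union>i. D i)"
    proof
      fix t assume t: "t \<in> E"
      then have "t \<in> (\<Union>k. S k)" unfolding S(4) by (rule subsetD[OF sets.sets_into_space[OF E]])
      then have ex: "\<exists>k. t \<in> S k" by blast
      define k where "k = (LEAST k. t \<in> S k)"
      have k: "t \<in> S k" unfolding k_def by (rule LeastI_ex[OF ex])
      then have "k \<noteq> 0" using S(2) by (metis empty_iff)
      then obtain i where i: "k = Suc i" by (cases k) auto
      then have "t \<notin> S i" using not_less_Least[of i "\<lambda>k. t \<in> S k"] by (simp add: k_def)
      then have "t \<in> D i" using t k i by (simp add: D_def)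
      then show "t \<in> (\<Union>i. D i)" by blast
    qed
  qed
  ultimately show ?thesis
    using countably_additive D unfolding countably_additive_in_def by (auto dest!: spec[of _ D])
qed

text \<open>A single nearly optimal pair of Bessel families is chosen for each compression error of
  \<open>\<nu> E\<close>; this keeps the integrands measurable without discussing the measurability of \<open>nrm\<close>.\<close>

lemma \<nu>_approximable:
  assumes E: "E \<in> sets M" shows "\<nu> E \<in> approximable"
proof -
  define R where "R n = \<nu> E - compress e n (\<nu> E)" for n
  have R: "R n \<in> ideal" for n
    unfolding R_def by (intro ideal_diff ideal_compress integral_ideal E)
  define P where "P n m x y \<longleftrightarrow> bessel m x \<and> bessel m y \<and>
      nrm (R n) - inverse (real (Suc n)) < \<Phi> (cut m (\<lambda>i. cinner (R n (x i)) (y i)))" for n m x y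
  have "\<exists>m x y. P n m x y" for n
  proof (rule ccontr)
    assume no: "\<not> ?thesis"
    \<comment> \<open>If no pair came within the slack \<open>inverse (real (Suc n))\<close>, the
      variational formula would yield a norm smaller than itself.\<close>
    have "nrm (R n) \<le> nrm (R n) - inverse (real (Suc n))"
    proof (rule nrm_least(2)[OF ideal_compact[OF R]])
      fix m and x y :: "nat \<Rightarrow> 'h" assume "bessel m x" "bessel m y"
      moreover have "\<not> P n m x y" using no by blast
      ultimately show "\<Phi> (cut m (\<lambda>i. cinner (R n (x i)) (y i))) \<le> nrm (R n) - inverse (real (Suc n))"
        by (simp only: P_def not_less simp_thms)
    qed
    then show False by simp
  qed
  then obtain m x y where "\<And>n. P n (m n) (x n) (y n)" by metis
  then have b: "\<And>n. bessel (m n) (x n)" "\<And>n. bessel (m n) (y n)"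
    and opt: "\<And>n. nrm (R n) - inverse (real (Suc n)) < \<Phi> (cut (m n) (\<lambda>i. cinner (R n (x n i)) (y n i)))"
    unfolding P_def by blast+
  \<comment> \<open>The matrix coefficients of \<open>A t - compress e n (A t)\<close>, expanded so
    that each term is visibly integrable in \<open>t\<close>.\<close>
  define q where "q n t i = cinner (A t (x n i)) (y n i) - cinner (A t (proj e n (x n i))) (proj e n (y n i))" for n t i
  define \<phi> where "\<phi> n t = \<Phi> (cut (m n) (q n t))" for n t
  have q_int: "integrable M (\<lambda>t. q n t i)" for n i
    unfolding q_def by (intro Bochner_Integration.integrable_diff integrable_cinner)
  have \<phi>_int: "integrable M (\<phi> n)" for n
    unfolding \<phi>_def by (rule integrable_cut[OF q_int])
  have \<phi>_nonneg: "0 \<le> \<phi> n t" for n t by (simp add: \<phi>_def nonneg)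
  have \<phi>_lim: "(\<lambda>n. \<phi> n t) \<longlonglongrightarrow> 0" if t: "t \<in> space M" for t
  proof (rule tendsto_sandwich[OF _ _ tendsto_const])
    show "(\<lambda>n. nrm (A t - compress e n (A t))) \<longlonglongrightarrow> 0"
      using approximable[OF t] by (simp add: approximable_def)
    have "\<phi> n t \<le> nrm (A t - compress e n (A t))" for n
    proof -
      have "q n t = (\<lambda>i. cinner ((A t - compress e n (A t)) (x n i)) (y n i))"
        by (rule ext) (simp add: q_def blinfun.diff_left cinner_diff_left cinner_compress[OF ideal_bounded[OF A_ideal[OF t]]])
      then show ?thesis
        unfolding \<phi>_def using nrm_upper[OF ideal_diff(1)[OF A_ideal[OF t] ideal_compress(1)[OF A_ideal[OF t]]] b]
        by simp
    qed
    then show "\<forall>\<^sub>F n in sequentially. \<phi> n t \<le> nrm (A t - compress e n (A t))"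
      by (rule always_eventually[OF allI])
  qed (simp add: \<phi>_nonneg)
  have "\<exists>B. \<forall>n. \<bar>\<phi> n t\<bar> \<le> B" if "t \<in> space M" for t
    using convergent_imp_Bseq[OF convergentI[OF \<phi>_lim[OF that]]] by (auto simp: Bseq_def)
  then obtain S g where S: "incseq S" "S 0 = {}" "\<And>k. S k \<in> sets M" "(\<Union>k. S k) = space M"
    and g: "integrable M g" and gS: "\<And>k n t. t \<in> S k \<Longrightarrow> \<bar>\<phi> n t\<bar> \<le> real k * g t"
    using exhausting_sets[of M \<phi>, OF \<phi>_int] by metis
  have ES: "E \<inter> S k \<in> sets M" for k using E S(3) by (rule sets.Int)
  have int_lim: "(\<lambda>n. LINT t:E \<inter> S k|M. \<phi> n t) \<longlonglongrightarrow> 0" for k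
  proof -
    have "(\<lambda>n. LINT t|M. indicator (E \<inter> S k) t *\<^sub>R \<phi> n t) \<longlonglongrightarrow> (LINT t|M. 0)"
    proof (rule integral_dominated_convergence[where w = "\<lambda>t. real k * \<bar>g t\<bar>"])
      show "integrable M (\<lambda>t. real k * \<bar>g t\<bar>)" by (rule integrable_mult_right[OF integrable_abs[OF g]])
      show "(\<lambda>t. indicator (E \<inter> S k) t *\<^sub>R \<phi> n t) \<in> borel_measurable M" for n
        by (rule borel_measurable_integrable[OF integrable_mult_indicator[OF ES \<phi>_int]])
      show "AE t in M. (\<lambda>n. indicator (E \<inter> S k) t *\<^sub>R \<phi> n t) \<longlonglongrightarrow> 0"
        by (rule AE_I2) (use tendsto_mult_right_zero[OF \<phi>_lim] in simp)
      show "AE t in M. norm (indicator (E \<inter> S k) t *\<^sub>R \<phi> n t) \<le> real k * \<bar>g t\<bar>" for n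
      proof (rule AE_I2)
        fix t
        have "\<bar>\<phi> n t\<bar> \<le> real k * \<bar>g t\<bar>" if "t \<in> S k"
          using gS[OF that, of n] mult_left_mono[OF abs_ge_self[of "g t"], of "real k"] by simp
        then show "norm (indicator (E \<inter> S k) t *\<^sub>R \<phi> n t) \<le> real k * \<bar>g t\<bar>"
          by (auto simp: indicator_def)
      qed
    qed simp
    then show ?thesis by (simp add: set_lebesgue_integral_def)
  qed
  \<comment> \<open>\<open>\<nu> E\<close> splits into its part \<open>T1\<close> over
    \<open>S k\<close> and the remainder \<open>T2\<close>. Jensen bounds the compression error of
    \<open>T1\<close> by the integral; that of \<open>T2\<close> is at most
    \<open>2 * nrm T2\<close>, compression being contractive. The first summand is the slack in the
    choice of the Bessel pair.\<close>
  have key: "nrm (R n) \<le> inverse (real (Suc n)) + (LINT t:E \<inter> S k|M. \<phi> n t) + 2 * nrm (\<nu> E - \<nu> (E \<inter> S k))" for n k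
  proof -
    define T1 where "T1 = \<nu> (E \<inter> S k)"
    define T2 where "T2 = \<nu> E - \<nu> (E \<inter> S k)"
    have T1: "T1 \<in> ideal" unfolding T1_def by (rule integral_ideal[OF ES])
    have T2: "T2 \<in> ideal" unfolding T2_def by (intro ideal_diff integral_ideal ES E)
    have "R n = (T1 - compress e n T1) + (T2 - compress e n T2)"
      by (simp add: R_def T1_def T2_def compress_diff)
    then have "(\<lambda>i. cinner (R n (x n i)) (y n i)) = (\<lambda>i. cinner ((T1 - compress e n T1) (x n i)) (y n i) +
        cinner ((T2 - compress e n T2) (x n i)) (y n i))"
      by (simp add: blinfun.add_left cinner_add_left)
    then have "\<Phi> (cut (m n) (\<lambda>i. cinner (R n (x n i)) (y n i))) \<le>
        \<Phi> (cut (m n) (\<lambda>i. cinner ((T1 - compress e n T1) (x n i)) (y n i))) +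
        \<Phi> (cut (m n) (\<lambda>i. cinner ((T2 - compress e n T2) (x n i)) (y n i)))"
      using triangle_cut by simp
    moreover have "\<Phi> (cut (m n) (\<lambda>i. cinner ((T2 - compress e n T2) (x n i)) (y n i))) \<le> 2 * nrm T2"
    proof -
      have "\<Phi> (cut (m n) (\<lambda>i. cinner ((T2 - compress e n T2) (x n i)) (y n i))) \<le> nrm (T2 - compress e n T2)"
        by (rule nrm_upper[OF ideal_diff(1)[OF T2 ideal_compress(1)[OF T2]] b])
      also have "\<dots> \<le> nrm T2 + nrm (compress e n T2)" by (rule ideal_diff(2)[OF T2 ideal_compress(1)[OF T2]])
      also have "\<dots> \<le> 2 * nrm T2" using ideal_compress(2)[OF T2, of n] by simp
      finally show ?thesis .
    qed
    moreover have "\<Phi> (cut (m n) (\<lambda>i. cinner ((T1 - compress e n T1) (x n i)) (y n i))) \<le>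
        (LINT t:E \<inter> S k|M. \<phi> n t)"
    proof -
      have "cinner ((T1 - compress e n T1) (x n i)) (y n i) = (LINT t:E \<inter> S k|M. q n t i)" for i
      proof -
        have "cinner ((T1 - compress e n T1) (x n i)) (y n i) =
            cinner (T1 (x n i)) (y n i) - cinner (T1 (proj e n (x n i))) (proj e n (y n i))"
          by (simp add: blinfun.diff_left cinner_diff_left cinner_compress[OF ideal_bounded[OF T1]])
        also have "\<dots> = (LINT t:E \<inter> S k|M. q n t i)"
          unfolding q_def T1_def cinner_\<nu>[OF ES]
          by (rule set_integral_diff(2)[symmetric])
            (auto simp: set_integrable_def intro!: integrable_indicator_scaleR integrable_cinner ES)
        finally show ?thesis .
      qed
      then show ?thesis unfolding \<phi>_def using cut_set_integral_le[of "m n" M "q n", OF q_int ES] by simp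
    qed
    ultimately show ?thesis using opt[of n] by (simp add: T2_def)
  qed
  have "(\<lambda>n. nrm (R n)) \<longlonglongrightarrow> 0"
  proof (rule LIMSEQ_I)
    fix \<epsilon> :: real assume \<epsilon>: "\<epsilon> > 0"
    \<comment> \<open>\<open>k\<close> has to be fixed before \<open>n\<close>, as the integrals
      tend to 0 only for fixed \<open>k\<close>. The remainder enters twice, so the total is below
      \<open>\<epsilon> / 2 + 2 * (\<epsilon> / 8)\<close>.\<close>
    have "\<forall>\<^sub>F k in sequentially. nrm (\<nu> E - \<nu> (E \<inter> S k)) < \<epsilon> / 8"
      using order_tendstoD(2)[OF \<nu>_tendsto[OF E S], of "\<epsilon> / 8"] \<epsilon> by simp
    then obtain k where k: "nrm (\<nu> E - \<nu> (E \<inter> S k)) < \<epsilon> / 8"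
      by (auto simp: eventually_sequentially)
    have "(\<lambda>n. inverse (real (Suc n)) + (LINT t:E \<inter> S k|M. \<phi> n t)) \<longlonglongrightarrow> 0"
      by (rule tendsto_add_zero[OF LIMSEQ_inverse_real_of_nat int_lim])
    then have "\<forall>\<^sub>F n in sequentially. inverse (real (Suc n)) + (LINT t:E \<inter> S k|M. \<phi> n t) < \<epsilon> / 2"
      using \<epsilon> by (intro order_tendstoD(2)) auto
    then obtain N where N: "\<And>n. n \<ge> N \<Longrightarrow> inverse (real (Suc n)) + (LINT t:E \<inter> S k|M. \<phi> n t) < \<epsilon> / 2"
      by (auto simp: eventually_sequentially)
    have "norm (nrm (R n) - 0) < \<epsilon>" if "n \<ge> N" for n
      using key[of n k] N[OF that] k nrm_nonneg[OF R, of n] \<epsilon> unfolding real_norm_def by linarith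
    then show "\<exists>N. \<forall>n\<ge>N. norm (nrm (R n) - 0) < \<epsilon>" by blast
  qed
  then show ?thesis using integral_ideal[OF E] by (simp add: approximable_def R_def)
qed

section \<open>Bounded functionals on the closure of the finite-rank operators\<close>

context
  fixes l :: "('h \<Rightarrow>\<^sub>L 'h) \<Rightarrow> complex"
  assumes l: "l \<in> dual_space approximable nrm"
begin

lemma dual_add: "X \<in> approximable \<Longrightarrow> Y \<in> approximable \<Longrightarrow> l (X + Y) = l X + l Y"
  and dual_scale: "X \<in> approximable \<Longrightarrow> l (c *\<^sub>C X) = c * l X"
  using l by (auto simp: dual_space_def)

lemma dual_diff:
  assumes "X \<in> approximable" "Y \<in> approximable" shows "l (X - Y) = l X - l Y"
  unfolding diff_eq_add_scaleC[of X Y] dual_add[OF assms(1) approximable_scale[OF assms(2)]]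
    dual_scale[OF assms(2)] by simp

lemma dual_sum: "finite I \<Longrightarrow> (\<And>i. i \<in> I \<Longrightarrow> f i \<in> approximable) \<Longrightarrow> l (\<Sum>i\<in>I. f i) = (\<Sum>i\<in>I. l (f i))"
proof (induction I rule: finite_induct)
  case empty
  show ?case using dual_scale[OF approximable_rank_one, of 0] by simp
next
  case (insert j I)
  then show ?case using dual_add[OF insert.prems[of j] approximable_sum[of I f]] by simp
qed

lemma dual_compress:
  "l (compress e n X) = (\<Sum>i<n. \<Sum>j<n. cinner (X (e j)) (e i) * l (rank_one (e i) (e j)))"
  unfolding compress_def
  by (simp add: dual_sum dual_scale approximable_sum approximable_scale approximable_rank_one)

text \<open>The functional is linear and bounded on \<open>approximable\<close> only, so
  \<open>X - Y n\<close> must be placed there before the bound applies.\<close>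

lemma dual_tendsto:
  assumes X: "X \<in> approximable" "\<And>n. Y n \<in> approximable" and lim: "(\<lambda>n. nrm (X - Y n)) \<longlonglongrightarrow> 0"
  shows "(\<lambda>n. l (Y n)) \<longlonglongrightarrow> l X"
proof -
  have "\<exists>K. \<forall>X\<in>approximable. cmod (l X) \<le> K * nrm X"
    using l by (simp add: dual_space_def)
  then obtain K where K: "\<And>X. X \<in> approximable \<Longrightarrow> cmod (l X) \<le> K * nrm X" by blast
  have "(\<lambda>n. l X - l (Y n)) \<longlonglongrightarrow> 0"
  proof (rule Lim_null_comparison)
    show "(\<lambda>n. K * nrm (X - Y n)) \<longlonglongrightarrow> 0" by (rule tendsto_mult_right_zero[OF lim])
    have "norm (l X - l (Y n)) \<le> K * nrm (X - Y n)" for n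
    proof -
      have "X - Y n \<in> approximable"
        unfolding diff_eq_add_scaleC[of X] by (intro approximable_add approximable_scale X)
      from K[OF this] show ?thesis by (simp add: dual_diff X)
    qed
    then show "\<forall>\<^sub>F n in sequentially. norm (l X - l (Y n)) \<le> K * nrm (X - Y n)"
      by (rule always_eventually[OF allI])
  qed
  from tendsto_diff[OF tendsto_const this, of "l X"] show ?thesis by simp
qed

lemma dual_compress_tendsto: "X \<in> approximable \<Longrightarrow> (\<lambda>n. l (compress e n X)) \<longlonglongrightarrow> l X"
  by (rule dual_tendsto[OF _ approximable_compress]) (simp_all add: approximable_def)

lemma integrable_dual_compress: "integrable M (\<lambda>t. l (compress e n (A t)))"
  unfolding dual_compress
  by (intro Bochner_Integration.integrable_sum integrable_mult_left integrable_cinner)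

lemma integral_dual_compress:
  assumes E: "E \<in> sets M"
  shows "(LINT t:E|M. l (compress e n (A t))) = l (compress e n (\<nu> E))"
proof -
  have i: "integrable M (\<lambda>t. indicator E t *\<^sub>R cinner (A t f) g)" for f g
    by (rule integrable_indicator_scaleR[OF integrable_cinner E])
  have "(LINT t:E|M. l (compress e n (A t))) =
      (LINT t|M. (\<Sum>i<n. \<Sum>j<n. (indicator E t *\<^sub>R cinner (A t (e j)) (e i)) * l (rank_one (e i) (e j))))"
    unfolding set_lebesgue_integral_def dual_compress by (simp add: scaleR_sum_right)
  also have "\<dots> = (\<Sum>i<n. \<Sum>j<n. (LINT t|M. indicator E t *\<^sub>R cinner (A t (e j)) (e i)) * l (rank_one (e i) (e j)))"
    by (simp only: Bochner_Integration.integral_sum Bochner_Integration.integrable_sum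
        integrable_mult_left[OF i] integral_mult_left_zero)
  also have "\<dots> = l (compress e n (\<nu> E))"
    unfolding dual_compress cinner_\<nu>[OF E] set_lebesgue_integral_def ..
  finally show ?thesis .
qed

lemma dual_integrable:
  shows "integrable M (\<lambda>t. l (A t))" "E \<in> sets M \<Longrightarrow> (LINT t:E|M. l (A t)) = l (\<nu> E)"
proof -
  define f where "f n t = l (compress e n (A t))" for n t
  have f_int: "integrable M (f n)" for n unfolding f_def by (rule integrable_dual_compress)
  have f_lim: "(\<lambda>n. f n t) \<longlonglongrightarrow> l (A t)" if "t \<in> space M" for t
    unfolding f_def by (rule dual_compress_tendsto[OF approximable[OF that]])
  \<comment> \<open>Measurability comes from the pointwise limit of the integrable functions
    \<open>f n\<close>.\<close>
  have meas: "(\<lambda>t. l (A t)) \<in> borel_measurable M"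
    by (rule borel_measurable_LIMSEQ_metric[of f]) (use f_int f_lim in auto)
  have "\<exists>B. \<forall>n. \<bar>cmod (f n t)\<bar> \<le> B" if "t \<in> space M" for t
    using convergent_imp_Bseq[OF convergentI[OF f_lim[OF that]]] by (auto simp: Bseq_def)
  then obtain S g where S: "incseq S" "S 0 = {}" "\<And>k. S k \<in> sets M" "(\<Union>k. S k) = space M"
    and g: "integrable M g" and gS: "\<And>k n t. t \<in> S k \<Longrightarrow> \<bar>cmod (f n t)\<bar> \<le> real k * g t"
    using exhausting_sets[of M "\<lambda>n t. cmod (f n t)", OF integrable_norm[OF f_int]] by metis
  have dct: "set_integrable M (E \<inter> S k) (\<lambda>t. l (A t))"
      "(\<lambda>n. LINT t:E \<inter> S k|M. f n t) \<longlonglongrightarrow> (LINT t:E \<inter> S k|M. l (A t))"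
    if E: "E \<in> sets M" for E k
  proof -
    have ES: "E \<inter> S k \<in> sets M" using E S(3) by (rule sets.Int)
    have w: "integrable M (\<lambda>t. real k * \<bar>g t\<bar>)" by (rule integrable_mult_right[OF integrable_abs[OF g]])
    have 1: "(\<lambda>t. indicator (E \<inter> S k) t *\<^sub>R l (A t)) \<in> borel_measurable M"
      using meas ES by measurable
    have 2: "(\<lambda>t. indicator (E \<inter> S k) t *\<^sub>R f n t) \<in> borel_measurable M" for n
      by (rule borel_measurable_integrable[OF integrable_indicator_scaleR[OF f_int ES]])
    have 3: "AE t in M. (\<lambda>n. indicator (E \<inter> S k) t *\<^sub>R f n t) \<longlonglongrightarrow> indicator (E \<inter> S k) t *\<^sub>R l (A t)"
      by (rule AE_I2, rule tendsto_scaleR[OF tendsto_const], rule f_lim)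
    have 4: "AE t in M. norm (indicator (E \<inter> S k) t *\<^sub>R f n t) \<le> real k * \<bar>g t\<bar>" for n
    proof (rule AE_I2)
      fix t
      have "cmod (f n t) \<le> real k * \<bar>g t\<bar>" if "t \<in> S k"
        using gS[OF that, of n] mult_left_mono[OF abs_ge_self[of "g t"], of "real k"] by simp
      then show "norm (indicator (E \<inter> S k) t *\<^sub>R f n t) \<le> real k * \<bar>g t\<bar>"
        by (auto simp: indicator_def)
    qed
    show "set_integrable M (E \<inter> S k) (\<lambda>t. l (A t))"
      unfolding set_integrable_def by (rule integrable_dominated_convergence[OF 1 2 w 3 4])
    show "(\<lambda>n. LINT t:E \<inter> S k|M. f n t) \<longlonglongrightarrow> (LINT t:E \<inter> S k|M. l (A t))"
      unfolding set_lebesgue_integral_def by (rule integral_dominated_convergence[OF 1 2 w 3 4])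
  qed
  \<comment> \<open>Here \<open>\<nu>_approximable\<close> is indispensable: without it the values
    of \<open>l\<close> on the compressions of \<open>\<nu> (E \<inter> S k)\<close> would not be
    known to converge to \<open>l (\<nu> (E \<inter> S k))\<close>.\<close>
  have part: "(LINT t:E \<inter> S k|M. l (A t)) = l (\<nu> (E \<inter> S k))" if E: "E \<in> sets M" for E k
  proof -
    have ES: "E \<inter> S k \<in> sets M" using E S(3) by (rule sets.Int)
    have "(\<lambda>n. LINT t:E \<inter> S k|M. f n t) \<longlonglongrightarrow> l (\<nu> (E \<inter> S k))"
      unfolding f_def integral_dual_compress[OF ES] by (rule dual_compress_tendsto[OF \<nu>_approximable[OF ES]])
    then show ?thesis using dct(2)[OF E] LIMSEQ_unique by blast
  qed
  \<comment> \<open>Norm convergence of the measure along the exhaustion passes through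
    \<open>l\<close>; it precedes integrability of \<open>l (A t)\<close> and is what proves
    it.\<close>
  have lim: "(\<lambda>k. LINT t:E \<inter> S k|M. l (A t)) \<longlonglongrightarrow> l (\<nu> E)" if E: "E \<in> sets M" for E
    unfolding part[OF E]
    by (rule dual_tendsto[OF \<nu>_approximable[OF E] \<nu>_approximable \<nu>_tendsto[OF E S]]) (use E S(3) in auto)
  show int: "integrable M (\<lambda>t. l (A t))"
  proof (rule integrable_if_set_integrals_convergent[OF meas S(1,3,4)])
    show "set_integrable M (S k) (\<lambda>t. l (A t))" for k
      using dct(1)[OF S(3)[of k], of k] by simp
    show "convergent (\<lambda>k. LINT t:E \<inter> S k|M. l (A t))" if "E \<in> sets M" for E
      using lim[OF that] by (rule convergentI)
  qed
  show "(LINT t:E|M. l (A t)) = l (\<nu> E)" if E: "E \<in> sets M"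
    using set_integral_incseq[OF int E S(1,3,4)] lim[OF E] LIMSEQ_unique by blast
qed

end

end

theorem theorem2p1:
  fixes M :: "'t measure"
    and \<Phi> :: "(nat \<Rightarrow> complex) \<Rightarrow> real"
    and \<A> :: "'t \<Rightarrow> 'h::complex_hilbert_space \<Rightarrow>\<^sub>L 'h"
  assumes "infinite_dimensional TYPE('h)"
    and "separable_space (euclidean :: 'h topology)"
    and "complete_measure M"
    and "sn_function \<Phi>"
    and "weak_star_integrable M \<A>"
    and "\<forall>t\<in>space M. \<A> t \<in> C0_ideal \<Phi>"
    and "\<forall>E\<in>sets M. weak_star_integral M \<A> E \<in> C_ideal \<Phi>"
    and "countably_additive_in (C_norm \<Phi>) M (weak_star_integral M \<A>)"
  shows "pettis_integrable M (C0_ideal \<Phi>) (C_norm \<Phi>) \<A>"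
proof -
  obtain e :: "nat \<Rightarrow> 'h" where e: "orthonormal0_basis e"
    using orthonormal0_basis_exists[OF assms(2)] by blast
  interpret separable_ideal \<Phi> e
    by unfold_locales (fact assms(4), fact e)
  interpret weak_star_measure \<Phi> e M \<A>
    by unfold_locales (use assms in \<open>simp_all add: C0_ideal_eq_approximable\<close>)
  \<comment> \<open>The operator demanded for each \<open>E\<close> is \<open>\<nu> E\<close>
    itself.\<close>
  show ?thesis
    unfolding pettis_integrable_def C0_ideal_eq_approximable
    using approximable dual_integrable \<nu>_approximable integrable_imp_mu_measurable by metis
qed

end
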